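(* Let $\Omega$ be the pinwheel tiling space and let $H_2\cong\mathbb{Z}_2$ be the group generated by rotation of $\mathbb{R}^2$ by 180 degrees about the origin. Let $\Omega_{H_2}$ be the subspace of tilings in $\Omega$ that are fixed by $H_2$. Then, up to rotation about the origin, there are exactly six $H_2$-invariant tilings in $\Omega$; the space $\Omega_{H_2}$ is a disjoint union of six circles, and hence $$\check H^0(\Omega_{H_2})\cong\check H^1(\Omega_{H_2})\cong\mathbb{Z}^6 .$$
   Context: Pinwheel substitution: the only tile, up to congruence (translations, rotations and reflections), is the right triangle with legs $1,2$ and hypotenuse $\sqrt5$. The substitution $\sigma$ dilates a tile by $\sqrt5$ about the origin of $\mathbb{R}^2$ and subdivides the resulting triangle into five triangles congruent to the original tile. Up to congruence the subdivision is the following. The dilated triangle has right-angle vertex $R=(-\tfrac32,-\tfrac12)$ and other vertices $P=(\tfrac12,-\tfrac32)$, $S=(\tfrac12,\tfrac72)$. With $F=(\tfrac12,-\tfrac12)$, $M_1=(\tfrac12,\tfrac32)$, $M_2=(-\tfrac12,\tfrac32)$, $M_3=(-\tfrac12,-\tfrac12)$, the five pieces are the triangles $PFR$, $RM_3M_2$, $M_3FM_2$, $M_1FM_2$, $M_1SM_2$. For any other tile the subdivision is obtained by transporting this picture by the corresponding isometry. $\sigma$ extends to patches and tilings tile by tile. $\Omega$ is the set of all tilings of $\mathbb{R}^2$ by such triangles for which every finite patch is congruent to a subpatch of $\sigma^n(t)$ for some tile $t$ and some $n\ge0$. The topology on $\Omega$: two tilings are close if they agree on a large ball about the origin after applying to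 each a small rigid motion (a small translation combined with a small rotation about the origin). The group $O(2)$ acts on $\Omega$ by acting on $\mathbb{R}^2$ about the origin. $\check H^*$ denotes Čech cohomology with integer coefficients. *)

theory Defs
  imports "HOL-Analysis.Analysis" "HOL-Algebra.Product_Groups" "HOL-Algebra.Elementary_Groups"
begin

section \<open>Pinwheel tilings\<close>

text \<open>
  The plane is \<^typ>\<open>complex\<close>, with \<open>Complex x y\<close> for the point \<open>(x, y)\<close>.
  A tile is a closed triangle, hence a set of points.  The triangle is scalene, so such a set
  determines its vertices, and the isometry between two tiles is unique.
\<close>

type_synonym tile = "complex set"

text \<open>Distance-preserving self-maps of the plane are bijective, so these are exactly the
  compositions of translations, rotations and reflections.\<close>

definition plane_isometry :: "(complex \<Rightarrow> complex) \<Rightarrow> bool" where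
  "plane_isometry g \<longleftrightarrow> (\<forall>x y. dist (g x) (g y) = dist x y)"

definition move :: "(complex \<Rightarrow> complex) \<Rightarrow> tile set \<Rightarrow> tile set" where
  "move g T = (\<lambda>t. g ` t) ` T"

definition congruent_patches :: "tile set \<Rightarrow> tile set \<Rightarrow> bool" where
  "congruent_patches P Q \<longleftrightarrow> (\<exists>g. plane_isometry g \<and> move g P = Q)"

definition is_tile :: "tile \<Rightarrow> bool" where
  "is_tile t \<longleftrightarrow> (\<exists>g. plane_isometry g \<and> t = g ` (convex hull {0, 1, Complex 0 2}))"

definition dilated_prototile :: "complex set" where
  "dilated_prototile =
     convex hull {Complex (-3/2) (-1/2), Complex (1/2) (-3/2), Complex (1/2) (7/2)}"

definition prototile_pieces :: "tile set" where
  "prototile_pieces =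
     (let R = Complex (-3/2) (-1/2); P = Complex (1/2) (-3/2); S = Complex (1/2) (7/2);
          F = Complex (1/2) (-1/2); M1 = Complex (1/2) (3/2);
          M2 = Complex (-1/2) (3/2); M3 = Complex (-1/2) (-1/2)
      in {convex hull {P, F, R}, convex hull {R, M3, M2}, convex hull {M3, F, M2},
          convex hull {M1, F, M2}, convex hull {M1, S, M2}})"

text \<open>For a tile \<open>t\<close> there is exactly one isometry \<open>h\<close> as below.\<close>

definition subst_tile :: "tile \<Rightarrow> tile set" where
  "subst_tile t = {h ` p | h p. plane_isometry h \<and>
       h ` dilated_prototile = (\<lambda>z. sqrt 5 *\<^sub>R z) ` t \<and> p \<in> prototile_pieces}"

definition subst :: "tile set \<Rightarrow> tile set" where
  "subst P = (\<Union>t\<in>P. subst_tile t)"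

definition is_tiling :: "tile set \<Rightarrow> bool" where
  "is_tiling T \<longleftrightarrow> (\<forall>t\<in>T. is_tile t) \<and> \<Union>T = UNIV \<and>
     pairwise (\<lambda>s t. interior s \<inter> interior t = {}) T"

definition pinwheel_space :: "tile set set" where
  "pinwheel_space = {T. is_tiling T \<and>
     (\<forall>P. P \<subseteq> T \<and> finite P \<longrightarrow>
        (\<exists>t n Q. is_tile t \<and> Q \<subseteq> (subst ^^ n) {t} \<and> congruent_patches P Q))}"


section \<open>The topology of the tiling space\<close>

definition rotation :: "real \<Rightarrow> complex \<Rightarrow> complex" where
  "rotation \<theta> z = cis \<theta> * z"

definition tiles_meeting :: "complex set \<Rightarrow> tile set \<Rightarrow> tile set" where
  "tiles_meeting B T = {t \<in> T. t \<inter> B \<noteq> {}}"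

definition tilings_close :: "real \<Rightarrow> tile set \<Rightarrow> tile set \<Rightarrow> bool" where
  "tilings_close \<epsilon> T T' \<longleftrightarrow>
     (\<exists>\<theta> v \<theta>' v'. \<bar>\<theta>\<bar> < \<epsilon> \<and> norm v < \<epsilon> \<and> \<bar>\<theta>'\<bar> < \<epsilon> \<and> norm v' < \<epsilon> \<and>
        tiles_meeting (ball 0 (1 / \<epsilon>)) (move (\<lambda>z. rotation \<theta> z + v) T) =
        tiles_meeting (ball 0 (1 / \<epsilon>)) (move (\<lambda>z. rotation \<theta>' z + v') T'))"

definition pinwheel_open :: "tile set set \<Rightarrow> bool" where
  "pinwheel_open U \<longleftrightarrow> U \<subseteq> pinwheel_space \<and>
     (\<forall>T\<in>U. \<exists>\<epsilon>>0. \<forall>T'\<in>pinwheel_space. tilings_close \<epsilon> T T' \<longrightarrow> T' \<in> U)"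

definition pinwheel_topology :: "tile set topology" where
  "pinwheel_topology = topology pinwheel_open"

lemma tilings_close_mono:
  assumes "tilings_close \<delta> T T'" "0 < \<delta>" "\<delta> \<le> \<epsilon>"
  shows "tilings_close \<epsilon> T T'"
proof -
  obtain \<theta> v \<theta>' v' where *: "\<bar>\<theta>\<bar> < \<delta>" "norm v < \<delta>" "\<bar>\<theta>'\<bar> < \<delta>" "norm v' < \<delta>"
    and eq: "tiles_meeting (ball 0 (1 / \<delta>)) (move (\<lambda>z. rotation \<theta> z + v) T) =
        tiles_meeting (ball 0 (1 / \<delta>)) (move (\<lambda>z. rotation \<theta>' z + v') T')"
    using assms(1) unfolding tilings_close_def by blast
  have shrink: "tiles_meeting (ball 0 (1 / \<epsilon>)) X =
      tiles_meeting (ball 0 (1 / \<epsilon>)) (tiles_meeting (ball 0 (1 / \<delta>)) X)" for X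
  proof -
    have "1 / \<epsilon> \<le> 1 / \<delta>"
      using assms by (simp add: frac_le)
    then have "ball (0::complex) (1 / \<epsilon>) \<subseteq> ball 0 (1 / \<delta>)"
      by (rule subset_ball)
    then show ?thesis
      unfolding tiles_meeting_def by blast
  qed
  have "tiles_meeting (ball 0 (1 / \<epsilon>)) (move (\<lambda>z. rotation \<theta> z + v) T) =
        tiles_meeting (ball 0 (1 / \<epsilon>)) (move (\<lambda>z. rotation \<theta>' z + v') T')"
    by (metis shrink eq)
  moreover have "\<bar>\<theta>\<bar> < \<epsilon>" "norm v < \<epsilon>" "\<bar>\<theta>'\<bar> < \<epsilon>" "norm v' < \<epsilon>"
    using * assms(3) by linarith+
  ultimately show ?thesis
    unfolding tilings_close_def by blast
qed

lemma istopology_pinwheel_open: "istopology pinwheel_open"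
  unfolding istopology_def
proof (intro conjI allI impI)
  fix S U assume S: "pinwheel_open S" and U: "pinwheel_open U"
  show "pinwheel_open (S \<inter> U)"
    unfolding pinwheel_open_def
  proof (intro conjI ballI)
    show "S \<inter> U \<subseteq> pinwheel_space"
      using S unfolding pinwheel_open_def by blast
    fix T assume T: "T \<in> S \<inter> U"
    obtain d where d: "d > 0" "\<forall>T'\<in>pinwheel_space. tilings_close d T T' \<longrightarrow> T' \<in> S"
      using S T unfolding pinwheel_open_def by blast
    obtain e where e: "e > 0" "\<forall>T'\<in>pinwheel_space. tilings_close e T T' \<longrightarrow> T' \<in> U"
      using U T unfolding pinwheel_open_def by blast
    have "min d e > 0" using d e by simp
    moreover have "\<forall>T'\<in>pinwheel_space. tilings_close (min d e) T T' \<longrightarrow> T' \<in> S \<inter> U"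
      using d e tilings_close_mono[of "min d e" T _ d] tilings_close_mono[of "min d e" T _ e]
      by auto
    ultimately show "\<exists>\<epsilon>>0. \<forall>T'\<in>pinwheel_space. tilings_close \<epsilon> T T' \<longrightarrow> T' \<in> S \<inter> U"
      by blast
  qed
next
  fix \<K> assume "\<forall>K\<in>\<K>. pinwheel_open K"
  then show "pinwheel_open (\<Union>\<K>)"
    unfolding pinwheel_open_def by (meson UnionE UnionI Union_least)
qed

lemma openin_pinwheel_topology: "openin pinwheel_topology = pinwheel_open"
  unfolding pinwheel_topology_def by (rule topology_inverse'[OF istopology_pinwheel_open])

lemma topspace_pinwheel_topology [simp]: "topspace pinwheel_topology = pinwheel_space"
proof -
  have "pinwheel_open pinwheel_space"
    unfolding pinwheel_open_def using zero_less_one by blast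
  then show ?thesis
    unfolding topspace_def openin_pinwheel_topology
    by (intro equalityI Union_least Union_upper) (simp_all add: pinwheel_open_def)
qed


section \<open>Tilings with a given symmetry\<close>

text \<open>The rotation has finite order, so its natural-number powers form the generated group.\<close>

definition H2 :: "(complex \<Rightarrow> complex) set" where
  "H2 = range (\<lambda>k::nat. rotation pi ^^ k)"

lemma H2_eq: "H2 = {id, rotation pi}"
proof -
  have pow: "rotation pi ^^ k = (if even k then id else rotation pi)" for k
    by (induction k) (auto simp: fun_eq_iff rotation_def)
  have "id \<in> H2" "rotation pi \<in> H2"
    unfolding H2_def using rangeI[of "\<lambda>k. rotation pi ^^ k" 0]
      rangeI[of "\<lambda>k. rotation pi ^^ k" 1] by auto
  moreover have "H2 \<subseteq> {id, rotation pi}"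
    unfolding H2_def by (auto simp: pow)
  ultimately show ?thesis
    by blast
qed

definition invariant_tilings :: "(complex \<Rightarrow> complex) set \<Rightarrow> tile set set" where
  "invariant_tilings H = {T \<in> pinwheel_space. \<forall>g\<in>H. move g T = T}"

definition invariant_tiling_space :: "(complex \<Rightarrow> complex) set \<Rightarrow> tile set topology" where
  "invariant_tiling_space H = subtopology pinwheel_topology (invariant_tilings H)"

definition rotation_related :: "(tile set \<times> tile set) set" where
  "rotation_related = {(T, T'). \<exists>\<theta>. T' = move (rotation \<theta>) T}"


section \<open>Direct limits of groups\<close>

text \<open>
  \<open>I\<close> is an index set directed by \<open>before\<close>, with groups \<open>G i\<close> and transition maps
  \<open>f i j\<close> from \<open>G i\<close> to \<open>G j\<close> for \<open>before i j\<close>.  Any two classes have representatives over a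
  common index; they are multiplied there.
\<close>

definition direct_limit_rel ::
  "'i set \<Rightarrow> ('i \<Rightarrow> 'i \<Rightarrow> bool) \<Rightarrow> ('i \<Rightarrow> 'a monoid) \<Rightarrow> ('i \<Rightarrow> 'i \<Rightarrow> 'a \<Rightarrow> 'a) \<Rightarrow>
     (('i \<times> 'a) \<times> ('i \<times> 'a)) set" where
  "direct_limit_rel I before G f =
     {((i, x), (j, y)). i \<in> I \<and> j \<in> I \<and> x \<in> carrier (G i) \<and> y \<in> carrier (G j) \<and>
        (\<exists>k\<in>I. before i k \<and> before j k \<and> f i k x = f j k y)}"

definition direct_limit ::
  "'i set \<Rightarrow> ('i \<Rightarrow> 'i \<Rightarrow> bool) \<Rightarrow> ('i \<Rightarrow> 'a monoid) \<Rightarrow> ('i \<Rightarrow> 'i \<Rightarrow> 'a \<Rightarrow> 'a) \<Rightarrow>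
     ('i \<times> 'a) set monoid" where
  "direct_limit I before G f =
     (let r = direct_limit_rel I before G f in
      \<lparr>carrier = (SIGMA i:I. carrier (G i)) // r,
       monoid.mult = (\<lambda>A B. r `` {(k, x \<otimes>\<^bsub>G k\<^esub> y) | k x y. (k, x) \<in> A \<and> (k, y) \<in> B}),
       one = r `` {(i, \<one>\<^bsub>G i\<^esub>) | i. i \<in> I}\<rparr>)"


section \<open>Cech cohomology with integer coefficients\<close>

text \<open>
  Ordered cochains of the nerve: an \<open>n\<close>-simplex is a list of \<open>n + 1\<close> members of the cover, with
  repetitions allowed, that have a common point.  Cochains vanish off the simplices, so that
  equality of functions is equality of cochains.
\<close>

definition nerve_simplices :: "nat \<Rightarrow> 'a set set \<Rightarrow> 'a set list set" where
  "nerve_simplices n \<U> = {s. length s = Suc n \<and> set s \<subseteq> \<U> \<and> \<Inter>(set s) \<noteq> {}}"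

definition nerve_cochains :: "nat \<Rightarrow> 'a set set \<Rightarrow> ('a set list \<Rightarrow> int) set" where
  "nerve_cochains n \<U> = {c. \<forall>s. s \<notin> nerve_simplices n \<U> \<longrightarrow> c s = 0}"

definition omit :: "nat \<Rightarrow> 'b list \<Rightarrow> 'b list" where
  "omit i s = take i s @ drop (Suc i) s"

definition nerve_coboundary ::
  "nat \<Rightarrow> 'a set set \<Rightarrow> ('a set list \<Rightarrow> int) \<Rightarrow> 'a set list \<Rightarrow> int" where
  "nerve_coboundary n \<U> c =
     (\<lambda>s. if s \<in> nerve_simplices (Suc n) \<U> then \<Sum>i\<le>Suc n. (-1) ^ i * c (omit i s) else 0)"

definition nerve_cocycles :: "nat \<Rightarrow> 'a set set \<Rightarrow> ('a set list \<Rightarrow> int) set" where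
  "nerve_cocycles n \<U> = {c \<in> nerve_cochains n \<U>. nerve_coboundary n \<U> c = (\<lambda>s. 0)}"

fun nerve_coboundaries :: "nat \<Rightarrow> 'a set set \<Rightarrow> ('a set list \<Rightarrow> int) set" where
  "nerve_coboundaries 0 \<U> = {\<lambda>s. 0}"
| "nerve_coboundaries (Suc n) \<U> = nerve_coboundary n \<U> ` nerve_cochains n \<U>"

definition nerve_cocycle_group :: "nat \<Rightarrow> 'a set set \<Rightarrow> ('a set list \<Rightarrow> int) monoid" where
  "nerve_cocycle_group n \<U> =
     \<lparr>carrier = nerve_cocycles n \<U>, monoid.mult = (\<lambda>c d s. c s + d s), one = (\<lambda>s. 0)\<rparr>"

definition nerve_cohomology :: "nat \<Rightarrow> 'a set set \<Rightarrow> ('a set list \<Rightarrow> int) set monoid" where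
  "nerve_cohomology n \<U> = nerve_cocycle_group n \<U> Mod nerve_coboundaries n \<U>"

definition open_covers :: "'a topology \<Rightarrow> 'a set set set" where
  "open_covers X = {\<U>. (\<forall>U\<in>\<U>. openin X U) \<and> \<Union>\<U> = topspace X}"

definition refinement_projections :: "'a set set \<Rightarrow> 'a set set \<Rightarrow> ('a set \<Rightarrow> 'a set) set" where
  "refinement_projections \<U> \<V> = {p. \<forall>V\<in>\<V>. p V \<in> \<U> \<and> V \<subseteq> p V}"

definition refined_by :: "'a set set \<Rightarrow> 'a set set \<Rightarrow> bool" where
  "refined_by \<U> \<V> \<longleftrightarrow> (\<forall>V\<in>\<V>. \<exists>U\<in>\<U>. V \<subseteq> U)"

definition nerve_pullback ::
  "nat \<Rightarrow> 'a set set \<Rightarrow> ('a set \<Rightarrow> 'a set) \<Rightarrow> ('a set list \<Rightarrow> int) \<Rightarrow> 'a set list \<Rightarrow> int" where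
  "nerve_pullback n \<V> p c = (\<lambda>s. if s \<in> nerve_simplices n \<V> then c (map p s) else 0)"

text \<open>
  The cosets in the following union coincide: different projections induce the same map on
  cohomology, so the union is the image of the class \<open>A\<close> in the cohomology of the finer cover.
\<close>

definition refinement_map ::
  "nat \<Rightarrow> 'a set set \<Rightarrow> 'a set set \<Rightarrow> ('a set list \<Rightarrow> int) set \<Rightarrow> ('a set list \<Rightarrow> int) set" where
  "refinement_map n \<U> \<V> A =
     (\<Union>p\<in>refinement_projections \<U> \<V>. \<Union>c\<in>A.
        nerve_coboundaries n \<V> #>\<^bsub>nerve_cocycle_group n \<V>\<^esub> nerve_pullback n \<V> p c)"

definition cech_cohomology ::
  "nat \<Rightarrow> 'a topology \<Rightarrow> ('a set set \<times> ('a set list \<Rightarrow> int) set) set monoid" where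
  "cech_cohomology n X =
     direct_limit (open_covers X) refined_by (nerve_cohomology n) (refinement_map n)"

end

theory Submission
  imports Defs
begin

text \<open>
  In a tiling fixed by the half-turn about the origin, the star of tiles at the origin is fixed too.
  By recognizability such a tiling desubstitutes to another one, whose star at the origin is again
  fixed, so every central star is the substitution of a central star. Only six half-turn invariant
  stars occur up to rotation, and the fourth power of the substitution fixes each of them; hence
  a tiling is recovered from its central star, as the union of the iterated substitutions of it.
  A star comes back to itself exactly after a rotation by a multiple of \<open>pi\<close>, so each
  family of rotated tilings is a circle with the square of the rotation as coordinate. On a disjoint
  union of circles the classes of Cech 1-cocycles are separated by their holonomies along the circles,
  which can be prescribed arbitrarily.
\<close>

section \<open>Isometries and tiles\<close>

text \<open>Recognizability rests on one adjacency. The pieces \<open>q1\<close> and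
  \<open>q3\<close> of a dilated tile meet with a short leg along the half of a long leg next to its
  right angle (\<open>gLb\<close>). Tracing all stars through one substitution shows that the middle
  of such a contact is always interior to a single dilated tile, so the pair betrays its parent. The
  obstacle to a finite tracing is the variety of stars made of acute corners. They are not listed:
  an acute corner has exactly one child at the dilated point, so the asymmetry of such a star is
  never lost, and the symmetric ones that arise are \<open>fanA\<close> and \<open>fanB\<close>. The
  number six: symmetric stars are two tiles around the middle of a common hypotenuse, two tiles
  around the middle of a common half of a long leg, the rhombus \<open>fanM\<close>, and the two
  acute fans. The two-tile stars have two mirror forms each, the acute fans are rotated copies of
  their mirror images, and the rhombus is not the substitution of any symmetric star: 2 + 2 + 1 + 1.
  The substitution permutes the two-tile stars in a cycle of length four and the fans in one of
  length two, whence the fourth power.\<close>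

abbreviation ginv :: "(complex \<Rightarrow> complex) \<Rightarrow> complex \<Rightarrow> complex" where
  "ginv \<equiv> inv_into UNIV"

definition conj_if :: "bool \<Rightarrow> complex \<Rightarrow> complex" where
  "conj_if b z = (if b then cnj z else z)"

definition euclid :: "bool \<Rightarrow> complex \<Rightarrow> complex \<Rightarrow> complex \<Rightarrow> complex" where
  "euclid b w v z = w * conj_if b z + v"

lemma plane_isometry_euclid:
  assumes "norm w = 1" shows "plane_isometry (euclid b w v)"
proof -
  have "dist (euclid b w v x) (euclid b w v y) = dist x y" for x y
  proof -
    have "euclid b w v x - euclid b w v y = w * conj_if b (x - y)"
      by (simp add: euclid_def conj_if_def algebra_simps)
    then show ?thesis
      using assms by (simp add: dist_norm norm_mult conj_if_def flip: complex_cnj_diff)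
  qed
  then show ?thesis by (simp add: plane_isometry_def)
qed

text \<open>Distances to 0 and 1 fix \<open>Re\<close> and the square of \<open>Im\<close>.
  Comparing two points (\<open>cross\<close>) makes products of imaginary parts invariant as well,
  so the sign taken at \<open>\<i>\<close> is the sign everywhere.\<close>

lemma isometry_fixing_0_1:
  assumes iso: "plane_isometry k" and k0: "k 0 = 0" and k1: "k 1 = 1"
  shows "k = id \<or> k = cnj"
proof -
  have d: "(Re (k x) - Re (k y))\<^sup>2 + (Im (k x) - Im (k y))\<^sup>2 = (Re x - Re y)\<^sup>2 + (Im x - Im y)\<^sup>2" for x y
  proof -
    have "(norm (k x - k y))\<^sup>2 = (norm (x - y))\<^sup>2"
      using iso by (simp add: plane_isometry_def dist_norm)
    then show ?thesis by (simp add: cmod_power2)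
  qed
  have re: "Re (k z) = Re z" for z
    using d[of z 0] d[of z 1] k0 k1 by (simp add: power2_eq_square algebra_simps)
  have im: "(Im (k z))\<^sup>2 = (Im z)\<^sup>2" for z
    using d[of z 0] k0 re[of z] by simp
  have cross: "Im (k x) * Im (k y) = Im x * Im y" for x y
    using d[of x y] im[of x] im[of y] re[of x] re[of y]
    by (simp add: power2_eq_square algebra_simps)
  have "Im (k \<i>) = 1 \<or> Im (k \<i>) = -1"
    using im[of \<i>] by (simp add: power2_eq_1_iff)
  then show ?thesis
  proof
    assume "Im (k \<i>) = 1"
    then have "k z = z" for z using cross[of z \<i>] re[of z] by (simp add: complex_eq_iff)
    then show ?thesis by (simp add: fun_eq_iff)
  next
    assume "Im (k \<i>) = -1"
    then have "k z = cnj z" for z using cross[of z \<i>] re[of z] by (simp add: complex_eq_iff)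
    then show ?thesis by (simp add: fun_eq_iff)
  qed
qed

lemma plane_isometry_iff:
  "plane_isometry g \<longleftrightarrow> (\<exists>b w v. norm w = 1 \<and> g = euclid b w v)"
proof
  assume iso: "plane_isometry g"
  define w where "w = g 1 - g 0"
  have dg: "dist (g x) (g y) = dist x y" for x y
    using iso by (simp add: plane_isometry_def)
  have w: "norm w = 1" using dg[of 1 0] by (simp add: w_def dist_norm)
  then have w0: "w \<noteq> 0" by auto
  define k where "k z = (g z - g 0) / w" for z
  have "dist (k x) (k y) = dist x y" for x y
  proof -
    have "k x - k y = (g x - g y) / w" by (simp add: k_def diff_divide_distrib)
    then show ?thesis using dg[of x y] w by (simp add: dist_norm norm_divide)
  qed
  then have "plane_isometry k" by (simp add: plane_isometry_def)
  moreover have "k 0 = 0" "k 1 = 1" using w0 by (simp_all add: k_def w_def)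
  ultimately have "k = id \<or> k = cnj" by (rule isometry_fixing_0_1)
  moreover have gk: "g z = w * k z + g 0" for z using w0 by (simp add: k_def)
  have "g = euclid False w (g 0)" if "k = id"
    by (rule ext, subst gk) (simp add: that euclid_def conj_if_def)
  moreover have "g = euclid True w (g 0)" if "k = cnj"
    by (rule ext, subst gk) (simp add: that euclid_def conj_if_def)
  ultimately show "\<exists>b w v. norm w = 1 \<and> g = euclid b w v" using w by blast
qed (auto intro: plane_isometry_euclid)

lemma plane_isometry_comp:
  "plane_isometry g \<Longrightarrow> plane_isometry h \<Longrightarrow> plane_isometry (g \<circ> h)"
  by (simp add: plane_isometry_def)

lemma plane_isometry_inj: "plane_isometry g \<Longrightarrow> inj g"
  unfolding plane_isometry_def by (metis dist_eq_0_iff injI)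

lemma plane_isometry_surj:
  assumes "plane_isometry g" shows "surj g"
proof -
  obtain b w v where g: "norm w = 1" "g = euclid b w v"
    using assms plane_isometry_iff by auto
  then have "w \<noteq> 0" by auto
  then have "g (conj_if b ((z - v) / w)) = z" for z
    unfolding g by (cases b) (simp_all add: euclid_def conj_if_def)
  then show ?thesis by (metis surj_def)
qed

lemma plane_isometry_bij: "plane_isometry g \<Longrightarrow> bij g"
  by (simp add: bij_def plane_isometry_inj plane_isometry_surj)

lemma plane_isometry_inv:
  assumes "plane_isometry g" shows "plane_isometry (ginv g)"
  using assms plane_isometry_surj[OF assms] unfolding plane_isometry_def
  by (metis surj_f_inv_f)

lemma plane_isometry_inv_comp [simp]:
  assumes "plane_isometry g" shows "g \<circ> ginv g = id" "ginv g \<circ> g = id"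
    "g (ginv g z) = z" "ginv g (g z) = z"
  using plane_isometry_inj[OF assms] plane_isometry_surj[OF assms]
  by (auto simp: fun_eq_iff surj_f_inv_f)

lemma plane_isometry_id: "plane_isometry id" "plane_isometry (\<lambda>z. z)"
  by (simp_all add: plane_isometry_def)

lemma plane_isometry_continuous:
  assumes "plane_isometry g" shows "continuous_on S g"
proof -
  obtain b w v where g: "g = euclid b w v" using assms plane_isometry_iff by auto
  show ?thesis unfolding g euclid_def[abs_def] conj_if_def
    by (cases b) (auto intro!: continuous_intros)
qed

lemma plane_isometry_open_image:
  assumes "plane_isometry g" "open S" shows "open (g ` S)"
proof -
  have "g ` S = ginv g -` S"
    using plane_isometry_bij[OF assms(1)] by (simp add: bij_vimage_eq_inv_image bij_imp_bij_inv inv_inv_eq)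
  then show ?thesis
    using open_vimage[OF assms(2) plane_isometry_continuous[OF plane_isometry_inv[OF assms(1)]]] by simp
qed

lemma plane_isometry_interior:
  assumes "plane_isometry g" shows "interior (g ` S) = g ` interior S"
proof
  show "g ` interior S \<subseteq> interior (g ` S)"
    by (rule interior_maximal) (auto intro: plane_isometry_open_image assms simp: interior_subset image_mono)
  have "ginv g ` interior (g ` S) \<subseteq> interior S"
  proof (rule interior_maximal)
    have "ginv g ` interior (g ` S) \<subseteq> ginv g ` (g ` S)" by (intro image_mono interior_subset)
    also have "\<dots> = S" by (simp add: image_image assms)
    finally show "ginv g ` interior (g ` S) \<subseteq> S" .
  qed (intro plane_isometry_open_image plane_isometry_inv assms open_interior)
  then have "g ` (ginv g ` interior (g ` S)) \<subseteq> g ` interior S" by (rule image_mono)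
  then show "interior (g ` S) \<subseteq> g ` interior S" by (simp add: image_image assms)
qed

lemma plane_isometry_convex_hull:
  assumes "plane_isometry g" shows "g ` (convex hull S) = convex hull (g ` S)"
proof -
  obtain b w v where g: "g = euclid b w v" using assms plane_isometry_iff by auto
  have lin: "linear (\<lambda>z. w * conj_if b z)"
    by (rule linearI) (simp_all add: conj_if_def algebra_simps scaleR_conv_of_real)
  have g': "g = (\<lambda>z. v + z) \<circ> (\<lambda>z. w * conj_if b z)" by (auto simp: g euclid_def)
  show ?thesis unfolding g' image_comp[symmetric] convex_hull_linear_image[OF lin] convex_hull_translation ..
qed

section \<open>The prototile and its rigidity\<close>

definition proto :: "complex set" where
  "proto = {z. 0 \<le> Re z \<and> 0 \<le> Im z \<and> 2 * Re z + Im z \<le> 2}"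

text \<open>A tile is handled through the motion that places the prototile. By
  \<open>tile_of_inj\<close> this motion is unique, so equalities of tiles become equalities of
  maps.\<close>

definition tile_of :: "(complex \<Rightarrow> complex) \<Rightarrow> complex set" where
  "tile_of h = h ` proto"

lemma proto_hull: "proto = convex hull {0, 1, Complex 0 2}"
proof -
  have "z \<in> convex hull {0, 1, Complex 0 2}" if "z \<in> proto" for z
    unfolding convex_hull_3
    using that by (intro CollectI exI[of _ "1 - Re z - Im z / 2"] exI[of _ "Re z"] exI[of _ "Im z / 2"])
      (auto simp: proto_def complex_eq_iff)
  moreover have "z \<in> proto" if "z \<in> convex hull {0, 1, Complex 0 2}" for z
    using that unfolding convex_hull_3 by (auto simp: proto_def)
  ultimately show ?thesis by blast
qed

lemma is_tile_iff: "is_tile t \<longleftrightarrow> (\<exists>h. plane_isometry h \<and> t = tile_of h)"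
  by (simp add: is_tile_def tile_of_def proto_hull)

lemma is_tile_tile_of: "plane_isometry h \<Longrightarrow> is_tile (tile_of h)"
  using is_tile_iff by blast

lemma proto_interior: "interior proto = {z. 0 < Re z \<and> 0 < Im z \<and> 2 * Re z + Im z < 2}"
proof
  show "{z. 0 < Re z \<and> 0 < Im z \<and> 2 * Re z + Im z < 2} \<subseteq> interior proto"
  proof (rule interior_maximal)
    have "{z. 0 < Re z \<and> 0 < Im z \<and> 2 * Re z + Im z < 2} =
      {z. 0 < Re z} \<inter> {z. 0 < Im z} \<inter> {z. 2 * Re z + Im z < 2}" by auto
    then show "open {z. 0 < Re z \<and> 0 < Im z \<and> 2 * Re z + Im z < 2}"
      by (auto intro!: open_Int open_Collect_less continuous_intros)
  qed (auto simp: proto_def)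
  show "interior proto \<subseteq> {z. 0 < Re z \<and> 0 < Im z \<and> 2 * Re z + Im z < 2}"
  proof
    fix z assume "z \<in> interior proto"
    then obtain e where e: "e > 0" "cball z e \<subseteq> proto" by (meson mem_interior_cball)
    have in_p: "z + d \<in> proto" if "norm d \<le> e" for d
      using e that by (auto simp: dist_norm intro!: subsetD[OF e(2)])
    have "z + of_real (-e) \<in> proto" "z + of_real e \<in> proto" "z + \<i> * of_real (-e) \<in> proto"
      using e by (auto intro!: in_p simp: norm_mult)
    then show "z \<in> {z. 0 < Re z \<and> 0 < Im z \<and> 2 * Re z + Im z < 2}"
      using e(1) by (auto simp: proto_def)
  qed
qed

text \<open>The triangle lies in a 1 by 2 box, so a chord of length sqrt 5 has both coordinate
  differences extreme. Hence an isometry into the triangle must respect the hypotenuse.\<close>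

lemma proto_diameter:
  assumes "z \<in> proto" "z' \<in> proto" "dist z z' = dist 1 (2 * \<i>)"
  shows "z = 1 \<and> z' = 2 * \<i> \<or> z = 2 * \<i> \<and> z' = 1"
proof -
  obtain a b where z: "z = Complex a b" by (cases z)
  obtain c d where z': "z' = Complex c d" by (cases z')
  have "(dist 1 (2 * \<i>))\<^sup>2 = 5" by (simp add: dist_norm cmod_power2)
  then have "(dist z z')\<^sup>2 = 5" by (simp only: assms(3))
  then have D: "(a - c)\<^sup>2 + (b - d)\<^sup>2 = 5" by (simp add: z z' dist_norm cmod_power2)
  have r: "0 \<le> a" "0 \<le> b" "2 * a + b \<le> 2" "0 \<le> c" "0 \<le> d" "2 * c + d \<le> 2"
    using assms by (auto simp: proto_def z z')
  have le: "(a - c)\<^sup>2 \<le> 1\<^sup>2" "(b - d)\<^sup>2 \<le> 2\<^sup>2"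
    using r by (intro abs_le_square_iff[THEN iffD1]; simp add: abs_le_iff)+
  then have "(a - c)\<^sup>2 = 1" "(b - d)\<^sup>2 = 2\<^sup>2" using D by auto
  then have "a - c = 1 \<or> a - c = -1" "b - d = 2 \<or> b - d = -2"
    by (simp_all only: power2_eq_1_iff power2_eq_iff)
  then show ?thesis using r by (auto simp: z z' complex_eq_iff)
qed

text \<open>The ends of the hypotenuse are fixed or swapped, and the image of the right-angle vertex
  has distances 1 and 2 from their images. Two points have these distances: in the first case only 0
  lies in the triangle, in the second case neither does.\<close>

lemma proto_rigid:
  assumes iso: "plane_isometry f" and im: "f ` proto \<subseteq> proto" shows "f = id"
proof -
  have df: "dist (f x) (f y) = dist x y" for x y using iso by (simp add: plane_isometry_def)
  have inp: "0 \<in> proto" "1 \<in> proto" "2 * \<i> \<in> proto" by (auto simp: proto_def)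
  have fp: "f 0 \<in> proto" "f 1 \<in> proto" "f (2 * \<i>) \<in> proto" using im inp by auto
  obtain x y where f0: "f 0 = Complex x y" by (cases "f 0")
  have r: "0 \<le> x" "0 \<le> y" "2 * x + y \<le> 2" using fp(1) by (auto simp: proto_def f0)
  have d1: "(norm (f 0 - f 1))\<^sup>2 = 1" using df[of 0 1] by (simp add: dist_norm)
  have d2: "(norm (f 0 - f (2 * \<i>)))\<^sup>2 = 4" using df[of 0 "2 * \<i>"] by (simp add: dist_norm)
  consider "f 1 = 1" "f (2 * \<i>) = 2 * \<i>" | "f 1 = 2 * \<i>" "f (2 * \<i>) = 1"
    using proto_diameter[OF fp(2,3) df] by blast
  then show ?thesis
  proof cases
    case 1
    have e: "(x - 1)\<^sup>2 + y\<^sup>2 = 1" "x\<^sup>2 + (y - 2)\<^sup>2 = 4"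
      using d1 d2 1 by (simp_all add: f0 cmod_power2)
    then have "x = 2 * y" by (simp add: power2_eq_square algebra_simps)
    with e(1) have "y * (5 * y - 4) = 0" by (simp add: power2_eq_square algebra_simps)
    then have "y = 0" using r \<open>x = 2 * y\<close> by auto
    then have "f 0 = 0" using \<open>x = 2 * y\<close> by (simp add: f0 complex_eq_iff)
    then have "f = id \<or> f = cnj" using isometry_fixing_0_1[OF iso] 1 by blast
    then show ?thesis using 1 by auto
  next
    case 2
    have e: "(x - 1)\<^sup>2 + y\<^sup>2 = 4" "x\<^sup>2 + (y - 2)\<^sup>2 = 1"
      using d1 d2 2 by (simp_all add: f0 cmod_power2)
    then have "x = 2 * y - 3" by (simp add: power2_eq_square algebra_simps)
    with e(2) have "(5 * y - 6) * (y - 2) = 0" by (simp add: power2_eq_square algebra_simps)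
    then show ?thesis using r \<open>x = 2 * y - 3\<close> by auto
  qed
qed

lemma tile_of_inj:
  assumes "plane_isometry h" "plane_isometry k" "tile_of h = tile_of k" shows "h = k"
proof -
  have "(ginv k \<circ> h) ` proto = proto"
    using assms unfolding tile_of_def by (metis image_comp image_id plane_isometry_inv_comp(2) id_apply)
  then have "ginv k \<circ> h = id"
    using assms by (intro proto_rigid plane_isometry_comp plane_isometry_inv) auto
  then have "k \<circ> (ginv k \<circ> h) = k" by simp
  then show ?thesis using assms(2) by (simp flip: comp_assoc)
qed

lemma tile_of_comp: "tile_of (g \<circ> h) = g ` tile_of h"
  by (simp add: tile_of_def image_comp)

lemma is_tile_image: "plane_isometry g \<Longrightarrow> is_tile t \<Longrightarrow> is_tile (g ` t)"
  by (metis is_tile_iff plane_isometry_comp tile_of_comp)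

lemma proto_compact: "compact proto" "convex proto"
  unfolding proto_hull by (simp_all add: finite_imp_compact_convex_hull)

lemma is_tile_compact: assumes "is_tile t" shows "compact t" "convex t" "closed t"
proof -
  obtain h where h: "plane_isometry h" "t = tile_of h" using assms is_tile_iff by auto
  show "compact t" unfolding h tile_of_def
    by (intro compact_continuous_image plane_isometry_continuous h proto_compact)
  then show "closed t" by (rule compact_imp_closed)
  show "convex t" unfolding h tile_of_def proto_hull plane_isometry_convex_hull[OF h(1)] by simp
qed

lemma is_tile_interior_nonempty: assumes "is_tile t" shows "interior t \<noteq> {}"
proof -
  obtain h where h: "plane_isometry h" "t = tile_of h" using assms is_tile_iff by auto
  have "Complex (1/4) (1/4) \<in> interior proto" by (simp add: proto_interior)
  then show ?thesis unfolding h tile_of_def plane_isometry_interior[OF h(1)] by auto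
qed

lemma is_tile_closure_interior: "is_tile t \<Longrightarrow> closure (interior t) = t"
  by (metis convex_closure_interior is_tile_compact(2,3) is_tile_interior_nonempty closure_closed)

lemma open_meets_tile:
  assumes "is_tile t" "open S" "S \<inter> t \<noteq> {}" shows "S \<inter> interior t \<noteq> {}"
  using assms by (metis is_tile_closure_interior open_Int_closure_eq_empty)

section \<open>The substitution\<close>

text \<open>In the frame with right-angle vertex \<open>R\<close> at the origin, the dilated triangle is
  \<open>(2 - \<i>) proto\<close> and its five pieces are the images of \<open>proto\<close> under the following
  isometries; in this frame all five have axis-parallel legs and Gaussian integer vertices.\<close>

definition q1 :: "complex \<Rightarrow> complex" where "q1 z = 2 - \<i> * cnj z"
definition q2 :: "complex \<Rightarrow> complex" where "q2 z = 1 - cnj z"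
definition q3 :: "complex \<Rightarrow> complex" where "q3 z = 1 + z"
definition q4 :: "complex \<Rightarrow> complex" where "q4 z = 2 + 2 * \<i> - z"
definition q5 :: "complex \<Rightarrow> complex" where "q5 z = 2 + 2 * \<i> - cnj z"

lemmas q_defs = q1_def q2_def q3_def q4_def q5_def

definition pieces :: "(complex \<Rightarrow> complex) set" where "pieces = {q1, q2, q3, q4, q5}"

lemma q_isometry: "plane_isometry q1" "plane_isometry q2" "plane_isometry q3"
  "plane_isometry q4" "plane_isometry q5"
proof -
  have e: "q1 = euclid True (-\<i>) 2" "q2 = euclid True (-1) 1" "q3 = euclid False 1 1"
    "q4 = euclid False (-1) (2 + 2 * \<i>)" "q5 = euclid True (-1) (2 + 2 * \<i>)"
    by (auto simp: q_defs euclid_def conj_if_def)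
  show "plane_isometry q1" by (subst e, rule plane_isometry_euclid) simp
  show "plane_isometry q2" by (subst e, rule plane_isometry_euclid) simp
  show "plane_isometry q3" by (subst e, rule plane_isometry_euclid) simp
  show "plane_isometry q4" by (subst e, rule plane_isometry_euclid) simp
  show "plane_isometry q5" by (subst e, rule plane_isometry_euclid) simp
qed

lemma pieces_isometry: "q \<in> pieces \<Longrightarrow> plane_isometry q"
  using q_isometry by (auto simp: pieces_def)

text \<open>If \<open>h\<close> places a tile, \<open>up h\<close> places the dilated tile, in the
  frame where the dilated triangle is \<open>(2 - \<i>) proto\<close>. It is again an isometry
  because \<open>2 - \<i>\<close> has modulus sqrt 5.\<close>

definition up :: "(complex \<Rightarrow> complex) \<Rightarrow> complex \<Rightarrow> complex" where
  "up h z = sqrt 5 *\<^sub>R h (z / (2 - \<i>))"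

text \<open>Conjugation by multiplication with \<open>2 - \<i>\<close>: tiles in relative position
  \<open>g\<close> have dilated tiles in relative position \<open>hat g\<close>, see
  \<open>up_comp\<close>.\<close>

definition hat :: "(complex \<Rightarrow> complex) \<Rightarrow> complex \<Rightarrow> complex" where
  "hat g z = (2 - \<i>) * g (z / (2 - \<i>))"

lemma two_minus_i [simp]: "2 - \<i> \<noteq> 0" "cmod (2 - \<i>) = sqrt 5"
  by (auto simp: complex_eq_iff cmod_def)

lemma up_isometry: "plane_isometry h \<Longrightarrow> plane_isometry (up h)"
  by (simp add: plane_isometry_def up_def dist_norm norm_divide
      flip: scaleR_diff_right diff_divide_distrib)

lemma up_comp: "up (h \<circ> g) = up h \<circ> hat g"
  by (auto simp: up_def hat_def)

lemma up_point: "up h ((2 - \<i>) * p) = sqrt 5 *\<^sub>R h p"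
  by (simp add: up_def)

lemma up_inj: assumes "up h = up k" shows "h = k"
proof
  fix z show "h z = k z" using fun_cong[OF assms, of "(2 - \<i>) * z"] by (simp add: up_point)
qed

lemma up_image: "up h ` ((\<lambda>z. (2 - \<i>) * z) ` X) = (\<lambda>z. sqrt 5 *\<^sub>R z) ` h ` X"
  by (simp add: image_image up_point)

lemma proto_image_hull:
  "plane_isometry g \<Longrightarrow> g ` proto = convex hull {g 0, g 1, g (2 * \<i>)}"
  by (simp add: proto_hull plane_isometry_convex_hull Complex_eq mult.commute)

text \<open>Moves the frame with right-angle vertex at the origin to the coordinates of
  \<open>dilated_prototile\<close>.\<close>

abbreviation shiftR :: "complex \<Rightarrow> complex" where
  "shiftR z \<equiv> z + Complex (-3/2) (-1/2)"

lemma shiftR_isometry: "plane_isometry shiftR"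
  by (simp add: plane_isometry_def)

lemma prototile_pieces_eq: "prototile_pieces = (\<lambda>q. shiftR ` tile_of q) ` pieces"
proof -
  have t: "shiftR ` tile_of q = convex hull {shiftR (q 0), shiftR (q 1), shiftR (q (2 * \<i>))}"
    if "q \<in> pieces" for q
    using that proto_image_hull[OF plane_isometry_comp[OF shiftR_isometry pieces_isometry[OF that]]]
    by (simp add: tile_of_def image_image)
  \<comment> \<open>Only the vertex sets agree: the maps \<open>q\<close> produce the vertices in
    another order than the definition lists them.\<close>
  have *: "convex hull {a, b, c} = convex hull {a', b', c'}"
    if "{a, b, c} = {a', b', c'}" for a b c a' b' c' :: complex
    using that by simp
  have "(\<lambda>q. shiftR ` tile_of q) ` pieces =
     (\<lambda>q. convex hull {shiftR (q 0), shiftR (q 1), shiftR (q (2 * \<i>))}) ` pieces"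
    by (intro image_cong refl t)
  also have "\<dots> = prototile_pieces"
    unfolding prototile_pieces_def Let_def pieces_def image_insert image_empty
  proof (intro arg_cong2[where f = insert] refl)
    show "convex hull {shiftR (q1 0), shiftR (q1 1), shiftR (q1 (2 * \<i>))} =
      convex hull {Complex (1/2) (-3/2), Complex (1/2) (-1/2), Complex (-3/2) (-1/2)}"
      by (rule *) (auto simp: q_defs complex_eq_iff)
    show "convex hull {shiftR (q2 0), shiftR (q2 1), shiftR (q2 (2 * \<i>))} =
      convex hull {Complex (-3/2) (-1/2), Complex (-1/2) (-1/2), Complex (-1/2) (3/2)}"
      by (rule *) (auto simp: q_defs complex_eq_iff)
    show "convex hull {shiftR (q3 0), shiftR (q3 1), shiftR (q3 (2 * \<i>))} =
      convex hull {Complex (-1/2) (-1/2), Complex (1/2) (-1/2), Complex (-1/2) (3/2)}"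
      by (rule *) (auto simp: q_defs complex_eq_iff)
    show "convex hull {shiftR (q4 0), shiftR (q4 1), shiftR (q4 (2 * \<i>))} =
      convex hull {Complex (1/2) (3/2), Complex (1/2) (-1/2), Complex (-1/2) (3/2)}"
      by (rule *) (auto simp: q_defs complex_eq_iff)
    show "convex hull {shiftR (q5 0), shiftR (q5 1), shiftR (q5 (2 * \<i>))} =
      convex hull {Complex (1/2) (3/2), Complex (1/2) (7/2), Complex (-1/2) (3/2)}"
      by (rule *) (auto simp: q_defs complex_eq_iff)
  qed
  finally show ?thesis ..
qed

lemma dilated_prototile_eq: "dilated_prototile = shiftR ` (\<lambda>z. (2 - \<i>) * z) ` proto"
proof -
  have lin: "linear (\<lambda>z. (2 - \<i>) * z)" by (simp add: linear_times)
  have "shiftR ` (\<lambda>z. (2 - \<i>) * z) ` proto = convex hull (shiftR ` (\<lambda>z. (2 - \<i>) * z) ` {0, 1, Complex 0 2})"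
    unfolding proto_hull convex_hull_linear_image[OF lin] plane_isometry_convex_hull[OF shiftR_isometry] ..
  also have "shiftR ` (\<lambda>z. (2 - \<i>) * z) ` {0, 1, Complex 0 2} =
     {Complex (-3/2) (-1/2), Complex (1/2) (-3/2), Complex (1/2) (7/2)}"
    by (auto simp: complex_eq_iff)
  finally show ?thesis by (simp add: dilated_prototile_def)
qed

text \<open>The isometry quantified in \<open>subst_tile\<close> is unique: scaled back by sqrt 5 it
  places the same tile as \<open>h\<close>, so rigidity identifies it with \<open>h\<close>. The
  five children thereby get explicit placements.\<close>

lemma subst_tile_tile_of:
  assumes h: "plane_isometry h"
  shows "subst_tile (tile_of h) = (\<lambda>q. tile_of (up h \<circ> q)) ` pieces"
proof -
  have ex: "h' = (\<lambda>y. up h (y - Complex (-3/2) (-1/2)))"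
    if h': "plane_isometry h'" and im: "h' ` dilated_prototile = (\<lambda>z. sqrt 5 *\<^sub>R z) ` tile_of h" for h'
  proof -
    define k where "k z = (1 / sqrt 5) *\<^sub>R h' (shiftR ((2 - \<i>) * z))" for z
    have "plane_isometry k"
      using h' by (simp add: plane_isometry_def k_def dist_norm norm_mult
          flip: scaleR_diff_right right_diff_distrib)
    moreover have "tile_of k = tile_of h"
    proof -
      have "tile_of k = (\<lambda>z. (1 / sqrt 5) *\<^sub>R z) ` h' ` dilated_prototile"
        by (simp add: tile_of_def dilated_prototile_eq image_image k_def)
      also have "\<dots> = tile_of h" unfolding im by (simp add: image_image)
      finally show ?thesis .
    qed
    ultimately have kh: "k = h" using h tile_of_inj by blast
    have "h' y = up h (y - Complex (-3/2) (-1/2))" for y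
      unfolding up_def kh[symmetric] k_def by simp
    then show ?thesis by blast
  qed
  define h0 where "h0 = (\<lambda>y. up h (y - Complex (-3/2) (-1/2)))"
  have "plane_isometry (\<lambda>y. y - Complex (-3/2) (-1/2))"
    unfolding plane_isometry_def by (intro allI) (simp add: dist_norm)
  from plane_isometry_comp[OF up_isometry[OF h] this] have h0: "plane_isometry h0"
    by (simp add: h0_def comp_def)
  have h0R: "h0 (shiftR z) = up h z" for z by (simp add: h0_def)
  have im0: "h0 ` dilated_prototile = (\<lambda>z. sqrt 5 *\<^sub>R z) ` tile_of h"
    unfolding dilated_prototile_eq tile_of_def up_image[symmetric]
    by (simp only: image_image[of h0 shiftR] h0R)
  have h0p: "tile_of (up h \<circ> q) = h0 ` (shiftR ` tile_of q)" for q
    unfolding tile_of_def image_image[of h0 shiftR] h0R by (simp add: image_comp)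
  have "subst_tile (tile_of h) = {h0 ` p | p. p \<in> prototile_pieces}"
  proof (rule Set.set_eqI, unfold subst_tile_def mem_Collect_eq, intro iffI)
    fix x assume "\<exists>h' p. x = h' ` p \<and> plane_isometry h' \<and>
      h' ` dilated_prototile = (\<lambda>z. sqrt 5 *\<^sub>R z) ` tile_of h \<and> p \<in> prototile_pieces"
    then show "\<exists>p. x = h0 ` p \<and> p \<in> prototile_pieces" using ex unfolding h0_def by metis
  next
    fix x assume "\<exists>p. x = h0 ` p \<and> p \<in> prototile_pieces"
    then show "\<exists>h' p. x = h' ` p \<and> plane_isometry h' \<and>
      h' ` dilated_prototile = (\<lambda>z. sqrt 5 *\<^sub>R z) ` tile_of h \<and> p \<in> prototile_pieces"
      using h0 im0 by metis
  qed
  also have "\<dots> = (\<lambda>q. tile_of (up h \<circ> q)) ` pieces"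
    unfolding prototile_pieces_eq h0p by blast
  finally show ?thesis .
qed


lemma q_mem:
  "w \<in> tile_of q1 \<longleftrightarrow> Im w \<le> 0 \<and> Re w \<le> 2 \<and> 0 \<le> Re w + 2 * Im w"
  "w \<in> tile_of q2 \<longleftrightarrow> Re w \<le> 1 \<and> 0 \<le> Im w \<and> Im w \<le> 2 * Re w"
  "w \<in> tile_of q3 \<longleftrightarrow> 1 \<le> Re w \<and> 0 \<le> Im w \<and> 2 * Re w + Im w \<le> 4"
  "w \<in> tile_of q4 \<longleftrightarrow> Re w \<le> 2 \<and> Im w \<le> 2 \<and> 4 \<le> 2 * Re w + Im w"
  "w \<in> tile_of q5 \<longleftrightarrow> Re w \<le> 2 \<and> 2 \<le> Im w \<and> Im w \<le> 2 * Re w"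
proof -
  have *: "w \<in> tile_of q \<longleftrightarrow> r w \<in> proto" if "\<And>z. q (r z) = z" "\<And>z. r (q z) = z" for q r
    using that unfolding tile_of_def by (metis imageE imageI)
  show "w \<in> tile_of q1 \<longleftrightarrow> Im w \<le> 0 \<and> Re w \<le> 2 \<and> 0 \<le> Re w + 2 * Im w"
    by (subst *[of _ "\<lambda>w. \<i> * cnj (2 - w)"]) (auto simp: q_defs proto_def complex_eq_iff)
  show "w \<in> tile_of q2 \<longleftrightarrow> Re w \<le> 1 \<and> 0 \<le> Im w \<and> Im w \<le> 2 * Re w"
    by (subst *[of _ "\<lambda>w. 1 - cnj w"]) (auto simp: q_defs proto_def complex_eq_iff)
  show "w \<in> tile_of q3 \<longleftrightarrow> 1 \<le> Re w \<and> 0 \<le> Im w \<and> 2 * Re w + Im w \<le> 4"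
    by (subst *[of _ "\<lambda>w. w - 1"]) (auto simp: q_defs proto_def complex_eq_iff)
  show "w \<in> tile_of q4 \<longleftrightarrow> Re w \<le> 2 \<and> Im w \<le> 2 \<and> 4 \<le> 2 * Re w + Im w"
    by (subst *[of _ "\<lambda>w. 2 + 2 * \<i> - w"]) (auto simp: q_defs proto_def complex_eq_iff)
  show "w \<in> tile_of q5 \<longleftrightarrow> Re w \<le> 2 \<and> 2 \<le> Im w \<and> Im w \<le> 2 * Re w"
    by (subst *[of _ "\<lambda>w. 2 - 2 * \<i> - cnj w"]) (auto simp: q_defs proto_def complex_eq_iff)
qed

lemma q_interior:
  "w \<in> interior (tile_of q1) \<longleftrightarrow> Im w < 0 \<and> Re w < 2 \<and> 0 < Re w + 2 * Im w"
  "w \<in> interior (tile_of q2) \<longleftrightarrow> Re w < 1 \<and> 0 < Im w \<and> Im w < 2 * Re w"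
  "w \<in> interior (tile_of q3) \<longleftrightarrow> 1 < Re w \<and> 0 < Im w \<and> 2 * Re w + Im w < 4"
  "w \<in> interior (tile_of q4) \<longleftrightarrow> Re w < 2 \<and> Im w < 2 \<and> 4 < 2 * Re w + Im w"
  "w \<in> interior (tile_of q5) \<longleftrightarrow> Re w < 2 \<and> 2 < Im w \<and> Im w < 2 * Re w"
proof -
  have *: "w \<in> interior (tile_of q) \<longleftrightarrow> r w \<in> interior proto"
    if "plane_isometry q" "\<And>z. q (r z) = z" "\<And>z. r (q z) = z" for q r
    using that(2,3) unfolding tile_of_def plane_isometry_interior[OF that(1)] by (metis imageE imageI)
  show "w \<in> interior (tile_of q1) \<longleftrightarrow> Im w < 0 \<and> Re w < 2 \<and> 0 < Re w + 2 * Im w"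
    by (subst *[of _ "\<lambda>w. \<i> * cnj (2 - w)"]) (auto simp: q_isometry q_defs proto_interior complex_eq_iff)
  show "w \<in> interior (tile_of q2) \<longleftrightarrow> Re w < 1 \<and> 0 < Im w \<and> Im w < 2 * Re w"
    by (subst *[of _ "\<lambda>w. 1 - cnj w"]) (auto simp: q_isometry q_defs proto_interior complex_eq_iff)
  show "w \<in> interior (tile_of q3) \<longleftrightarrow> 1 < Re w \<and> 0 < Im w \<and> 2 * Re w + Im w < 4"
    by (subst *[of _ "\<lambda>w. w - 1"]) (auto simp: q_isometry q_defs proto_interior complex_eq_iff)
  show "w \<in> interior (tile_of q4) \<longleftrightarrow> Re w < 2 \<and> Im w < 2 \<and> 4 < 2 * Re w + Im w"
    by (subst *[of _ "\<lambda>w. 2 + 2 * \<i> - w"]) (auto simp: q_isometry q_defs proto_interior complex_eq_iff)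
  show "w \<in> interior (tile_of q5) \<longleftrightarrow> Re w < 2 \<and> 2 < Im w \<and> Im w < 2 * Re w"
    by (subst *[of _ "\<lambda>w. 2 - 2 * \<i> - cnj w"]) (auto simp: q_isometry q_defs proto_interior complex_eq_iff)
qed

lemma big_mem:
  "w \<in> (\<lambda>z. (2 - \<i>) * z) ` proto \<longleftrightarrow> Im w \<le> 2 * Re w \<and> 0 \<le> Re w + 2 * Im w \<and> Re w \<le> 2"
proof -
  have "w \<in> (\<lambda>z. (2 - \<i>) * z) ` proto \<longleftrightarrow> w * (2 + \<i>) / 5 \<in> proto"
  proof -
    have e: "(2 - \<i>) * (w * (2 + \<i>) / 5) = w" for w by (simp add: complex_eq_iff)
    have e': "(2 - \<i>) * w * (2 + \<i>) / 5 = w" for w by (simp add: complex_eq_iff)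
    show ?thesis using e e' by (metis (no_types, lifting) imageE image_eqI)
  qed
  also have "\<dots> \<longleftrightarrow> Im w \<le> 2 * Re w \<and> 0 \<le> Re w + 2 * Im w \<and> Re w \<le> 2"
    unfolding proto_def mem_Collect_eq by (simp add: field_simps)
  finally show ?thesis .
qed

lemma pieces_cover: "(\<Union>q\<in>pieces. tile_of q) = (\<lambda>z. (2 - \<i>) * z) ` proto"
proof (intro Set.set_eqI)
  fix w :: complex
  have "w \<in> (\<Union>q\<in>pieces. tile_of q) \<longleftrightarrow>
    w \<in> tile_of q1 \<or> w \<in> tile_of q2 \<or> w \<in> tile_of q3 \<or> w \<in> tile_of q4 \<or> w \<in> tile_of q5"
    by (simp add: pieces_def)
  also have "\<dots> \<longleftrightarrow> w \<in> (\<lambda>z. (2 - \<i>) * z) ` proto"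
    unfolding q_mem big_mem by linarith
  finally show "w \<in> (\<Union>q\<in>pieces. tile_of q) \<longleftrightarrow> w \<in> (\<lambda>z. (2 - \<i>) * z) ` proto" .
qed

lemma pieces_disjoint:
  assumes "q \<in> pieces" "r \<in> pieces" "q \<noteq> r"
  shows "interior (tile_of q) \<inter> interior (tile_of r) = {}"
proof -
  have "q = r" if "w \<in> interior (tile_of q)" "w \<in> interior (tile_of r)" for w
    using assms(1,2) that unfolding pieces_def
    by (elim insertE emptyE) (simp_all add: q_interior)
  then show ?thesis using assms(3) by blast
qed

lemma subst_tile_is_tile: assumes "is_tile t" "x \<in> subst_tile t" shows "is_tile x"
proof -
  obtain h where h: "plane_isometry h" "t = tile_of h" using assms is_tile_iff by auto
  then show ?thesis
    using assms(2) by (auto simp: subst_tile_tile_of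
      intro: is_tile_tile_of plane_isometry_comp up_isometry pieces_isometry)
qed

lemma subst_tile_Union: assumes "is_tile t" shows "\<Union> (subst_tile t) = (\<lambda>z. sqrt 5 *\<^sub>R z) ` t"
proof -
  obtain h where h: "plane_isometry h" "t = tile_of h" using assms is_tile_iff by auto
  have "\<Union> (subst_tile t) = up h ` (\<Union>q\<in>pieces. tile_of q)"
    unfolding h(2) subst_tile_tile_of[OF h(1)] by (auto simp: tile_of_def)
  then show ?thesis unfolding pieces_cover up_image by (simp add: h(2) tile_of_def)
qed

lemma subst_tile_disjoint:
  assumes "is_tile t" "x \<in> subst_tile t" "y \<in> subst_tile t" "x \<noteq> y"
  shows "interior x \<inter> interior y = {}"
proof -
  obtain h where h: "plane_isometry h" "t = tile_of h" using assms is_tile_iff by auto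
  obtain q r where qr: "q \<in> pieces" "r \<in> pieces" "x = up h ` tile_of q" "y = up h ` tile_of r"
    using assms(2,3) unfolding h(2) subst_tile_tile_of[OF h(1)] by (auto simp: tile_of_comp)
  then have "q \<noteq> r" using assms(4) by blast
  then show ?thesis
    using pieces_disjoint[OF qr(1,2)] plane_isometry_inj[OF up_isometry[OF h(1)]]
    unfolding qr plane_isometry_interior[OF up_isometry[OF h(1)]]
    by (simp flip: image_Int)
qed

section \<open>Patches, and motions passing through the substitution\<close>

definition patch :: "tile set \<Rightarrow> bool" where
  "patch P \<longleftrightarrow> (\<forall>t\<in>P. is_tile t) \<and> pairwise (\<lambda>s t. interior s \<inter> interior t = {}) P"

lemma patch_eqI: "patch P \<Longrightarrow> s \<in> P \<Longrightarrow> t \<in> P \<Longrightarrow> z \<in> interior s \<Longrightarrow> z \<in> interior t \<Longrightarrow> s = t"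
  unfolding patch_def pairwise_def by blast

text \<open>A tile is the closure of its interior, so an interior point of one tile lying anywhere
  in another, even on its boundary, makes the interiors overlap.\<close>

lemma patch_eqI': "patch P \<Longrightarrow> s \<in> P \<Longrightarrow> t \<in> P \<Longrightarrow> z \<in> interior s \<Longrightarrow> z \<in> t \<Longrightarrow> s = t"
  using open_meets_tile[of t "interior s"] patch_eqI[of P s t] by (auto simp: patch_def)

lemma patch_is_tile: "patch P \<Longrightarrow> t \<in> P \<Longrightarrow> is_tile t"
  by (simp add: patch_def)

lemma patch_mono: "patch P \<Longrightarrow> Q \<subseteq> P \<Longrightarrow> patch Q"
  unfolding patch_def by (meson pairwise_subset subset_iff)

lemma scale_interior: "interior ((\<lambda>z::complex. sqrt 5 *\<^sub>R z) ` t) = (\<lambda>z. sqrt 5 *\<^sub>R z) ` interior t"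
  by (rule interior_injective_linear_image) (auto simp: linear_scaleR inj_on_def)

lemma subst_Union: assumes "patch P" shows "\<Union> (subst P) = (\<lambda>z. sqrt 5 *\<^sub>R z) ` (\<Union> P)"
proof -
  have "\<Union> (subst P) = (\<Union>t\<in>P. \<Union> (subst_tile t))" by (auto simp: subst_def)
  also have "\<dots> = (\<Union>t\<in>P. (\<lambda>z. sqrt 5 *\<^sub>R z) ` t)"
    using assms by (intro SUP_cong refl subst_tile_Union) (simp add: patch_is_tile)
  finally show ?thesis by auto
qed

lemma subst_tile_interior:
  assumes "is_tile t" "x \<in> subst_tile t" "z \<in> interior x" shows "(1 / sqrt 5) *\<^sub>R z \<in> interior t"
proof -
  have "interior x \<subseteq> interior ((\<lambda>z. sqrt 5 *\<^sub>R z) ` t)"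
    using assms subst_tile_Union[OF assms(1)] by (intro interior_mono) blast
  then show ?thesis using assms(3) by (auto simp: scale_interior)
qed

lemma subst_patch: assumes "patch P" shows "patch (subst P)"
proof -
  have "x = y" if xy: "x \<in> subst P" "y \<in> subst P" "z \<in> interior x" "z \<in> interior y" for x y z
  proof -
    obtain s t where st: "s \<in> P" "t \<in> P" "x \<in> subst_tile s" "y \<in> subst_tile t"
      using xy(1,2) unfolding subst_def by blast
    then have "s = t"
      using assms xy subst_tile_interior by (meson patch_eqI patch_is_tile)
    then show ?thesis using subst_tile_disjoint[OF patch_is_tile[OF assms st(1)]] st xy by blast
  qed
  moreover have "is_tile x" if "x \<in> subst P" for x
    using that assms by (auto simp: subst_def intro: subst_tile_is_tile patch_is_tile)
  ultimately show ?thesis unfolding patch_def pairwise_def by blast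
qed

lemma subst_mono: "P \<subseteq> Q \<Longrightarrow> subst P \<subseteq> subst Q" by (auto simp: subst_def)

lemma subst_finite: assumes "finite P" "patch P" shows "finite (subst P)"
proof -
  have "finite (subst_tile t)" if "t \<in> P" for t
    using patch_is_tile[OF assms(2) that] by (auto simp: is_tile_iff subst_tile_tile_of pieces_def)
  then show ?thesis using assms(1) by (auto simp: subst_def)
qed

text \<open>A motion conjugated by the dilation, so that substituting a moved patch amounts to
  moving the substituted patch by \<open>dil g\<close>. Translations are stretched, motions fixing
  the origin are unchanged.\<close>

definition dil :: "(complex \<Rightarrow> complex) \<Rightarrow> complex \<Rightarrow> complex" where
  "dil g z = sqrt 5 *\<^sub>R g ((1 / sqrt 5) *\<^sub>R z)"

definition undil :: "(complex \<Rightarrow> complex) \<Rightarrow> complex \<Rightarrow> complex" where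
  "undil g z = (1 / sqrt 5) *\<^sub>R g (sqrt 5 *\<^sub>R z)"

lemma dil_isometry: "plane_isometry g \<Longrightarrow> plane_isometry (dil g)"
  by (simp add: plane_isometry_def dil_def dist_norm flip: scaleR_diff_right)

lemma undil_isometry: "plane_isometry g \<Longrightarrow> plane_isometry (undil g)"
  by (simp add: plane_isometry_def undil_def dist_norm flip: scaleR_diff_right)

lemma dil_undil: "dil (undil g) = g"
  by (simp add: dil_def undil_def fun_eq_iff)

lemma up_comp_dil: "up (g \<circ> h) = dil g \<circ> up h"
  by (auto simp: up_def dil_def)

lemma subst_tile_move:
  assumes "plane_isometry g" "is_tile t" shows "subst_tile (g ` t) = move (dil g) (subst_tile t)"
proof -
  obtain h where h: "plane_isometry h" "t = tile_of h" using assms is_tile_iff by auto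
  show ?thesis
    unfolding h(2) tile_of_comp[symmetric] subst_tile_tile_of[OF plane_isometry_comp[OF assms(1) h(1)]]
      subst_tile_tile_of[OF h(1)] move_def up_comp_dil by (simp add: image_image tile_of_comp)
qed

lemma subst_move:
  assumes "plane_isometry g" "\<And>t. t \<in> P \<Longrightarrow> is_tile t"
  shows "subst (move g P) = move (dil g) (subst P)"
proof -
  have "subst (move g P) = (\<Union>t\<in>P. subst_tile (g ` t))" by (auto simp: subst_def move_def)
  also have "\<dots> = (\<Union>t\<in>P. move (dil g) (subst_tile t))"
    by (intro SUP_cong refl subst_tile_move assms)
  finally show ?thesis by (auto simp: subst_def move_def)
qed

lemma move_comp: "move g (move h P) = move (g \<circ> h) P"
  by (simp add: move_def image_image image_comp)

lemma move_id [simp]: "move id P = P" by (simp add: move_def)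

lemma move_inverse: "plane_isometry g \<Longrightarrow> move (ginv g) (move g P) = P"
  "plane_isometry g \<Longrightarrow> move g (move (ginv g) P) = P"
  by (simp_all add: move_comp)

lemma move_mono: "P \<subseteq> Q \<Longrightarrow> move g P \<subseteq> move g Q" by (auto simp: move_def)

lemma patch_move: assumes "plane_isometry g" "patch P" shows "patch (move g P)"
proof -
  have "x = y" if xy: "x \<in> P" "y \<in> P" "z \<in> interior (g ` x)" "z \<in> interior (g ` y)" for x y z
  proof -
    obtain a b where ab: "a \<in> interior x" "b \<in> interior y" "z = g a" "z = g b"
      using xy(3,4) unfolding plane_isometry_interior[OF assms(1)] by blast
    then have "a = b" using plane_isometry_inj[OF assms(1)] by (metis injD)
    then show ?thesis using patch_eqI[OF assms(2) xy(1,2)] ab by blast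
  qed
  then show ?thesis
    using is_tile_image[OF assms(1)] patch_is_tile[OF assms(2)]
    unfolding patch_def pairwise_def move_def by blast
qed

lemma subst_pow_patch: "patch P \<Longrightarrow> patch ((subst ^^ n) P)"
  by (induction n) (simp_all add: subst_patch)

lemma patch_single: "is_tile t \<Longrightarrow> patch {t}" by (simp add: patch_def)

section \<open>Stars of points\<close>

definition star :: "tile set \<Rightarrow> complex \<Rightarrow> tile set" where
  "star P c = {t \<in> P. c \<in> t}"

text \<open>\<open>p\<close> is a point of the undilated parent in the coordinates of the prototile;
  in the frame of the pieces its dilation is \<open>(2 - \<i>) * p\<close>.\<close>

definition kids :: "complex \<Rightarrow> (complex \<Rightarrow> complex) set" where
  "kids p = {q \<in> pieces. (2 - \<i>) * p \<in> tile_of q}"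

lemma isometry_mem_image: "plane_isometry g \<Longrightarrow> g z \<in> g ` X \<longleftrightarrow> z \<in> X"
  using plane_isometry_inj by (simp add: inj_image_mem_iff)

lemma subst_tile_at:
  assumes "plane_isometry h"
  shows "{x \<in> subst_tile (tile_of h). sqrt 5 *\<^sub>R h p \<in> x} = (\<lambda>q. tile_of (up h \<circ> q)) ` kids p"
proof -
  have "{x \<in> subst_tile (tile_of h). sqrt 5 *\<^sub>R h p \<in> x} =
     (\<lambda>q. tile_of (up h \<circ> q)) ` {q \<in> pieces. up h ((2 - \<i>) * p) \<in> up h ` tile_of q}"
    unfolding subst_tile_tile_of[OF assms] up_point tile_of_comp by blast
  then show ?thesis
    by (simp only: kids_def isometry_mem_image[OF up_isometry[OF assms]])
qed

lemma star_subst: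
  assumes "patch P"
  shows "star (subst P) (sqrt 5 *\<^sub>R c) = (\<Union>t\<in>star P c. {x \<in> subst_tile t. sqrt 5 *\<^sub>R c \<in> x})"
proof -
  have "c \<in> t" if "t \<in> P" "x \<in> subst_tile t" "sqrt 5 *\<^sub>R c \<in> x" for t x
  proof -
    have "sqrt 5 *\<^sub>R c \<in> (\<lambda>z. sqrt 5 *\<^sub>R z) ` t"
      using subst_tile_Union[OF patch_is_tile[OF assms that(1)]] that(2,3) by blast
    then show ?thesis by auto
  qed
  then show ?thesis by (auto simp: star_def subst_def)
qed

text \<open>A star up to a motion: \<open>G\<close> lists the placements of its tiles in a common
  frame, \<open>p\<close> is the point in that frame, and \<open>h\<close> carries the frame to the
  actual position. A star type thereby becomes a finite list of explicit maps.\<close>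

definition fan :: "(complex \<Rightarrow> complex) set \<Rightarrow> complex \<Rightarrow> tile set \<Rightarrow> complex \<Rightarrow> bool" where
  "fan G p S c \<longleftrightarrow> (\<exists>h. plane_isometry h \<and> S = (\<lambda>g. tile_of (h \<circ> g)) ` G \<and> c = h p)"

lemma hat_isometry: "plane_isometry g \<Longrightarrow> plane_isometry (hat g)"
  by (simp add: plane_isometry_def hat_def dist_norm norm_mult norm_divide
      flip: right_diff_distrib diff_divide_distrib)

lemma hat_id [simp]: "hat id = id"
  by (auto simp: hat_def)

lemma ginv_eqI: "plane_isometry g \<Longrightarrow> g a = p \<Longrightarrow> ginv g p = a"
  by (auto simp: plane_isometry_inj)

lemma star_subst_fan:
  assumes P: "patch P" and h: "plane_isometry h" "star P c = (\<lambda>g. tile_of (h \<circ> g)) ` G" "c = h p"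
    and G: "\<And>g. g \<in> G \<Longrightarrow> plane_isometry g"
  shows "star (subst P) (sqrt 5 *\<^sub>R c) =
    (\<lambda>f. tile_of (up h \<circ> f)) ` (\<Union>g\<in>G. (\<circ>) (hat g) ` kids (ginv g p))"
proof -
  have kid: "{x \<in> subst_tile (tile_of (h \<circ> g)). sqrt 5 *\<^sub>R c \<in> x} =
     (\<lambda>q. tile_of (up h \<circ> (hat g \<circ> q))) ` kids (ginv g p)" if "g \<in> G" for g
    using subst_tile_at[OF plane_isometry_comp[OF h(1) G[OF that]], of "ginv g p"] G[OF that]
    by (simp add: h(3) up_comp comp_assoc)
  have "star (subst P) (sqrt 5 *\<^sub>R c) = (\<Union>g\<in>G. {x \<in> subst_tile (tile_of (h \<circ> g)). sqrt 5 *\<^sub>R c \<in> x})"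
    unfolding star_subst[OF P] h(2) by auto
  also have "\<dots> = (\<Union>g\<in>G. (\<lambda>q. tile_of (up h \<circ> (hat g \<circ> q))) ` kids (ginv g p))"
    by (intro SUP_cong refl kid)
  finally show ?thesis by auto
qed

text \<open>The evolution law of stars. Relative positions pass from \<open>g\<close> to
  \<open>hat g\<close>, and each tile contributes the pieces that contain its own view
  \<open>ginv g p\<close> of the point.\<close>

lemma fan_step:
  assumes P: "patch P" and fan: "fan G p (star P c) c" and G: "\<And>g. g \<in> G \<Longrightarrow> plane_isometry g"
  shows "fan (\<Union>g\<in>G. (\<circ>) (hat g) ` kids (ginv g p)) ((2 - \<i>) * p)
           (star (subst P) (sqrt 5 *\<^sub>R c)) (sqrt 5 *\<^sub>R c)"
proof -
  obtain h where h: "plane_isometry h" "star P c = (\<lambda>g. tile_of (h \<circ> g)) ` G" "c = h p"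
    using fan by (auto simp: fan_def)
  have "sqrt 5 *\<^sub>R c = up h ((2 - \<i>) * p)" by (simp add: up_point h(3))
  then show ?thesis
    unfolding fan_def using up_isometry[OF h(1)] star_subst_fan[OF P h G] by blast
qed

text \<open>Change of frame, used to bring a computed star into one of the listed normal
  forms.\<close>

lemma fan_rebase:
  assumes "fan F x S c" "F = (\<circ>) a ` G" "plane_isometry a" "x = a p"
  shows "fan G p S c"
proof -
  obtain h where h: "plane_isometry h" "S = (\<lambda>f. tile_of (h \<circ> f)) ` F" "c = h x"
    using assms by (auto simp: fan_def)
  show ?thesis unfolding fan_def
    using h assms(2-) by (intro exI[of _ "h \<circ> a"])
      (auto simp: plane_isometry_comp image_image comp_assoc)
qed

lemma fan_swap: "fan {id, g} p S c \<Longrightarrow> g \<circ> g = id \<Longrightarrow> plane_isometry g \<Longrightarrow> fan {id, g} (g p) S c"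
  by (rule fan_rebase[where F = "{id, g}" and a = g and x = p]) (auto simp: comp_def id_def fun_eq_iff)

lemma fan_step2:
  assumes "patch P" "fan {id, g} p (star P c) c" "plane_isometry g" "g r = p"
    "kids p = K" "kids r = L"
  shows "fan (K \<union> (\<circ>) (hat g) ` L) ((2 - \<i>) * p) (star (subst P) (sqrt 5 *\<^sub>R c)) (sqrt 5 *\<^sub>R c)"
proof -
  have "ginv id p = p" "ginv g p = r"
    using ginv_eqI[OF assms(3,4)] ginv_eqI[OF plane_isometry_id(1), of p p] by auto
  then show ?thesis
    using fan_step[OF assms(1,2)] assms(3,5,6) plane_isometry_id by auto
qed

text \<open>\<open>r\<close> is the point as seen from the second tile. The child \<open>a\<close>
  of the first tile becomes the reference, so \<open>g'\<close> is the position of the other child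
  relative to it.\<close>

lemma fan_step_pair:
  assumes "patch P" "fan {id, g} p (star P c) c" "plane_isometry g" "g r = p"
    "kids p = {a}" "kids r = {b}" "plane_isometry a" "hat g \<circ> b = a \<circ> g'" "(2 - \<i>) * p = a p'"
  shows "fan {id, g'} p' (star (subst P) (sqrt 5 *\<^sub>R c)) (sqrt 5 *\<^sub>R c)"
  by (rule fan_rebase[OF fan_step2[OF assms(1-6)], where a = a]) (use assms(7-) in auto)

section \<open>Which pieces contain a given point of the parent\<close>

lemma kids_eq:
  "kids p = {q. q = q1 \<and> Im p * 2 \<le> Re p \<and> 2 * Re p + Im p \<le> 2 \<and> 0 \<le> Im p
      \<or> q = q2 \<and> 2 * Re p + Im p \<le> 1 \<and> Re p \<le> 2 * Im p \<and> 0 \<le> Re p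
      \<or> q = q3 \<and> 1 \<le> 2 * Re p + Im p \<and> Re p \<le> 2 * Im p \<and> 3 * Re p + 4 * Im p \<le> 4
      \<or> q = q4 \<and> 2 * Re p + Im p \<le> 2 \<and> 2 * Im p - Re p \<le> 2 \<and> 4 \<le> 3 * Re p + 4 * Im p
      \<or> q = q5 \<and> 2 * Re p + Im p \<le> 2 \<and> 2 \<le> 2 * Im p - Re p \<and> 0 \<le> Re p}"
proof -
  have "kids p = {q. q = q1 \<and> (2 - \<i>) * p \<in> tile_of q1 \<or> q = q2 \<and> (2 - \<i>) * p \<in> tile_of q2
      \<or> q = q3 \<and> (2 - \<i>) * p \<in> tile_of q3 \<or> q = q4 \<and> (2 - \<i>) * p \<in> tile_of q4
      \<or> q = q5 \<and> (2 - \<i>) * p \<in> tile_of q5}"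
    by (auto simp: kids_def pieces_def)
  also have "\<dots> = {q. q = q1 \<and> Im p * 2 \<le> Re p \<and> 2 * Re p + Im p \<le> 2 \<and> 0 \<le> Im p
      \<or> q = q2 \<and> 2 * Re p + Im p \<le> 1 \<and> Re p \<le> 2 * Im p \<and> 0 \<le> Re p
      \<or> q = q3 \<and> 1 \<le> 2 * Re p + Im p \<and> Re p \<le> 2 * Im p \<and> 3 * Re p + 4 * Im p \<le> 4
      \<or> q = q4 \<and> 2 * Re p + Im p \<le> 2 \<and> 2 * Im p - Re p \<le> 2 \<and> 4 \<le> 3 * Re p + 4 * Im p
      \<or> q = q5 \<and> 2 * Re p + Im p \<le> 2 \<and> 2 \<le> 2 * Im p - Re p \<and> 0 \<le> Re p}"
    unfolding q_mem by (intro Collect_cong disj_cong conj_cong refl) (simp; linarith)+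
  finally show ?thesis .
qed

definition hyp :: "complex set" where
  "hyp = {p. 2 * Re p + Im p = 2 \<and> 0 < Im p \<and> Im p < 2}"
text \<open>The long leg is treated in two halves: after dilation its midpoint \<open>\<i>\<close>
  becomes a vertex where the hypotenuses of \<open>q2\<close> and \<open>q5\<close> join, and a
  short leg of a neighbour may abut either half.\<close>

definition long :: "real \<Rightarrow> real \<Rightarrow> complex set" where
  "long a b = {p. Re p = 0 \<and> a < Im p \<and> Im p < b}"
definition short :: "complex set" where
  "short = {p. Im p = 0 \<and> 0 < Re p \<and> Re p < 1}"

text \<open>The dilated hypotenuse has length 5 and consists of the short leg of \<open>q1\<close>
  and the long legs of \<open>q4\<close> and \<open>q5\<close>, as 1 + 2 + 2. Since
  \<open>Im p\<close> runs from 0 to 2 along it, the joints sit at 2/5 and 6/5.\<close>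

lemma kids_hyp:
  assumes "p \<in> hyp"
  shows "Im p < 2/5 \<Longrightarrow> kids p = {q1}" "Im p = 2/5 \<Longrightarrow> kids p = {q1, q3, q4}"
    "2/5 < Im p \<Longrightarrow> Im p < 6/5 \<Longrightarrow> kids p = {q4}" "Im p = 6/5 \<Longrightarrow> kids p = {q4, q5}"
    "6/5 < Im p \<Longrightarrow> kids p = {q5}"
  using assms by (auto simp: kids_eq hyp_def)

lemma kids_long:
  "p \<in> long 0 1 \<Longrightarrow> kids p = {q2}" "kids \<i> = {q2, q3, q4, q5}" "p \<in> long 1 2 \<Longrightarrow> kids p = {q5}"
  by (auto simp: kids_eq long_def)

lemma kids_short: "p \<in> short \<Longrightarrow> kids p = {q1}"
  by (auto simp: kids_eq short_def)

text \<open>A right angle splits into one acute corner of each kind, while an acute corner passes to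
  a single child as the same corner. Hence vertices soon carry acute corners only.\<close>

lemma kids_vertex: "kids 0 = {q1, q2}" "kids 1 = {q1}" "kids (2 * \<i>) = {q5}"
  by (auto simp: kids_eq)

text \<open>The positions of a tile relative to an edge-adjacent one: mirror images across the
  hypotenuse, the long and the short leg (\<open>gHm\<close>, \<open>gLm\<close>, \<open>gSm\<close>), half-turns about the midpoint
  of the hypotenuse and about \<open>\<i>/2\<close> (\<open>gHr\<close>, \<open>gLr\<close>), a glide along the long leg (\<open>gLg\<close>),
  and the two positions of a short leg on one half of the long leg (\<open>gLa\<close>, \<open>gLb\<close>).\<close>

definition gHm :: "complex \<Rightarrow> complex" where "gHm z = (8 + 4 * \<i>) / 5 - (3 + 4 * \<i>) / 5 * cnj z"
definition gHr :: "complex \<Rightarrow> complex" where "gHr z = 1 + 2 * \<i> - z"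
definition gLm :: "complex \<Rightarrow> complex" where "gLm z = - cnj z"
definition gSm :: "complex \<Rightarrow> complex" where "gSm z = cnj z"
definition gLr :: "complex \<Rightarrow> complex" where "gLr z = \<i> - z"
definition gLg :: "complex \<Rightarrow> complex" where "gLg z = \<i> - cnj z"
definition gLa :: "complex \<Rightarrow> complex" where "gLa z = \<i> + \<i> * z"
definition gLb :: "complex \<Rightarrow> complex" where "gLb z = \<i> - \<i> * cnj z"
definition gF3 :: "complex \<Rightarrow> complex" where "gF3 z = -1 + \<i> + cnj z"
definition gF4 :: "complex \<Rightarrow> complex" where "gF4 z = - \<i> - cnj z"
definition gM3 :: "complex \<Rightarrow> complex" where "gM3 z = - z"
definition gV3 :: "complex \<Rightarrow> complex" where "gV3 z = - 2 + \<i> * cnj z"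
definition gV4 :: "complex \<Rightarrow> complex" where "gV4 z = - \<i> + \<i> * z"
definition gV5 :: "complex \<Rightarrow> complex" where "gV5 z = - 2 - \<i> * z"

lemmas g_defs = gHm_def gHr_def gLm_def gSm_def gLr_def gLg_def gLa_def gLb_def gF3_def gF4_def
  gM3_def gV3_def gV4_def gV5_def

lemma euclidI: "norm w = 1 \<Longrightarrow> (\<And>z. g z = w * conj_if b z + v) \<Longrightarrow> plane_isometry g"
  using plane_isometry_euclid[of w b v] by (metis euclid_def ext)

lemma g_isometry [simp]:
  "plane_isometry gHm" "plane_isometry gHr" "plane_isometry gLm" "plane_isometry gSm"
  "plane_isometry gLr" "plane_isometry gLg" "plane_isometry gLa" "plane_isometry gLb"
  "plane_isometry gF3" "plane_isometry gF4" "plane_isometry gM3" "plane_isometry gV3"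
  "plane_isometry gV4" "plane_isometry gV5" "plane_isometry id"
proof -
  have n: "norm (- ((3 + 4 * \<i>) / 5)) = 1" by (simp add: cmod_def power2_eq_square)
  show "plane_isometry gHm"
    by (rule euclidI[OF n, of _ True "(8 + 4 * \<i>) / 5"]) (simp add: g_defs conj_if_def)
  show "plane_isometry gHr" by (rule euclidI[of "-1" _ False "1 + 2 * \<i>"]) (simp_all add: g_defs conj_if_def)
  show "plane_isometry gLm" by (rule euclidI[of "-1" _ True "0"]) (simp_all add: g_defs conj_if_def)
  show "plane_isometry gSm" by (rule euclidI[of "1" _ True "0"]) (simp_all add: g_defs conj_if_def)
  show "plane_isometry gLr" by (rule euclidI[of "-1" _ False "\<i>"]) (simp_all add: g_defs conj_if_def)
  show "plane_isometry gLg" by (rule euclidI[of "-1" _ True "\<i>"]) (simp_all add: g_defs conj_if_def)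
  show "plane_isometry gLa" by (rule euclidI[of "\<i>" _ False "\<i>"]) (simp_all add: g_defs conj_if_def)
  show "plane_isometry gLb" by (rule euclidI[of "-\<i>" _ True "\<i>"]) (simp_all add: g_defs conj_if_def)
  show "plane_isometry gF3" by (rule euclidI[of "1" _ True "-1 + \<i>"]) (simp_all add: g_defs conj_if_def)
  show "plane_isometry gF4" by (rule euclidI[of "-1" _ True "- \<i>"]) (simp_all add: g_defs conj_if_def)
  show "plane_isometry gM3" by (rule euclidI[of "-1" _ False "0"]) (simp_all add: g_defs conj_if_def)
  show "plane_isometry gV3" by (rule euclidI[of "\<i>" _ True "-2"]) (simp_all add: g_defs conj_if_def)
  show "plane_isometry gV4" by (rule euclidI[of "\<i>" _ False "-\<i>"]) (simp_all add: g_defs conj_if_def)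
  show "plane_isometry gV5" by (rule euclidI[of "-\<i>" _ False "-2"]) (simp_all add: g_defs conj_if_def)
  show "plane_isometry id" by (rule plane_isometry_id)
qed

section \<open>The catalogue of star types\<close>

definition rA :: complex where "rA = (3 - 4 * \<i>) / 5"

text \<open>Eight acute corners around the origin, four of each kind, the maps paired as
  \<open>f\<close> and \<open>- f\<close>. The rotation \<open>rA\<close> is the square of the unit
  number \<open>(2 - \<i>) / sqrt 5\<close>, that is, minus twice the smaller acute angle of a tile.
  The substitution exchanges \<open>fanA\<close> and \<open>fanB\<close> up to rotation.\<close>

definition fanA :: "(complex \<Rightarrow> complex) set" where
  "fanA = {\<lambda>z. 2 - \<i> * cnj z, \<lambda>z. - 2 + \<i> * cnj z, \<lambda>z. 1 - cnj z, \<lambda>z. - 1 + cnj z,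
     \<lambda>z. rA * (2 + \<i> * z), \<lambda>z. rA * (- 2 - \<i> * z), \<lambda>z. rA * (1 - z), \<lambda>z. rA * (- 1 + z)}"

definition fanB :: "(complex \<Rightarrow> complex) set" where
  "fanB = {\<lambda>z. 2 - \<i> * cnj z, \<lambda>z. - 2 + \<i> * cnj z, \<lambda>z. \<i> * (1 - cnj z), \<lambda>z. \<i> * (- 1 + cnj z),
     \<lambda>z. 2 + \<i> * z, \<lambda>z. - 2 - \<i> * z, \<lambda>z. \<i> * (1 - z), \<lambda>z. \<i> * (- 1 + z)}"

text \<open>Four right angles: the rhombus with diagonals 2 and 4.\<close>

definition fanM :: "(complex \<Rightarrow> complex) set" where "fanM = {id, gSm, gLm, gM3}"
text \<open>The star at the joint 2/5 of two mirrored hypotenuses; each side contributes a right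
  angle and both acute angles.\<close>

definition fanF :: "(complex \<Rightarrow> complex) set" where "fanF = {id, gLb, gV3, gSm, gV4, gV5}"

text \<open>Stars of acute corners are not enumerated. Each corner has one child at the dilated
  point, so it suffices to remember that the star lacks central symmetry, unless it is one of the
  two symmetric fans.\<close>

definition acute_star :: "tile set \<Rightarrow> complex \<Rightarrow> bool" where
  "acute_star S c \<longleftrightarrow> (\<forall>t\<in>S. \<exists>h. plane_isometry h \<and> t = tile_of h \<and> (c = h 1 \<or> c = h (2 * \<i>))) \<and>
     ((\<exists>t\<in>S. (\<lambda>z. 2 * c - z) ` t \<notin> S) \<or> fan fanA 0 S c \<or> fan fanB 0 S c)"

text \<open>Points in the interior of an edge contact between exactly two tiles. The contact
  \<open>gLb\<close> is left out on purpose; it enters only with \<open>inner_star\<close>.\<close>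

inductive edge_star :: "tile set \<Rightarrow> complex \<Rightarrow> bool" where
  "fan {id, gHm} p S c \<Longrightarrow> p \<in> hyp \<Longrightarrow> edge_star S c"
| "fan {id, gHr} p S c \<Longrightarrow> p \<in> hyp \<Longrightarrow> edge_star S c"
| "fan {id, gLm} p S c \<Longrightarrow> p \<in> long 0 2 \<Longrightarrow> edge_star S c"
| "fan {id, gSm} p S c \<Longrightarrow> p \<in> short \<Longrightarrow> edge_star S c"
| "fan {id, gLr} p S c \<Longrightarrow> p \<in> long 0 1 \<Longrightarrow> edge_star S c"
| "fan {id, gLg} p S c \<Longrightarrow> p \<in> long 1 2 \<Longrightarrow> edge_star S c"
| "fan {id, gLa} p S c \<Longrightarrow> p \<in> long 1 2 \<Longrightarrow> edge_star S c"

text \<open>The types closed under the substitution. By \<open>step_inner\<close>, a dilated point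
  that came from the boundary of the parents has one of them.\<close>

inductive outer_star :: "tile set \<Rightarrow> complex \<Rightarrow> bool" where
  "edge_star S c \<Longrightarrow> outer_star S c"
| "fan {id, gLa, gF3, gF4} \<i> S c \<Longrightarrow> outer_star S c"
| "fan {id, gLr, gLg} \<i> S c \<Longrightarrow> outer_star S c"
| "fan fanF 0 S c \<Longrightarrow> outer_star S c"
| "fan fanM 0 S c \<Longrightarrow> outer_star S c"
| "acute_star S c \<Longrightarrow> outer_star S c"

text \<open>Adds the points where a short leg lies along the half of a long leg next to the right
  angle, including the end of that contact at \<open>\<i>\<close>. They are created only strictly
  inside one dilated tile, and this gap to \<open>outer_star\<close> is what makes parents
  recognizable.\<close>

inductive inner_star :: "tile set \<Rightarrow> complex \<Rightarrow> bool" where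
  "outer_star S c \<Longrightarrow> inner_star S c"
| "fan {id, gLb} p S c \<Longrightarrow> p \<in> long 0 1 \<Longrightarrow> inner_star S c"
| "fan {id, gLa, gLb} \<i> S c \<Longrightarrow> inner_star S c"

definition point_star :: "tile set \<Rightarrow> complex \<Rightarrow> bool" where
  "point_star S c \<longleftrightarrow> (\<exists>t. is_tile t \<and> S = {t} \<and> c \<in> interior t)"

lemma hat_alt: "hat g z = (2 - \<i>) * g (z * (2 + \<i>) / 5)"
proof -
  have "z / (2 - \<i>) = z * (2 + \<i>) / 5" by (simp add: field_simps)
  then show ?thesis by (simp only: hat_def)
qed

lemma isometry_reflect:
  assumes "plane_isometry h" shows "2 * h p - h z = h (2 * p - z)"
proof -
  obtain b w v where h: "h = euclid b w v" using assms plane_isometry_iff by auto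
  show ?thesis by (cases b) (simp_all add: h euclid_def conj_if_def algebra_simps)
qed

lemma reflect_isometry: "plane_isometry (\<lambda>z. 2 * c - z)"
  by (simp add: plane_isometry_def dist_norm norm_minus_commute)

lemma reflect_tile:
  assumes "plane_isometry h" shows "(\<lambda>z. 2 * h p - z) ` tile_of (h \<circ> f) = tile_of (h \<circ> (\<lambda>z. 2 * p - f z))"
  by (simp add: tile_of_def image_image isometry_reflect[OF assms])

lemma tile_of_comp_inj:
  assumes "plane_isometry h" "plane_isometry f" "plane_isometry g" "tile_of (h \<circ> f) = tile_of (h \<circ> g)"
  shows "f = g"
proof -
  have "h \<circ> f = h \<circ> g" using assms by (intro tile_of_inj plane_isometry_comp)
  then have "h (f z) = h (g z)" for z by (metis comp_apply)
  then show ?thesis using plane_isometry_inj[OF assms(1)] by (auto simp: fun_eq_iff dest: injD)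
qed

text \<open>Reflecting at the point permutes the tiles, and by rigidity it permutes their
  placements; central symmetry thus becomes a condition on the finite list \<open>G\<close>.\<close>

lemma fan_symmetric:
  assumes "fan G p S c" "\<And>t. t \<in> S \<Longrightarrow> (\<lambda>z. 2 * c - z) ` t \<in> S"
    "\<And>g. g \<in> G \<Longrightarrow> plane_isometry g" "g \<in> G"
  obtains g' where "g' \<in> G" "g' = (\<lambda>z. 2 * p - g z)"
proof -
  obtain h where h: "plane_isometry h" "S = (\<lambda>g. tile_of (h \<circ> g)) ` G" "c = h p"
    using assms(1) by (auto simp: fan_def)
  have "tile_of (h \<circ> (\<lambda>z. 2 * p - g z)) \<in> S"
    using assms(2)[of "tile_of (h \<circ> g)"] assms(4) unfolding h reflect_tile[OF h(1)] by blast
  then obtain g' where "g' \<in> G" "tile_of (h \<circ> (\<lambda>z. 2 * p - g z)) = tile_of (h \<circ> g')"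
    unfolding h by blast
  moreover have "plane_isometry (\<lambda>z. 2 * p - g z)"
    using plane_isometry_comp[OF reflect_isometry assms(3)[OF assms(4)], of p] by (simp add: comp_def)
  ultimately have "g' \<in> G" "(\<lambda>z. 2 * p - g z) = g'"
    using tile_of_comp_inj[OF h(1)] assms(3) by blast+
  then show ?thesis using that by blast
qed

lemma kids_pieces: "q \<in> kids p \<Longrightarrow> q \<in> pieces"
  by (simp add: kids_def)

text \<open>A criterion for asymmetric acute stars: every child has an acute corner at the point,
  and the right-angle vertex of the witness \<open>hat g0 \<circ> q0\<close> has no antipode among
  the right-angle vertices of the children.\<close>

lemma fan_step_acute:
  assumes P: "patch P" and fan: "fan G p (star P c) c" and G: "\<And>g. g \<in> G \<Longrightarrow> plane_isometry g"
    and vertex: "\<forall>g\<in>G. \<forall>q\<in>kids (ginv g p). hat g (q 1) = (2 - \<i>) * p \<or> hat g (q (2 * \<i>)) = (2 - \<i>) * p"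
    and wit: "g0 \<in> G" "q0 \<in> kids (ginv g0 p)"
      "\<forall>g\<in>G. \<forall>q\<in>kids (ginv g p). hat g (q 0) \<noteq> 2 * ((2 - \<i>) * p) - hat g0 (q0 0)"
  shows "acute_star (star (subst P) (sqrt 5 *\<^sub>R c)) (sqrt 5 *\<^sub>R c)"
proof -
  define F where "F = (\<Union>g\<in>G. (\<circ>) (hat g) ` kids (ginv g p))"
  let ?S = "star (subst P) (sqrt 5 *\<^sub>R c)" and ?c = "sqrt 5 *\<^sub>R c"
  have f: "fan F ((2 - \<i>) * p) ?S ?c" unfolding F_def by (rule fan_step[OF P fan G])
  then obtain h where h: "plane_isometry h" "?S = (\<lambda>f. tile_of (h \<circ> f)) ` F" "?c = h ((2 - \<i>) * p)"
    unfolding fan_def by blast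
  have iso: "plane_isometry f" if "f \<in> F" for f
    using that by (auto simp: F_def intro: plane_isometry_comp hat_isometry G pieces_isometry kids_pieces)
  have "\<exists>h. plane_isometry h \<and> t = tile_of h \<and> (?c = h 1 \<or> ?c = h (2 * \<i>))" if tS: "t \<in> ?S" for t
  proof -
    obtain f where f: "f \<in> F" "t = tile_of (h \<circ> f)" using tS unfolding h(2) by blast
    then obtain g q where gq: "g \<in> G" "q \<in> kids (ginv g p)" "f = hat g \<circ> q" unfolding F_def by blast
    have "f 1 = (2 - \<i>) * p \<or> f (2 * \<i>) = (2 - \<i>) * p"
      using vertex gq by auto
    then have "?c = (h \<circ> f) 1 \<or> ?c = (h \<circ> f) (2 * \<i>)"
      unfolding h(3) comp_def by (elim disjE) simp_all
    then show ?thesis using f(2) plane_isometry_comp[OF h(1) iso[OF f(1)]] by blast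
  qed
  moreover have "\<exists>t\<in>?S. (\<lambda>z. 2 * ?c - z) ` t \<notin> ?S"
  proof (rule ccontr)
    assume "\<not> ?thesis"
    then have sym: "\<And>t. t \<in> ?S \<Longrightarrow> (\<lambda>z. 2 * ?c - z) ` t \<in> ?S" by blast
    have f0: "hat g0 \<circ> q0 \<in> F" unfolding F_def using wit by blast
    obtain f' where f': "f' \<in> F" "f' = (\<lambda>z. 2 * ((2 - \<i>) * p) - (hat g0 \<circ> q0) z)"
      using fan_symmetric[OF f sym iso f0] by blast
    then obtain g q where "g \<in> G" "q \<in> kids (ginv g p)" "f' = hat g \<circ> q" unfolding F_def by blast
    moreover have "f' 0 = 2 * ((2 - \<i>) * p) - hat g0 (q0 0)" unfolding f'(2) by simp
    ultimately have "hat g (q 0) = 2 * ((2 - \<i>) * p) - hat g0 (q0 0)" by simp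
    then show False using wit(3) \<open>g \<in> G\<close> \<open>q \<in> kids (ginv g p)\<close> by blast
  qed
  ultimately show ?thesis unfolding acute_star_def by blast
qed

section \<open>Evolution of each star type under one substitution\<close>

lemmas mapeq = fun_eq_iff hat_alt g_defs q_defs rA_def complex_eq_iff

text \<open>The reflection \<open>gHm\<close> fixes the point, so both sides see the same place of
  the division 1 + 2 + 2 of the hypotenuse. Inside a segment two children meet along a whole leg;
  the joints 2/5 and 6/5 give \<open>fanF\<close> and \<open>fanM\<close>.\<close>

lemma step_gHm:
  assumes "patch P" "fan {id, gHm} p (star P c) c" "p \<in> hyp"
  shows "outer_star (star (subst P) (sqrt 5 *\<^sub>R c)) (sqrt 5 *\<^sub>R c)"
proof -
  note h = kids_hyp[OF assms(3)]
  have fix_p: "gHm p = p"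
    using assms(3) by (auto simp: hyp_def g_defs complex_eq_iff field_simps)
  note pair = fan_step_pair[OF assms(1,2) g_isometry(1) fix_p]
  note two = fan_step2[OF assms(1,2) g_isometry(1) fix_p]
  consider "Im p < 2/5" | "Im p = 2/5" | "2/5 < Im p" "Im p < 6/5" | "Im p = 6/5" | "6/5 < Im p"
    by linarith
  then show ?thesis
  proof cases
    case 1
    \<comment> \<open>The new point is \<open>(2 - \<i>) * p\<close> in the coordinates of the child
      \<open>q1\<close>; the points in the other cases arise in the same way from their reference
      child.\<close>
    have "fan {id, gSm} (Complex (1 - 5/2 * Im p) 0) (star (subst P) (sqrt 5 *\<^sub>R c)) (sqrt 5 *\<^sub>R c)"
      by (rule pair[OF h(1)[OF 1] h(1)[OF 1] q_isometry(1)])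
        (use assms(3) in \<open>auto simp: field_simps mapeq hyp_def\<close>)
    then show ?thesis
      by (intro outer_star.intros edge_star.intros(4)) (use assms(3) 1 in \<open>auto simp: short_def hyp_def\<close>)
  next
    case 2
    have e: "q3 = q1 \<circ> gLb" "q4 = q1 \<circ> gV3" "hat gHm \<circ> q1 = q1 \<circ> gSm"
      "hat gHm \<circ> (q1 \<circ> gLb) = q1 \<circ> gV4" "hat gHm \<circ> (q1 \<circ> gV3) = q1 \<circ> gV5"
      by (auto simp: field_simps mapeq)
    have "fan fanF 0 (star (subst P) (sqrt 5 *\<^sub>R c)) (sqrt 5 *\<^sub>R c)"
      by (rule fan_rebase[OF two[OF h(2)[OF 2] h(2)[OF 2]] _ q_isometry(1)])
        (use assms(3) 2 in \<open>auto simp: e fanF_def hyp_def complex_eq_iff q1_def\<close>)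
    then show ?thesis by (rule outer_star.intros)
  next
    case 3
    have "fan {id, gLm} (Complex 0 (3 - 5/2 * Im p)) (star (subst P) (sqrt 5 *\<^sub>R c)) (sqrt 5 *\<^sub>R c)"
      by (rule pair[OF h(3)[OF 3] h(3)[OF 3] q_isometry(4)])
        (use assms(3) in \<open>auto simp: field_simps mapeq hyp_def\<close>)
    then show ?thesis
      by (intro outer_star.intros edge_star.intros(3)) (use assms(3) 3 in \<open>auto simp: long_def hyp_def\<close>)
  next
    case 4
    have e: "q5 = q4 \<circ> gSm" "hat gHm \<circ> q4 = q4 \<circ> gLm" "hat gHm \<circ> (q4 \<circ> gSm) = q4 \<circ> gM3"
      by (auto simp: field_simps mapeq)
    have "fan fanM 0 (star (subst P) (sqrt 5 *\<^sub>R c)) (sqrt 5 *\<^sub>R c)"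
      by (rule fan_rebase[OF two[OF h(4)[OF 4] h(4)[OF 4]] _ q_isometry(4)])
        (use assms(3) 4 in \<open>auto simp: e fanM_def hyp_def complex_eq_iff q4_def\<close>)
    then show ?thesis by (rule outer_star.intros)
  next
    case 5
    have "fan {id, gLm} (Complex 0 (5/2 * Im p - 3)) (star (subst P) (sqrt 5 *\<^sub>R c)) (sqrt 5 *\<^sub>R c)"
      by (rule pair[OF h(5)[OF 5] h(5)[OF 5] q_isometry(5)])
        (use assms(3) in \<open>auto simp: field_simps mapeq hyp_def\<close>)
    then show ?thesis
      by (intro outer_star.intros edge_star.intros(3)) (use assms(3) 5 in \<open>auto simp: long_def hyp_def\<close>)
  qed
qed

text \<open>The half-turn lays the division 1 + 2 + 2 against its reverse 2 + 2 + 1, so the joints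
  sit at 2/5, 4/5, 6/5 and 8/5. Exchanging the two tiles reduces to \<open>Im p \<le> 1\<close>,
  where only the first two occur.\<close>

lemma step_gHr:
  assumes "patch P" "fan {id, gHr} p (star P c) c" "p \<in> hyp"
  shows "outer_star (star (subst P) (sqrt 5 *\<^sub>R c)) (sqrt 5 *\<^sub>R c)"
proof -
  have *: ?thesis if fan: "fan {id, gHr} p (star P c) c" and p: "p \<in> hyp" and le: "Im p \<le> 1" for p
  proof -
    note h = kids_hyp[OF p]
    have r: "gHr (gHr p) = p" by (simp add: g_defs)
    have rh: "gHr p \<in> hyp" and Imr: "Im (gHr p) = 2 - Im p" using p by (auto simp: hyp_def g_defs)
    note k = kids_hyp[OF rh, unfolded Imr]
    note two = fan_step2[OF assms(1) fan g_isometry(2) r]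
    consider "Im p < 2/5" | "Im p = 2/5" | "2/5 < Im p" "Im p < 4/5" | "Im p = 4/5" | "4/5 < Im p"
      by linarith
    then show ?thesis
    proof cases
      case 1
      then have k1: "kids (gHr p) = {q5}" by (intro k) auto
      \<comment> \<open>The child of the second tile is the reference here, because its long leg is
        the one along which the short leg of \<open>q1\<close> lies.\<close>
      have e: "q1 = hat gHr \<circ> (q5 \<circ> gLa)" by (auto simp: field_simps mapeq)
      have "fan {id, gLa} (Complex 0 (2 - 5/2 * Im p)) (star (subst P) (sqrt 5 *\<^sub>R c)) (sqrt 5 *\<^sub>R c)"
        by (rule fan_rebase[OF two[OF h(1)[OF 1] k1], where a = "hat gHr \<circ> q5"])
          (use p in \<open>auto simp: e comp_assoc hat_isometry q_isometry intro!: plane_isometry_comp,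
            auto simp: field_simps mapeq hyp_def\<close>)
      then show ?thesis
        by (intro outer_star.intros(1) edge_star.intros(7)) (use p 1 in \<open>auto simp: long_def hyp_def\<close>)
    next
      case 2
      then have k1: "kids (gHr p) = {q5}" by (intro k) auto
      have e: "q1 = hat gHr \<circ> (q5 \<circ> gLa)" "q3 = hat gHr \<circ> (q5 \<circ> gF3)" "q4 = hat gHr \<circ> (q5 \<circ> gF4)"
        by (auto simp: field_simps mapeq)
      have "fan {id, gLa, gF3, gF4} \<i> (star (subst P) (sqrt 5 *\<^sub>R c)) (sqrt 5 *\<^sub>R c)"
        by (rule fan_rebase[OF two[OF h(2)[OF 2] k1], where a = "hat gHr \<circ> q5"])
          (use p 2 in \<open>auto simp: e comp_assoc hat_isometry q_isometry intro!: plane_isometry_comp,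
            auto simp: field_simps mapeq hyp_def\<close>)
      then show ?thesis by (rule outer_star.intros)
    next
      case 3
      then have h1: "kids p = {q4}" and k1: "kids (gHr p) = {q5}" by (intro h k; linarith)+
      have "fan {id, gLg} (Complex 0 (3 - 5/2 * Im p)) (star (subst P) (sqrt 5 *\<^sub>R c)) (sqrt 5 *\<^sub>R c)"
        by (rule fan_step_pair[OF assms(1) fan g_isometry(2) r h1 k1 q_isometry(4)])
          (use p in \<open>auto simp: field_simps mapeq hyp_def\<close>)
      then show ?thesis
        by (intro outer_star.intros(1) edge_star.intros(6)) (use p 3 in \<open>auto simp: long_def hyp_def\<close>)
    next
      case 4
      then have h1: "kids p = {q4}" and k1: "kids (gHr p) = {q4, q5}" by (intro h k; linarith)+
      have e: "hat gHr \<circ> q4 = q4 \<circ> gLr" "hat gHr \<circ> q5 = q4 \<circ> gLg"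
        by (auto simp: field_simps mapeq)
      have "fan {id, gLr, gLg} \<i> (star (subst P) (sqrt 5 *\<^sub>R c)) (sqrt 5 *\<^sub>R c)"
        by (rule fan_rebase[OF two[OF h1 k1] _ q_isometry(4)])
          (use p 4 in \<open>auto simp: e, auto simp: field_simps mapeq hyp_def\<close>)
      then show ?thesis by (rule outer_star.intros)
    next
      case 5
      then have h1: "kids p = {q4}" and k1: "kids (gHr p) = {q4}" using le by (intro h k; linarith)+
      have "fan {id, gLr} (Complex 0 (3 - 5/2 * Im p)) (star (subst P) (sqrt 5 *\<^sub>R c)) (sqrt 5 *\<^sub>R c)"
        by (rule fan_step_pair[OF assms(1) fan g_isometry(2) r h1 k1 q_isometry(4)])
          (use p in \<open>auto simp: field_simps mapeq hyp_def\<close>)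
      then show ?thesis
        by (intro outer_star.intros(1) edge_star.intros(5)) (use p le 5 in \<open>auto simp: long_def hyp_def\<close>)
    qed
  qed
  show ?thesis
  proof (cases "Im p \<le> 1")
    case True then show ?thesis using * assms by blast
  next
    case False
    have "fan {id, gHr} (gHr p) (star P c) c"
      by (rule fan_swap[OF assms(2)]) (auto simp: g_defs fun_eq_iff)
    moreover have "gHr p \<in> hyp" "Im (gHr p) \<le> 1" using assms(3) False by (auto simp: hyp_def g_defs)
    ultimately show ?thesis by (rule *)
  qed
qed

lemma Union_insert_fans: "(\<Union>g\<in>insert a G. F g) = F a \<union> (\<Union>g\<in>G. F g)" by simp

lemma ginv_vals [simp]:
  "ginv id p = p" "ginv gLm \<i> = \<i>" "ginv gLa \<i> = 0" "ginv gLb \<i> = 0" "ginv gF3 \<i> = 1" "ginv gF4 \<i> = 2 * \<i>"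
  "ginv gLr \<i> = 0" "ginv gLg \<i> = 0" "ginv gSm 0 = 0" "ginv gLm 0 = 0" "ginv gM3 0 = 0"
  "ginv gLb 0 = 1" "ginv gV3 0 = 2 * \<i>" "ginv gV4 0 = 1" "ginv gV5 0 = 2 * \<i>"
  by (rule ginv_eqI, simp_all add: g_defs)+

lemma step_gLm:
  assumes "patch P" "fan {id, gLm} p (star P c) c" "p \<in> long 0 2"
  shows "outer_star (star (subst P) (sqrt 5 *\<^sub>R c)) (sqrt 5 *\<^sub>R c)"
proof -
  have fix_p: "gLm p = p" using assms(3) by (auto simp: long_def g_defs complex_eq_iff)
  note pair = fan_step_pair[OF assms(1,2) g_isometry(3) fix_p]
  consider "p \<in> long 0 1" | "p = \<i>" | "p \<in> long 1 2"
    using assms(3) by (fastforce simp: long_def complex_eq_iff)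
  then show ?thesis
  proof cases
    case 1
    note k = kids_long(1)[OF 1]
    have "fan {id, gHm} (Complex (1 - Im p) (2 * Im p)) (star (subst P) (sqrt 5 *\<^sub>R c)) (sqrt 5 *\<^sub>R c)"
      by (rule pair[OF k k q_isometry(2)]) (use 1 in \<open>auto simp: field_simps mapeq long_def\<close>)
    then show ?thesis
      by (intro outer_star.intros(1) edge_star.intros(1)) (use 1 in \<open>auto simp: long_def hyp_def\<close>)
  next
    case 2
    have "acute_star (star (subst P) (sqrt 5 *\<^sub>R c)) (sqrt 5 *\<^sub>R c)"
      by (rule fan_step_acute[OF assms(1) assms(2)[unfolded 2], where ?g0.0 = id and ?q0.0 = q2])
        (auto simp: kids_long, auto simp: field_simps mapeq)
    then show ?thesis by (rule outer_star.intros)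
  next
    case 3
    note k = kids_long(3)[OF 3]
    have "fan {id, gHm} (Complex (2 - Im p) (2 * Im p - 2)) (star (subst P) (sqrt 5 *\<^sub>R c)) (sqrt 5 *\<^sub>R c)"
      by (rule pair[OF k k q_isometry(5)]) (use 3 in \<open>auto simp: field_simps mapeq long_def\<close>)
    then show ?thesis
      by (intro outer_star.intros(1) edge_star.intros(1)) (use 3 in \<open>auto simp: long_def hyp_def\<close>)
  qed
qed

text \<open>A short leg, and each half of a long leg, dilates to exactly one hypotenuse of a child.
  Both sides contribute one piece, hypotenuse against hypotenuse, and only the mirrored and the
  half-turned position have to be told apart.\<close>

lemma step_leg:
  assumes P: "patch P" and
   "fan {id, gSm} p (star P c) c \<and> p \<in> short \<or> fan {id, gLr} p (star P c) c \<and> p \<in> long 0 1 \<or>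
    fan {id, gLg} p (star P c) c \<and> p \<in> long 1 2 \<or> fan {id, gLa} p (star P c) c \<and> p \<in> long 1 2 \<or>
    fan {id, gLb} p (star P c) c \<and> p \<in> long 0 1"
  shows "outer_star (star (subst P) (sqrt 5 *\<^sub>R c)) (sqrt 5 *\<^sub>R c)"
  using assms(2)
proof (elim disjE conjE)
  assume f: "fan {id, gSm} p (star P c) c" and p: "p \<in> short"
  note k = kids_short[OF p]
  have "fan {id, gHm} (Complex (Re p) (2 - 2 * Re p)) (star (subst P) (sqrt 5 *\<^sub>R c)) (sqrt 5 *\<^sub>R c)"
    by (rule fan_step_pair[OF P f g_isometry(4) _ k k q_isometry(1)]) (use p in \<open>auto simp: field_simps mapeq short_def\<close>)
  then show ?thesis
    by (intro outer_star.intros(1) edge_star.intros(1)) (use p in \<open>auto simp: short_def hyp_def\<close>)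
next
  assume f: "fan {id, gLr} p (star P c) c" and p: "p \<in> long 0 1"
  have r: "gLr (\<i> - p) = p" "\<i> - p \<in> long 0 1" using p by (auto simp: g_defs long_def)
  have "fan {id, gHr} (Complex (1 - Im p) (2 * Im p)) (star (subst P) (sqrt 5 *\<^sub>R c)) (sqrt 5 *\<^sub>R c)"
    by (rule fan_step_pair[OF P f g_isometry(5) r(1) kids_long(1)[OF p] kids_long(1)[OF r(2)] q_isometry(2)])
      (use p in \<open>auto simp: field_simps mapeq long_def\<close>)
  then show ?thesis
    by (intro outer_star.intros(1) edge_star.intros(2)) (use p in \<open>auto simp: long_def hyp_def\<close>)
next
  assume f: "fan {id, gLg} p (star P c) c" and p: "p \<in> long 1 2"
  have r: "gLg (p - \<i>) = p" "p - \<i> \<in> long 0 1" using p by (auto simp: g_defs long_def complex_eq_iff)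
  have "fan {id, gHm} (Complex (2 - Im p) (2 * Im p - 2)) (star (subst P) (sqrt 5 *\<^sub>R c)) (sqrt 5 *\<^sub>R c)"
    by (rule fan_step_pair[OF P f g_isometry(6) r(1) kids_long(3)[OF p] kids_long(1)[OF r(2)] q_isometry(5)])
      (use p in \<open>auto simp: field_simps mapeq long_def\<close>)
  then show ?thesis
    by (intro outer_star.intros(1) edge_star.intros(1)) (use p in \<open>auto simp: long_def hyp_def\<close>)
next
  assume f: "fan {id, gLa} p (star P c) c" and p: "p \<in> long 1 2"
  have r: "gLa (Complex (Im p - 1) 0) = p" "Complex (Im p - 1) 0 \<in> short"
    using p by (auto simp: g_defs long_def short_def complex_eq_iff)
  have "fan {id, gHr} (Complex (2 - Im p) (2 * Im p - 2)) (star (subst P) (sqrt 5 *\<^sub>R c)) (sqrt 5 *\<^sub>R c)"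
    by (rule fan_step_pair[OF P f g_isometry(7) r(1) kids_long(3)[OF p] kids_short[OF r(2)] q_isometry(5)])
      (use p in \<open>auto simp: field_simps mapeq long_def\<close>)
  then show ?thesis
    by (intro outer_star.intros(1) edge_star.intros(2)) (use p in \<open>auto simp: long_def hyp_def\<close>)
next
  assume f: "fan {id, gLb} p (star P c) c" and p: "p \<in> long 0 1"
  have r: "gLb (Complex (1 - Im p) 0) = p" "Complex (1 - Im p) 0 \<in> short"
    using p by (auto simp: g_defs long_def short_def complex_eq_iff)
  have "fan {id, gHm} (Complex (1 - Im p) (2 * Im p)) (star (subst P) (sqrt 5 *\<^sub>R c)) (sqrt 5 *\<^sub>R c)"
    by (rule fan_step_pair[OF P f g_isometry(8) r(1) kids_long(1)[OF p] kids_short[OF r(2)] q_isometry(2)])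
      (use p in \<open>auto simp: field_simps mapeq long_def\<close>)
  then show ?thesis
    by (intro outer_star.intros(1) edge_star.intros(1)) (use p in \<open>auto simp: long_def hyp_def\<close>)
qed

text \<open>Whether the point is the midpoint of a long leg or a corner of a tile, all children that
  reach it do so with an acute corner, so the criterion for acute stars applies.\<close>

lemma step_junction:
  assumes P: "patch P" and
   "fan {id, gLa, gF3, gF4} \<i> (star P c) c \<or> fan {id, gLr, gLg} \<i> (star P c) c \<or>
    fan {id, gLa, gLb} \<i> (star P c) c"
  shows "acute_star (star (subst P) (sqrt 5 *\<^sub>R c)) (sqrt 5 *\<^sub>R c)"
  using assms(2)
proof (elim disjE)
  assume f: "fan {id, gLa, gF3, gF4} \<i> (star P c) c"
  show ?thesis
    by (rule fan_step_acute[OF P f, where ?g0.0 = id and ?q0.0 = q4])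
      (auto simp: kids_long kids_vertex, auto simp: field_simps mapeq)
next
  assume f: "fan {id, gLr, gLg} \<i> (star P c) c"
  show ?thesis
    by (rule fan_step_acute[OF P f, where ?g0.0 = id and ?q0.0 = q2])
      (auto simp: kids_long kids_vertex, auto simp: field_simps mapeq)
next
  assume f: "fan {id, gLa, gLb} \<i> (star P c) c"
  show ?thesis
    by (rule fan_step_acute[OF P f, where ?g0.0 = id and ?q0.0 = q4])
      (auto simp: kids_long kids_vertex, auto simp: field_simps mapeq)
qed

lemma kids_fanM: "(\<Union>g\<in>fanM. (\<circ>) (hat g) ` kids (ginv g 0)) = fanA"
proof -
  have e: "q1 = (\<lambda>z. 2 - \<i> * cnj z)" "q2 = (\<lambda>z. 1 - cnj z)"
    "hat gSm \<circ> q1 = (\<lambda>z. rA * (2 + \<i> * z))" "hat gSm \<circ> q2 = (\<lambda>z. rA * (1 - z))"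
    "hat gLm \<circ> q1 = (\<lambda>z. rA * (- 2 - \<i> * z))" "hat gLm \<circ> q2 = (\<lambda>z. rA * (- 1 + z))"
    "hat gM3 \<circ> q1 = (\<lambda>z. - 2 + \<i> * cnj z)" "hat gM3 \<circ> q2 = (\<lambda>z. - 1 + cnj z)"
    by (auto simp: field_simps mapeq)
  show ?thesis
    unfolding fanM_def Union_insert_fans ginv_vals kids_vertex image_insert image_empty hat_id id_comp e(3-8)
    unfolding fanA_def e(1,2) by auto
qed

lemma fan_isometry:
  "f \<in> fanM \<Longrightarrow> plane_isometry f" "f \<in> fanF \<Longrightarrow> plane_isometry f"
  by (auto simp: fanM_def fanF_def)

lemma step_fanM:
  assumes P: "patch P" and f: "fan fanM 0 (star P c) c"
  shows "fan fanA 0 (star (subst P) (sqrt 5 *\<^sub>R c)) (sqrt 5 *\<^sub>R c)"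
  using fan_step[OF P f fan_isometry(1)] by (simp only: kids_fanM mult_zero_right)

text \<open>Together with \<open>step_fanM\<close> this shows that the asymmetric
  \<open>fanF\<close> and the symmetric \<open>fanM\<close> have the same substitution. A symmetric
  star may therefore have an asymmetric parent star, and symmetry has to be supplied for the parent
  tiling separately.\<close>

lemma step_fanF:
  assumes P: "patch P" and f: "fan fanF 0 (star P c) c"
  shows "fan fanA 0 (star (subst P) (sqrt 5 *\<^sub>R c)) (sqrt 5 *\<^sub>R c)"
proof -
  have e: "q1 = (\<lambda>z. 2 - \<i> * cnj z)" "q2 = (\<lambda>z. 1 - cnj z)"
    "hat gSm \<circ> q1 = (\<lambda>z. rA * (2 + \<i> * z))" "hat gSm \<circ> q2 = (\<lambda>z. rA * (1 - z))"
    "hat gLb \<circ> q1 = (\<lambda>z. rA * (- 1 + z))" "hat gV3 \<circ> q5 = (\<lambda>z. rA * (- 2 - \<i> * z))"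
    "hat gV4 \<circ> q1 = (\<lambda>z. - 1 + cnj z)" "hat gV5 \<circ> q5 = (\<lambda>z. - 2 + \<i> * cnj z)"
    by (auto simp: field_simps mapeq)
  have eq: "(\<Union>g\<in>fanF. (\<circ>) (hat g) ` kids (ginv g 0)) = fanA"
    unfolding fanF_def Union_insert_fans ginv_vals kids_vertex image_insert image_empty hat_id id_comp e(3-8)
    unfolding fanA_def e(1,2) by auto
  have "\<And>g. g \<in> fanF \<Longrightarrow> plane_isometry g" by (auto simp: fanF_def)
  from fan_step[OF P f this] show ?thesis by (simp only: eq mult_zero_right)
qed

lemma fanAB_isometry:
  "f \<in> fanA \<Longrightarrow> plane_isometry f" "f \<in> fanB \<Longrightarrow> plane_isometry f"
proof -
  have n: "norm rA = 1" "norm (rA * \<i>) = 1" "norm (- rA) = 1" "norm (- rA * \<i>) = 1"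
    by (simp_all add: rA_def cmod_def power2_eq_square norm_mult)
  have 1: "plane_isometry (\<lambda>z. 2 - \<i> * cnj z)" "plane_isometry (\<lambda>z. - 2 + \<i> * cnj z)"
    by (rule euclidI[of "-\<i>" _ True 2]; simp add: conj_if_def)
      (rule euclidI[of "\<i>" _ True "-2"]; simp add: conj_if_def)
  have 2: "plane_isometry (\<lambda>z. 1 - cnj z)" "plane_isometry (\<lambda>z. - 1 + cnj z)"
    by (rule euclidI[of "-1" _ True 1]; simp add: conj_if_def)
      (rule euclidI[of "1" _ True "-1"]; simp add: conj_if_def)
  have 3: "plane_isometry (\<lambda>z. rA * (2 + \<i> * z))" "plane_isometry (\<lambda>z. rA * (- 2 - \<i> * z))"
    by (rule euclidI[OF n(2), of _ False "2 * rA"]; simp add: conj_if_def algebra_simps)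
      (rule euclidI[OF n(4), of _ False "-2 * rA"]; simp add: conj_if_def algebra_simps)
  have 4: "plane_isometry (\<lambda>z. rA * (1 - z))" "plane_isometry (\<lambda>z. rA * (- 1 + z))"
    by (rule euclidI[OF n(3), of _ False rA]; simp add: conj_if_def algebra_simps)
      (rule euclidI[OF n(1), of _ False "-rA"]; simp add: conj_if_def algebra_simps)
  show "f \<in> fanA \<Longrightarrow> plane_isometry f" using 1 2 3 4 unfolding fanA_def by blast
  have 5: "plane_isometry (\<lambda>z. \<i> * (1 - cnj z))" "plane_isometry (\<lambda>z. \<i> * (- 1 + cnj z))"
    by (rule euclidI[of "-\<i>" _ True \<i>]; simp add: conj_if_def algebra_simps)
      (rule euclidI[of "\<i>" _ True "-\<i>"]; simp add: conj_if_def algebra_simps)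
  have 6: "plane_isometry (\<lambda>z. 2 + \<i> * z)" "plane_isometry (\<lambda>z. - 2 - \<i> * z)"
    by (rule euclidI[of "\<i>" _ False 2]; simp add: conj_if_def algebra_simps)
      (rule euclidI[of "-\<i>" _ False "-2"]; simp add: conj_if_def algebra_simps)
  have 7: "plane_isometry (\<lambda>z. \<i> * (1 - z))" "plane_isometry (\<lambda>z. \<i> * (- 1 + z))"
    by (rule euclidI[of "-\<i>" _ False \<i>]; simp add: conj_if_def algebra_simps)
      (rule euclidI[of "\<i>" _ False "-\<i>"]; simp add: conj_if_def algebra_simps)
  show "f \<in> fanB \<Longrightarrow> plane_isometry f" using 1 5 6 7 unfolding fanB_def by blast
qed

lemma kids_fanA: "(\<Union>g\<in>fanA. (\<circ>) (hat g) ` kids (ginv g 0)) = (\<circ>) (\<lambda>z. rA * z) ` fanB"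
proof -
  have g: "ginv (\<lambda>z. 2 - \<i> * cnj z) 0 = 2 * \<i>" "ginv (\<lambda>z. - 2 + \<i> * cnj z) 0 = 2 * \<i>"
    "ginv (\<lambda>z. 1 - cnj z) 0 = 1" "ginv (\<lambda>z. - 1 + cnj z) 0 = 1"
    "ginv (\<lambda>z. rA * (2 + \<i> * z)) 0 = 2 * \<i>" "ginv (\<lambda>z. rA * (- 2 - \<i> * z)) 0 = 2 * \<i>"
    "ginv (\<lambda>z. rA * (1 - z)) 0 = 1" "ginv (\<lambda>z. rA * (- 1 + z)) 0 = 1"
    by (rule ginv_eqI, rule fanAB_isometry(1), simp add: fanA_def, simp add: complex_eq_iff)+
  have e: "hat (\<lambda>z. 2 - \<i> * cnj z) \<circ> q5 = (\<lambda>z. rA * (2 + \<i> * z))"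
    "hat (\<lambda>z. - 2 + \<i> * cnj z) \<circ> q5 = (\<lambda>z. rA * (- 2 - \<i> * z))"
    "hat (\<lambda>z. 1 - cnj z) \<circ> q1 = (\<lambda>z. rA * (\<i> * (1 - z)))"
    "hat (\<lambda>z. - 1 + cnj z) \<circ> q1 = (\<lambda>z. rA * (\<i> * (- 1 + z)))"
    "hat (\<lambda>z. rA * (2 + \<i> * z)) \<circ> q5 = (\<lambda>z. rA * (2 - \<i> * cnj z))"
    "hat (\<lambda>z. rA * (- 2 - \<i> * z)) \<circ> q5 = (\<lambda>z. rA * (- 2 + \<i> * cnj z))"
    "hat (\<lambda>z. rA * (1 - z)) \<circ> q1 = (\<lambda>z. rA * (\<i> * (- 1 + cnj z)))"
    "hat (\<lambda>z. rA * (- 1 + z)) \<circ> q1 = (\<lambda>z. rA * (\<i> * (1 - cnj z)))"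
    by (auto simp: fun_eq_iff hat_alt q_defs rA_def complex_eq_iff field_simps)
  show ?thesis
    unfolding fanA_def Union_insert_fans g kids_vertex image_insert image_empty e
    unfolding fanB_def image_insert image_empty comp_def by blast
qed

lemma step_fanA:
  assumes P: "patch P" and f: "fan fanA 0 (star P c) c"
  shows "fan fanB 0 (star (subst P) (sqrt 5 *\<^sub>R c)) (sqrt 5 *\<^sub>R c)"
proof (rule fan_rebase[OF fan_step[OF P f fanAB_isometry(1)] kids_fanA])
  show "plane_isometry (\<lambda>z. rA * z)"
    by (rule euclidI[of rA _ False 0]) (simp_all add: conj_if_def rA_def cmod_def power2_eq_square)
qed simp_all

lemma kids_fanB: "(\<Union>g\<in>fanB. (\<circ>) (hat g) ` kids (ginv g 0)) = fanA"
proof -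
  have g: "ginv (\<lambda>z. 2 - \<i> * cnj z) 0 = 2 * \<i>" "ginv (\<lambda>z. - 2 + \<i> * cnj z) 0 = 2 * \<i>"
    "ginv (\<lambda>z. \<i> * (1 - cnj z)) 0 = 1" "ginv (\<lambda>z. \<i> * (- 1 + cnj z)) 0 = 1"
    "ginv (\<lambda>z. 2 + \<i> * z) 0 = 2 * \<i>" "ginv (\<lambda>z. - 2 - \<i> * z) 0 = 2 * \<i>"
    "ginv (\<lambda>z. \<i> * (1 - z)) 0 = 1" "ginv (\<lambda>z. \<i> * (- 1 + z)) 0 = 1"
    by (rule ginv_eqI, rule fanAB_isometry(2), simp add: fanB_def, simp add: complex_eq_iff)+
  have e: "hat (\<lambda>z. 2 - \<i> * cnj z) \<circ> q5 = (\<lambda>z. rA * (2 + \<i> * z))"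
    "hat (\<lambda>z. - 2 + \<i> * cnj z) \<circ> q5 = (\<lambda>z. rA * (- 2 - \<i> * z))"
    "hat (\<lambda>z. \<i> * (1 - cnj z)) \<circ> q1 = (\<lambda>z. rA * (- 1 + z))"
    "hat (\<lambda>z. \<i> * (- 1 + cnj z)) \<circ> q1 = (\<lambda>z. rA * (1 - z))"
    "hat (\<lambda>z. 2 + \<i> * z) \<circ> q5 = (\<lambda>z. 2 - \<i> * cnj z)"
    "hat (\<lambda>z. - 2 - \<i> * z) \<circ> q5 = (\<lambda>z. - 2 + \<i> * cnj z)"
    "hat (\<lambda>z. \<i> * (1 - z)) \<circ> q1 = (\<lambda>z. 1 - cnj z)"
    "hat (\<lambda>z. \<i> * (- 1 + z)) \<circ> q1 = (\<lambda>z. - 1 + cnj z)"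
    by (auto simp: fun_eq_iff hat_alt q_defs rA_def complex_eq_iff field_simps)
  show ?thesis
    unfolding fanB_def Union_insert_fans g kids_vertex image_insert image_empty e
    unfolding fanA_def by blast
qed

lemma step_fanB:
  assumes P: "patch P" and f: "fan fanB 0 (star P c) c"
  shows "fan fanA 0 (star (subst P) (sqrt 5 *\<^sub>R c)) (sqrt 5 *\<^sub>R c)"
  using fan_step[OF P f fanAB_isometry(2)] by (simp only: kids_fanB mult_zero_right)

definition corner_kid :: "complex \<Rightarrow> complex \<Rightarrow> complex" where
  "corner_kid v = (if v = 1 then q1 else q5)"

lemma corner_kid:
  assumes "v = 1 \<or> v = 2 * \<i>"
  shows "kids v = {corner_kid v}" "corner_kid v v = (2 - \<i>) * v" "plane_isometry (corner_kid v)"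
proof -
  have "2 * \<i> \<noteq> (1::complex)" by (simp add: complex_eq_iff)
  then show "kids v = {corner_kid v}" "corner_kid v v = (2 - \<i>) * v" "plane_isometry (corner_kid v)"
    using assms by (auto simp: corner_kid_def kids_vertex q_isometry) (auto simp: q_defs complex_eq_iff)
qed

lemma corner_kid_at:
  assumes "plane_isometry h" "v = 1 \<or> v = 2 * \<i>" "c = h v"
  shows "{x \<in> subst_tile (tile_of h). sqrt 5 *\<^sub>R c \<in> x} = {tile_of (up h \<circ> corner_kid v)}"
  using subst_tile_at[OF assms(1), of v] corner_kid(1)[OF assms(2)] by (simp add: assms(3))

lemma up_reflect: "plane_isometry h \<Longrightarrow> (\<lambda>z. 2 * (sqrt 5 *\<^sub>R c) - up h z) = up (\<lambda>z. 2 * c - h z)"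
  by (auto simp: up_def scaleR_diff_right scaleR_conv_of_real algebra_simps)

text \<open>Passing from a tile at \<open>c\<close> to its one child at the dilated point is
  injective and commutes with the reflection, so a tile without antipode has a child without
  antipode.\<close>

lemma step_acute:
  assumes P: "patch P" and ac: "acute_star (star P c) c"
  shows "acute_star (star (subst P) (sqrt 5 *\<^sub>R c)) (sqrt 5 *\<^sub>R c)"
proof -
  let ?S = "star P c" and ?S' = "star (subst P) (sqrt 5 *\<^sub>R c)" and ?c = "sqrt 5 *\<^sub>R c"
  have vert: "\<exists>h v. plane_isometry h \<and> t = tile_of h \<and> (v = 1 \<or> v = 2 * \<i>) \<and> c = h v" if "t \<in> ?S" for t
    using ac that unfolding acute_star_def by blast
  have down: "\<exists>h v. plane_isometry h \<and> tile_of h \<in> ?S \<and> (v = 1 \<or> v = 2 * \<i>) \<and> c = h v \<and>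
      x = tile_of (up h \<circ> corner_kid v)" if x: "x \<in> ?S'" for x
  proof -
    obtain t where t: "t \<in> ?S" "x \<in> {x \<in> subst_tile t. ?c \<in> x}" using x unfolding star_subst[OF P] by blast
    obtain h v where h: "plane_isometry h" "t = tile_of h" "v = 1 \<or> v = 2 * \<i>" "c = h v"
      using vert[OF t(1)] by blast
    have "x = tile_of (up h \<circ> corner_kid v)"
      using t(2) unfolding h(2) corner_kid_at[OF h(1,3,4)] by simp
    then show ?thesis using t(1) h by metis
  qed
  have upw: "tile_of (up h \<circ> corner_kid v) \<in> ?S'"
    if "plane_isometry h" "tile_of h \<in> ?S" "v = 1 \<or> v = 2 * \<i>" "c = h v" for h v
    using corner_kid_at[OF that(1,3,4)] that(2) unfolding star_subst[OF P] by blast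
  have "\<exists>k. plane_isometry k \<and> x = tile_of k \<and> (?c = k 1 \<or> ?c = k (2 * \<i>))" if x: "x \<in> ?S'" for x
  proof -
    obtain h v where h: "plane_isometry h" "tile_of h \<in> ?S" "v = 1 \<or> v = 2 * \<i>" "c = h v"
      "x = tile_of (up h \<circ> corner_kid v)" using down[OF x] by blast
    then show ?thesis
      using corner_kid[OF h(3)] up_isometry[OF h(1)] up_point[of h v]
      by (intro exI[of _ "up h \<circ> corner_kid v"]) (auto simp: plane_isometry_comp)
  qed
  moreover have "(\<exists>t\<in>?S'. (\<lambda>z. 2 * ?c - z) ` t \<notin> ?S')" if as: "\<exists>t\<in>?S. (\<lambda>z. 2 * c - z) ` t \<notin> ?S"
  proof (rule ccontr)
    assume no: "\<not> ?thesis"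
    obtain t where t: "t \<in> ?S" "(\<lambda>z. 2 * c - z) ` t \<notin> ?S" using as by blast
    obtain h v where h: "plane_isometry h" "t = tile_of h" "v = 1 \<or> v = 2 * \<i>" "c = h v"
      using vert[OF t(1)] by blast
    \<comment> \<open>\<open>h2\<close> places the reflected tile, which is missing from the star.
      If the reflected child were present, it would stem from a tile placed by some
      \<open>k\<close>; the aim is \<open>k = h2\<close>.\<close>
    define h2 where "h2 = (\<lambda>z. 2 * c - h z)"
    have h2: "plane_isometry h2"
      using plane_isometry_comp[OF reflect_isometry h(1), of c] by (simp add: h2_def comp_def)
    have "(\<lambda>z. 2 * ?c - z) ` tile_of (up h \<circ> corner_kid v) \<in> ?S'"
      using no upw[OF h(1) _ h(3,4)] t(1) h(2) by blast
    moreover have "(\<lambda>z. 2 * ?c - z) ` tile_of (up h \<circ> corner_kid v) = tile_of (up h2 \<circ> corner_kid v)"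
      using up_reflect[OF h(1), of c] by (simp add: tile_of_def image_image h2_def fun_eq_iff)
    ultimately obtain k w where k: "plane_isometry k" "tile_of k \<in> ?S" "w = 1 \<or> w = 2 * \<i>" "c = k w"
      "tile_of (up h2 \<circ> corner_kid v) = tile_of (up k \<circ> corner_kid w)" using down by metis
    have eq: "up h2 \<circ> corner_kid v = up k \<circ> corner_kid w"
      by (intro tile_of_inj plane_isometry_comp up_isometry h2 k corner_kid h)
    \<comment> \<open>A corner piece keeps its vertex, so one side sends \<open>v\<close> to the
      point and the other sends \<open>w\<close> there; equality of the maps gives
      \<open>v = w\<close>, hence the same piece.\<close>
    have "up h2 (corner_kid v v) = ?c"
      unfolding corner_kid(2)[OF h(3)] up_point h2_def h(4)[symmetric] by simp
    then have "up k (corner_kid w v) = up k (corner_kid w w)"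
      using fun_cong[OF eq, of v] unfolding corner_kid(2)[OF k(3)] up_point k(4)[symmetric] by simp
    then have "v = w"
      using plane_isometry_inj[OF up_isometry[OF k(1)]] plane_isometry_inj[OF corner_kid(3)[OF k(3)]]
      by (metis injD)
    have "up h2 z = up k z" for z
      using fun_cong[OF eq, of "ginv (corner_kid w) z"] corner_kid(3)[OF k(3)] \<open>v = w\<close> by simp
    then have "up h2 = up k" by (rule ext)
    then have "h2 = k" by (rule up_inj)
    then have "(\<lambda>z. 2 * c - z) ` t = tile_of k" unfolding h(2) h2_def by (auto simp: tile_of_def)
    then show False using t k(2) by simp
  qed
  moreover have "(\<exists>t\<in>?S. (\<lambda>z. 2 * c - z) ` t \<notin> ?S) \<or> fan fanA 0 ?S c \<or> fan fanB 0 ?S c"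
    using ac unfolding acute_star_def by (rule conjunct2)
  ultimately show ?thesis
    using step_fanA[OF P] step_fanB[OF P] unfolding acute_star_def[of ?S'] by (metis (no_types, lifting))
qed

lemma fanA_acute: assumes "fan fanA 0 S c" shows "acute_star S c"
proof -
  obtain h where h: "plane_isometry h" "S = (\<lambda>f. tile_of (h \<circ> f)) ` fanA" "c = h 0"
    using assms by (auto simp: fan_def)
  have "f 1 = 0 \<or> f (2 * \<i>) = 0" if "f \<in> fanA" for f
    using that unfolding fanA_def by (elim insertE emptyE) (simp_all add: complex_eq_iff)
  then have v: "h 0 = (h \<circ> f) 1 \<or> h 0 = (h \<circ> f) (2 * \<i>)" if "f \<in> fanA" for f
    using that by fastforce
  have "\<exists>k. plane_isometry k \<and> t = tile_of k \<and> (c = k 1 \<or> c = k (2 * \<i>))" if tS: "t \<in> S" for t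
  proof -
    obtain f where f: "f \<in> fanA" "t = tile_of (h \<circ> f)" using tS unfolding h(2) by blast
    show ?thesis
      by (rule exI[of _ "h \<circ> f"]) (use v[OF f(1)] f(2) h(3) plane_isometry_comp[OF h(1) fanAB_isometry(1)[OF f(1)]] in simp)
  qed
  then show ?thesis using assms unfolding acute_star_def by simp
qed

lemma step_inner:
  assumes P: "patch P" and st: "inner_star (star P c) c"
  shows "outer_star (star (subst P) (sqrt 5 *\<^sub>R c)) (sqrt 5 *\<^sub>R c)"
proof -
  have e: ?thesis if "edge_star (star P c) c"
    using that
  proof cases
    case 1 then show ?thesis using step_gHm[OF P] by blast
  next
    case 2 then show ?thesis using step_gHr[OF P] by blast
  next
    case 3 then show ?thesis using step_gLm[OF P] by blast
  qed (use step_leg[OF P] in blast)+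
  have o: ?thesis if "outer_star (star P c) c"
    using that
  proof cases
    case 1 then show ?thesis using e by blast
  next
    case 2 then show ?thesis using step_junction[OF P] outer_star.intros(6) by blast
  next
    case 3 then show ?thesis using step_junction[OF P] outer_star.intros(6) by blast
  next
    case 4 then show ?thesis using step_fanF[OF P] fanA_acute outer_star.intros(6) by blast
  next
    case 5 then show ?thesis using step_fanM[OF P] fanA_acute outer_star.intros(6) by blast
  next
    case 6 then show ?thesis using step_acute[OF P] outer_star.intros(6) by blast
  qed
  show ?thesis
    using st
  proof cases
    case 1 then show ?thesis using o by blast
  next
    case 2 then show ?thesis using step_leg[OF P] by blast
  next
    case 3 then show ?thesis using step_junction[OF P] outer_star.intros(6) by blast
  qed
qed

lemma fan_point_star:
  assumes "fan {q} x S c" "plane_isometry q" "x \<in> interior (tile_of q)" shows "point_star S c"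
proof -
  obtain h where h: "plane_isometry h" "S = {tile_of (h \<circ> q)}" "c = h x"
    using assms by (auto simp: fan_def)
  have "c \<in> interior (tile_of (h \<circ> q))"
    unfolding h(3) tile_of_comp plane_isometry_interior[OF h(1)] using assms(3) by blast
  then show ?thesis
    unfolding point_star_def h(2) using is_tile_tile_of[OF plane_isometry_comp[OF h(1) assms(2)]] by blast
qed

text \<open>\<open>?X\<close> and \<open>?Y\<close> are the coordinates of
  \<open>(2 - \<i>) * p\<close>. The eleven cases are the five open pieces, the five open edges
  between pieces and the inner vertex 1; cases 3 and 4 are the only source of the contact
  \<open>gLb\<close>.\<close>

lemma step_point:
  assumes P: "patch P" and st: "point_star (star P c) c"
  shows "point_star (star (subst P) (sqrt 5 *\<^sub>R c)) (sqrt 5 *\<^sub>R c) \<or>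
    inner_star (star (subst P) (sqrt 5 *\<^sub>R c)) (sqrt 5 *\<^sub>R c)"
proof -
  obtain t where t: "is_tile t" "star P c = {t}" "c \<in> interior t" using st by (auto simp: point_star_def)
  obtain h where h: "plane_isometry h" "t = tile_of h" using t is_tile_iff by auto
  obtain p where p: "p \<in> interior proto" "c = h p"
    using t(3) unfolding h(2) tile_of_def plane_isometry_interior[OF h(1)] by blast
  have "fan {id} p (star P c) c" unfolding fan_def using h t(2) p(2) by (intro exI[of _ h]) simp
  from fan_step[OF P this] have f: "fan (kids p) ((2 - \<i>) * p) (star (subst P) (sqrt 5 *\<^sub>R c)) (sqrt 5 *\<^sub>R c)"
    by simp
  have r: "0 < Re p" "0 < Im p" "2 * Re p + Im p < 2" using p(1) by (auto simp: proto_interior)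
  have pt: ?thesis if "kids p = {q}" "plane_isometry q" "(2 - \<i>) * p \<in> interior (tile_of q)" for q
    using fan_point_star[OF f[unfolded that(1)] that(2,3)] by simp
  let ?X = "2 * Re p + Im p" and ?Y = "2 * Im p - Re p"
  consider "?Y < 0" | "?Y = 0" "?X < 1" | "?Y = 0" "?X = 1" | "?Y = 0" "?X > 1"
    | "?Y > 0" "?X < 1" | "?Y > 0" "?X = 1" | "?Y > 0" "?X > 1" "2 * ?X + ?Y < 4"
    | "?Y > 0" "?X > 1" "2 * ?X + ?Y = 4" | "2 * ?X + ?Y > 4" "?Y < 2"
    | "2 * ?X + ?Y > 4" "?Y = 2" | "2 * ?X + ?Y > 4" "?Y > 2"
    by (rule linorder_cases[of ?Y 0]; rule linorder_cases[of ?X 1];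
      rule linorder_cases[of "2 * ?X + ?Y" 4]; rule linorder_cases[of ?Y 2]; blast)
  then show ?thesis
  proof cases
    case 1
    then show ?thesis using r by (intro pt[OF _ q_isometry(1)]) (auto simp: kids_eq q_interior)
  next
    case 2
    have k: "kids p = {q1, q2}" using 2 r by (auto simp: kids_eq)
    have e: "q2 = q1 \<circ> gLa" by (auto simp: mapeq)
    have "fan {id, gLa} (Complex 0 (2 - ?X)) (star (subst P) (sqrt 5 *\<^sub>R c)) (sqrt 5 *\<^sub>R c)"
      by (rule fan_rebase[OF f, where a = q1])
        (use 2 r in \<open>auto simp: k e q_isometry, auto simp: q_defs complex_eq_iff\<close>)
    moreover have "Complex 0 (2 - ?X) \<in> long 1 2" using 2 r by (auto simp: long_def)
    ultimately show ?thesis using inner_star.intros(1) outer_star.intros(1) edge_star.intros(7) by blast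
  next
    case 3
    have k: "kids p = {q1, q2, q3}" using 3 r by (auto simp: kids_eq)
    have e: "q2 = q1 \<circ> gLa" "q3 = q1 \<circ> gLb" by (auto simp: mapeq)
    have "fan {id, gLa, gLb} (\<i>) (star (subst P) (sqrt 5 *\<^sub>R c)) (sqrt 5 *\<^sub>R c)"
      by (rule fan_rebase[OF f, where a = q1])
        (use 3 r in \<open>auto simp: k e q_isometry, auto simp: q_defs complex_eq_iff\<close>)
    then show ?thesis using inner_star.intros(3) by blast
  next
    case 4
    have k: "kids p = {q1, q3}" using 4 r by (auto simp: kids_eq)
    have e: "q3 = q1 \<circ> gLb" by (auto simp: mapeq)
    have "fan {id, gLb} (Complex 0 (2 - ?X)) (star (subst P) (sqrt 5 *\<^sub>R c)) (sqrt 5 *\<^sub>R c)"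
      by (rule fan_rebase[OF f, where a = q1])
        (use 4 r in \<open>auto simp: k e q_isometry, auto simp: q_defs complex_eq_iff\<close>)
    moreover have "Complex 0 (2 - ?X) \<in> long 0 1" using 4 r by (auto simp: long_def)
    ultimately show ?thesis using inner_star.intros(2) by blast
  next
    case 5
    then show ?thesis using r by (intro pt[OF _ q_isometry(2)]) (auto simp: kids_eq q_interior)
  next
    case 6
    have k: "kids p = {q2, q3}" using 6 r by (auto simp: kids_eq)
    have e: "q2 = q3 \<circ> gLm" by (auto simp: mapeq)
    have "fan {id, gLm} (Complex 0 ?Y) (star (subst P) (sqrt 5 *\<^sub>R c)) (sqrt 5 *\<^sub>R c)"
      by (rule fan_rebase[OF f, where a = q3])
        (use 6 r in \<open>auto simp: k e q_isometry, auto simp: q_defs complex_eq_iff\<close>)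
    moreover have "Complex 0 ?Y \<in> long 0 2" using 6 r by (auto simp: long_def)
    ultimately show ?thesis using inner_star.intros(1) outer_star.intros(1) edge_star.intros(3) by blast
  next
    case 7
    then show ?thesis using r by (intro pt[OF _ q_isometry(3)]) (auto simp: kids_eq q_interior)
  next
    case 8
    have k: "kids p = {q3, q4}" using 8 r by (auto simp: kids_eq)
    have e: "q4 = q3 \<circ> gHr" by (auto simp: mapeq)
    have "fan {id, gHr} (Complex (?X - 1) ?Y) (star (subst P) (sqrt 5 *\<^sub>R c)) (sqrt 5 *\<^sub>R c)"
      by (rule fan_rebase[OF f, where a = q3])
        (use 8 r in \<open>auto simp: k e q_isometry, auto simp: q_defs complex_eq_iff\<close>)
    moreover have "Complex (?X - 1) ?Y \<in> hyp" using 8 r by (auto simp: hyp_def)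
    ultimately show ?thesis using inner_star.intros(1) outer_star.intros(1) edge_star.intros(2) by blast
  next
    case 9
    then show ?thesis using r by (intro pt[OF _ q_isometry(4)]) (auto simp: kids_eq q_interior)
  next
    case 10
    have k: "kids p = {q4, q5}" using 10 r by (auto simp: kids_eq)
    have e: "q5 = q4 \<circ> gSm" by (auto simp: mapeq)
    have "fan {id, gSm} (Complex (2 - ?X) 0) (star (subst P) (sqrt 5 *\<^sub>R c)) (sqrt 5 *\<^sub>R c)"
      by (rule fan_rebase[OF f, where a = q4])
        (use 10 r in \<open>auto simp: k e q_isometry, auto simp: q_defs complex_eq_iff\<close>)
    moreover have "Complex (2 - ?X) 0 \<in> short" using 10 r by (auto simp: short_def)
    ultimately show ?thesis using inner_star.intros(1) outer_star.intros(1) edge_star.intros(4) by blast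
  next
    case 11
    then show ?thesis using r by (intro pt[OF _ q_isometry(5)]) (auto simp: kids_eq q_interior)
  qed
qed

text \<open>Interior points of the support are required so that the star surrounds the point; they
  are dilations of interior points one level below, where the evolution laws take over.\<close>

lemma star_classification:
  assumes "is_tile t" "c \<in> interior (\<Union>((subst ^^ n) {t}))"
  shows "point_star (star ((subst ^^ n) {t}) c) c \<or> inner_star (star ((subst ^^ n) {t}) c) c"
  using assms(2)
proof (induction n arbitrary: c)
  case 0
  then have "star {t} c = {t}" using interior_subset by (fastforce simp: star_def)
  then show ?case using 0 assms(1) by (auto simp: point_star_def)
next
  case (Suc n)
  let ?P = "(subst ^^ n) {t}"
  have P: "patch ?P" by (intro subst_pow_patch patch_single assms)
  have "c \<in> (\<lambda>z. sqrt 5 *\<^sub>R z) ` interior (\<Union> ?P)"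
    using Suc.prems by (simp add: subst_Union[OF P] scale_interior)
  then obtain d where d: "d \<in> interior (\<Union> ?P)" "c = sqrt 5 *\<^sub>R d" by blast
  then show ?case
    using Suc.IH[OF d(1)] step_point[OF P] step_inner[OF P] inner_star.intros(1) by auto
qed

text \<open>Two tiles in relative position \<open>b\<close> must appear in the list as
  \<open>f\<close> and \<open>f \<circ> b\<close>; \<open>r\<close> records where the point sits on
  the first of them.\<close>

lemma fan_pair_in:
  assumes "fan G p S c" "\<And>g. g \<in> G \<Longrightarrow> plane_isometry g" "plane_isometry k" "plane_isometry b"
    "tile_of k \<in> S" "tile_of (k \<circ> b) \<in> S" "c = k r"
  shows "\<exists>f\<in>G. f \<circ> b \<in> G \<and> f r = p"
proof -
  obtain h where h: "plane_isometry h" "S = (\<lambda>g. tile_of (h \<circ> g)) ` G" "c = h p"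
    using assms(1) by (auto simp: fan_def)
  obtain f where f: "f \<in> G" "tile_of k = tile_of (h \<circ> f)" using assms(5) h(2) by blast
  obtain f' where f': "f' \<in> G" "tile_of (k \<circ> b) = tile_of (h \<circ> f')" using assms(6) h(2) by blast
  have k: "k = h \<circ> f" by (rule tile_of_inj[OF _ _ f(2)]) (intro assms h plane_isometry_comp f)+
  have "f \<circ> b = f'"
    by (rule tile_of_comp_inj[OF h(1)]) (use f'(2) k assms f(1) f'(1) in \<open>auto intro: plane_isometry_comp simp: comp_assoc\<close>)
  moreover have "f r = p"
    using assms(7) h(3) k plane_isometry_inj[OF h(1)] by (auto dest: injD)
  ultimately show ?thesis using f(1) f'(1) by blast
qed

text \<open>The point is the middle of the contact, \<open>\<i> / 2\<close> on the first tile.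
  Two-tile types fail because neither \<open>gLb\<close> nor its inverse is the listed position; in
  all larger types no tile has the point at its \<open>\<i> / 2\<close>.\<close>

lemma outer_star_no_gLb:
  assumes st: "outer_star S c" and k: "plane_isometry k" "tile_of k \<in> S" "tile_of (k \<circ> gLb) \<in> S" "c = k (\<i> / 2)"
  shows False
proof -
  have two: False if "fan {id, g} p S c" "plane_isometry g"
    "gLb \<noteq> id" "gLb \<noteq> g" "g \<circ> gLb \<noteq> id" "g \<circ> gLb \<noteq> g" for g p
  proof -
    have "\<And>f. f \<in> {id, g} \<Longrightarrow> plane_isometry f" using that(2) by auto
    from fan_pair_in[OF that(1) this k(1) g_isometry(8) k(2-4)] show False using that(3-) by auto
  qed
  have many: False if "fan G p S c" "\<forall>g\<in>G. plane_isometry g \<and> g (\<i> / 2) \<noteq> p" for G p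
    using fan_pair_in[OF that(1) _ k(1) g_isometry(8) k(2-4)] that(2) by blast
  have neq: "f \<noteq> g" if "f 0 \<noteq> g 0 \<or> f 1 \<noteq> g 1 \<or> f (2 * \<i>) \<noteq> g (2 * \<i>)" for f g :: "complex \<Rightarrow> complex"
    using that by auto
  show False
    using st
  proof cases
    case 1
    then show ?thesis
      by cases (erule two, simp, (rule neq, simp add: g_defs complex_eq_iff)+)+
  next
    case 2
    show ?thesis by (rule many[OF 2]) (auto simp: g_defs complex_eq_iff)
  next
    case 3
    show ?thesis by (rule many[OF 3]) (auto simp: g_defs complex_eq_iff)
  next
    case 4
    show ?thesis by (rule many[OF 4]) (auto simp: fanF_def, auto simp: g_defs complex_eq_iff)
  next
    case 5
    show ?thesis by (rule many[OF 5]) (auto simp: fanM_def, auto simp: g_defs complex_eq_iff)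
  next
    case 6
    then obtain h where h: "plane_isometry h" "tile_of k = tile_of h" "c = h 1 \<or> c = h (2 * \<i>)"
      using k(2) unfolding acute_star_def by blast
    have "k = h" by (rule tile_of_inj[OF k(1) h(1,2)])
    then have "\<i> / 2 = (1::complex) \<or> \<i> / 2 = 2 * \<i>"
      using h(3) unfolding k(4) \<open>k = h\<close> inj_eq[OF plane_isometry_inj[OF h(1)]] by blast
    then show False by (simp add: complex_eq_iff)
  qed
qed

text \<open>Recognizability: the position \<open>gLb\<close> arises only inside a substituted tile.\<close>

lemma subst_tile_recognize:
  assumes t: "is_tile t" and u: "is_tile u" and sub: "subst_tile u \<subseteq> (subst ^^ Suc n) {t}"
  shows "u \<in> (subst ^^ n) {t}"
proof -
  let ?P = "(subst ^^ n) {t}"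
  have P: "patch ?P" by (intro subst_pow_patch patch_single t)
  obtain h where h: "plane_isometry h" "u = tile_of h" using u is_tile_iff by auto
  \<comment> \<open>In the frame of the pieces the short leg of \<open>q3\<close> covers
    \<open>[1, 2]\<close> on the long leg \<open>[0, 2]\<close> of \<open>q1\<close>. The point
    \<open>p\<close> dilates to the middle 3/2 of this contact.\<close>
  define p where "p = (3/2) / (2 - \<i>)"
  have p: "p = (6 + 3 * \<i>) / 10" by (simp add: p_def field_simps)
  define c where "c = h p"
  have c_int: "c \<in> interior u"
    unfolding c_def h(2) tile_of_def plane_isometry_interior[OF h(1)]
    by (intro imageI) (simp add: proto_interior p)
  have "(\<lambda>z. sqrt 5 *\<^sub>R z) ` u \<subseteq> (\<lambda>z. sqrt 5 *\<^sub>R z) ` \<Union> ?P"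
    using sub subst_tile_Union[OF u] subst_Union[OF P] by (metis Sup_subset_mono funpow_simps_right(2) funpow.simps(2) comp_apply)
  then have "u \<subseteq> \<Union> ?P" by (auto simp: inj_image_subset_iff inj_on_def)
  then have cP: "c \<in> interior (\<Union> ?P)" using c_int interior_mono by blast
  define k where "k = up h \<circ> q1"
  have k: "plane_isometry k" unfolding k_def by (intro plane_isometry_comp up_isometry h q_isometry)
  have kb: "k \<circ> gLb = up h \<circ> q3" unfolding k_def by (rule ext) (simp add: q_defs gLb_def algebra_simps)
  have ck: "sqrt 5 *\<^sub>R c = k (\<i> / 2)"
  proof -
    have "(2 - \<i>) * p = 3 / 2" unfolding p by (simp add: complex_eq_iff)
    moreover have "q1 (\<i> / 2) = 3 / 2" by (simp add: q1_def)
    ultimately show ?thesis unfolding c_def up_point[symmetric] k_def comp_def by (simp only:)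
  qed
  have in1: "tile_of k \<in> subst ?P" "tile_of (k \<circ> gLb) \<in> subst ?P"
    using sub unfolding h(2) subst_tile_tile_of[OF h(1)] kb unfolding k_def by (auto simp: pieces_def)
  have half: "\<i> / 2 \<in> proto" by (simp add: proto_def)
  have mem: "sqrt 5 *\<^sub>R c \<in> tile_of k" "sqrt 5 *\<^sub>R c \<in> tile_of (k \<circ> gLb)"
  proof -
    show "sqrt 5 *\<^sub>R c \<in> tile_of k" unfolding ck tile_of_def using half by blast
    have "k (\<i> / 2) = (k \<circ> gLb) (1/2)" by (simp add: gLb_def)
    moreover have "1/2 \<in> proto" by (simp add: proto_def)
    ultimately show "sqrt 5 *\<^sub>R c \<in> tile_of (k \<circ> gLb)" unfolding ck tile_of_def by (metis imageI)
  qed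
  have st: "tile_of k \<in> star (subst ?P) (sqrt 5 *\<^sub>R c)" "tile_of (k \<circ> gLb) \<in> star (subst ?P) (sqrt 5 *\<^sub>R c)"
    using in1 mem by (auto simp: star_def)
  \<comment> \<open>An inner star of the parents would give an outer star of the children, which
    cannot contain the pair. So \<open>c\<close> is interior to one parent tile \<open>s\<close>,
    and both tiles of the pair are children of \<open>s\<close>.\<close>
  have "\<not> inner_star (star ?P c) c"
    using step_inner[OF P] outer_star_no_gLb[OF _ k st ck] by blast
  then have "point_star (star ?P c) c" using star_classification[OF t cP] by blast
  then obtain s where s: "is_tile s" "star ?P c = {s}" by (auto simp: point_star_def)
  then obtain g where g: "plane_isometry g" "s = tile_of g" using is_tile_iff by auto
  have "tile_of k \<in> subst_tile s" "tile_of (k \<circ> gLb) \<in> subst_tile s"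
    using st unfolding star_subst[OF P] s(2) by auto
  then obtain q r where qr: "q \<in> pieces" "r \<in> pieces" "tile_of k = tile_of (up g \<circ> q)"
    "tile_of (k \<circ> gLb) = tile_of (up g \<circ> r)"
    unfolding g(2) subst_tile_tile_of[OF g(1)] by blast
  have kq: "k = up g \<circ> q"
    by (rule tile_of_inj[OF k _ qr(3)]) (intro plane_isometry_comp up_isometry g pieces_isometry qr)
  have "q \<circ> gLb = r"
    by (rule tile_of_comp_inj[OF up_isometry[OF g(1)]])
      (use qr(4) plane_isometry_comp[OF pieces_isometry[OF qr(1)] g_isometry(8)] pieces_isometry[OF qr(2)]
        in \<open>simp_all add: kq comp_assoc\<close>)
  \<comment> \<open>Among the five pieces of one tile only \<open>q1\<close> has a partner in
    position \<open>gLb\<close>. Hence \<open>k\<close> places the \<open>q1\<close> piece of both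
    \<open>u\<close> and \<open>s\<close>, and \<open>u = s\<close>.\<close>
  then have "q = q1"
  proof -
    have v: "q (gLb 0) = r 0" "q (gLb 1) = r 1" "q (gLb (2 * \<i>)) = r (2 * \<i>)" using \<open>q \<circ> gLb = r\<close> by auto
    show ?thesis
      using qr(1,2) v unfolding pieces_def
      by (elim insertE emptyE) (simp_all add: q_defs gLb_def complex_eq_iff)
  qed
  have "up h z = up g z" for z
    using fun_cong[OF kq, of "ginv q1 z"] q_isometry(1) by (simp add: k_def \<open>q = q1\<close>)
  then have "up h = up g" by (rule ext)
  then have "h = g" by (rule up_inj)
  then have "u \<in> star ?P c" using s g h by simp
  then show ?thesis by (simp add: star_def)
qed

section \<open>Centrally symmetric stars\<close>

definition symmetric_star :: "tile set \<Rightarrow> complex \<Rightarrow> bool" where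
  "symmetric_star S c \<longleftrightarrow> fan {id, gHr} (1 / 2 + \<i>) S c \<or> fan {id, gLr} (\<i> / 2) S c \<or>
     fan fanM 0 S c \<or> fan fanA 0 S c \<or> fan fanB 0 S c"

text \<open>Symmetry requires the half-turn \<open>2 * p - z\<close> of the reference tile to be
  among the positions. In the edge types this leaves \<open>gHr\<close> and \<open>gLr\<close>, each
  with \<open>p\<close> at its centre; for acute stars only the two fans are open by
  definition.\<close>

lemma symmetric_stars:
  assumes st: "point_star S c \<or> inner_star S c" and sym: "\<And>t. t \<in> S \<Longrightarrow> (\<lambda>z. 2 * c - z) ` t \<in> S"
  shows "symmetric_star S c"
proof -
  have rot: "\<exists>g\<in>G. g 0 = 2 * p \<and> g 1 = 2 * p - 1 \<and> g (2 * \<i>) = 2 * p - 2 * \<i>"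
    if f: "fan G p S c" and G: "\<forall>g\<in>G. plane_isometry g" "id \<in> G" for G p
  proof -
    obtain g where g: "g \<in> G" "g = (\<lambda>z. 2 * p - id z)"
      using fan_symmetric[OF f sym _ G(2)] G(1) by blast
    then show ?thesis by (intro bexI[OF _ g(1)]) simp
  qed
  have edge: ?thesis if "edge_star S c"
    using that
  proof cases
    case (1 p) then show ?thesis using rot[OF 1(1)] by (auto simp: g_defs complex_eq_iff)
  next
    case (2 p)
    then have "p = 1 / 2 + \<i>" using rot[OF 2(1)] by (auto simp: g_defs complex_eq_iff)
    then show ?thesis using 2 by (simp add: symmetric_star_def)
  next
    case (3 p) then show ?thesis using rot[OF 3(1)] by (auto simp: g_defs complex_eq_iff)
  next
    case (4 p) then show ?thesis using rot[OF 4(1)] by (auto simp: g_defs complex_eq_iff)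
  next
    case (5 p)
    then have "p = \<i> / 2" using rot[OF 5(1)] by (auto simp: g_defs complex_eq_iff)
    then show ?thesis using 5(1) unfolding symmetric_star_def by blast
  next
    case (6 p) then show ?thesis using rot[OF 6(1)] by (auto simp: g_defs complex_eq_iff)
  next
    case (7 p) then show ?thesis using rot[OF 7(1)] by (auto simp: g_defs complex_eq_iff)
  qed
  have outer: ?thesis if "outer_star S c"
    using that
  proof cases
    case 1 then show ?thesis by (rule edge)
  next
    case 2 show ?thesis using rot[OF 2] by (auto simp: g_defs complex_eq_iff)
  next
    case 3 show ?thesis using rot[OF 3] by (auto simp: g_defs complex_eq_iff)
  next
    case 4 show ?thesis using rot[OF 4] by (auto simp: fanF_def fan_isometry) (auto simp: g_defs complex_eq_iff)
  next
    case 5 then show ?thesis by (simp add: symmetric_star_def)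
  next
    case 6 then show ?thesis using sym unfolding symmetric_star_def acute_star_def by blast
  qed
  show ?thesis
    using st
  proof
    assume "point_star S c"
    then obtain t where t: "is_tile t" "S = {t}" "c \<in> interior t" by (auto simp: point_star_def)
    obtain h where h: "plane_isometry h" "t = tile_of h" using t is_tile_iff by auto
    have "fan {id} (ginv h c) S c" unfolding fan_def t(2) h(2) using h(1) by (intro exI[of _ h]) auto
    from rot[OF this] show ?thesis by (auto simp: complex_eq_iff)
  next
    assume "inner_star S c"
    then show ?thesis
    proof cases
      case 1 then show ?thesis by (rule outer)
    next
      case (2 p) then show ?thesis using rot[OF 2(1)] by (auto simp: g_defs complex_eq_iff)
    next
      case 3 show ?thesis using rot[OF 3] by (auto simp: g_defs complex_eq_iff)
    qed
  qed
qed

section \<open>Legal patches and composition\<close>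

definition legal :: "tile set \<Rightarrow> bool" where
  "legal P \<longleftrightarrow> (\<exists>t n g. is_tile t \<and> plane_isometry g \<and> move g P \<subseteq> (subst ^^ n) {t})"

lemma legal_iff:
  "legal P \<longleftrightarrow> (\<exists>t n Q. is_tile t \<and> Q \<subseteq> (subst ^^ n) {t} \<and> congruent_patches P Q)"
  unfolding legal_def congruent_patches_def by blast

lemma is_tiling_iff: "is_tiling T \<longleftrightarrow> patch T \<and> \<Union>T = UNIV"
  by (auto simp: is_tiling_def patch_def)

lemma pinwheel_space_iff:
  "T \<in> pinwheel_space \<longleftrightarrow> patch T \<and> \<Union>T = UNIV \<and> (\<forall>P. P \<subseteq> T \<and> finite P \<longrightarrow> legal P)"
  by (simp add: pinwheel_space_def is_tiling_iff legal_iff)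

lemma legal_patch: assumes "legal P" shows "patch P"
proof -
  obtain t n g where g: "is_tile t" "plane_isometry g" "move g P \<subseteq> (subst ^^ n) {t}"
    using assms by (auto simp: legal_def)
  then have "patch (move g P)" using subst_pow_patch patch_single patch_mono by blast
  then have "patch (move (ginv g) (move g P))" using patch_move[OF plane_isometry_inv[OF g(2)]] by blast
  then show ?thesis using g(2) by (simp add: move_inverse)
qed

lemma legal_mono: "legal P \<Longrightarrow> Q \<subseteq> P \<Longrightarrow> legal Q"
  unfolding legal_def by (meson move_mono subset_trans)

lemma legal_move: assumes "legal P" "plane_isometry k" shows "legal (move k P)"
proof -
  obtain t n g where g: "is_tile t" "plane_isometry g" "move g P \<subseteq> (subst ^^ n) {t}"
    using assms by (auto simp: legal_def)
  have "move (g \<circ> ginv k) (move k P) = move g P"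
    using assms(2) by (simp add: move_comp comp_assoc)
  then show ?thesis
    unfolding legal_def using g plane_isometry_comp[OF g(2) plane_isometry_inv[OF assms(2)]] by metis
qed

lemma legal_subst: assumes "legal P" shows "legal (subst P)"
proof -
  obtain t n g where g: "is_tile t" "plane_isometry g" "move g P \<subseteq> (subst ^^ n) {t}"
    using assms by (auto simp: legal_def)
  have "move (dil g) (subst P) \<subseteq> (subst ^^ Suc n) {t}"
    using subst_move[OF g(2), of P] patch_is_tile[OF legal_patch[OF assms]] subst_mono[OF g(3)] by simp
  then show ?thesis unfolding legal_def using g(1) dil_isometry[OF g(2)] by blast
qed

lemma subst_tile_two: assumes "is_tile u" shows "\<exists>x\<in>subst_tile u. \<exists>y\<in>subst_tile u. x \<noteq> y"
proof -
  obtain h where h: "plane_isometry h" "u = tile_of h" using assms is_tile_iff by auto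
  have "tile_of (up h \<circ> q1) \<noteq> tile_of (up h \<circ> q2)"
  proof
    assume "tile_of (up h \<circ> q1) = tile_of (up h \<circ> q2)"
    then have "q1 = q2" by (intro tile_of_comp_inj[OF up_isometry[OF h(1)]] q_isometry)
    then have "q1 0 = q2 0" by simp
    then show False by (simp add: q_defs)
  qed
  then show ?thesis unfolding h(2) subst_tile_tile_of[OF h(1)] pieces_def by blast
qed

text \<open>The motion that puts \<open>subst P\<close> into a supertile, scaled back, puts
  \<open>P\<close> into the supertile one order lower; recognizability does this tile by
  tile.\<close>

lemma legal_unsubst:
  assumes leg: "legal (subst P)" and P: "\<And>t. t \<in> P \<Longrightarrow> is_tile t" and ne: "P \<noteq> {}" shows "legal P"
proof -
  obtain t n g where g: "is_tile t" "plane_isometry g" "move g (subst P) \<subseteq> (subst ^^ n) {t}"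
    using leg by (auto simp: legal_def)
  obtain u where u: "u \<in> P" using ne by blast
  \<comment> \<open>A supertile of order 0 is a single tile and has no room for two distinct
    children.\<close>
  have "n \<noteq> 0"
  proof
    assume "n = 0"
    then have sub: "move g (subst P) \<subseteq> {t}" using g(3) by simp
    obtain x y where xy: "x \<in> subst_tile u" "y \<in> subst_tile u" "x \<noteq> y" using subst_tile_two[OF P[OF u]] by blast
    have "g ` x = g ` y" using sub xy(1,2) u unfolding move_def subst_def by blast
    then show False using xy(3) inj_image_eq_iff[OF plane_isometry_inj[OF g(2)]] by blast
  qed
  then obtain m where m: "n = Suc m" by (cases n) auto
  have "undil g ` v \<in> (subst ^^ m) {t}" if v: "v \<in> P" for v
  proof (rule subst_tile_recognize[OF g(1)])
    show "is_tile (undil g ` v)" using is_tile_image[OF undil_isometry[OF g(2)] P[OF v]] .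
    have "subst_tile (undil g ` v) = move g (subst_tile v)"
      using subst_tile_move[OF undil_isometry[OF g(2)] P[OF v]] by (simp add: dil_undil)
    also have "\<dots> \<subseteq> move g (subst P)" using v by (auto simp: move_def subst_def)
    finally show "subst_tile (undil g ` v) \<subseteq> (subst ^^ Suc m) {t}" using g(3) m by simp
  qed
  then have "move (undil g) P \<subseteq> (subst ^^ m) {t}" by (auto simp: move_def)
  then show ?thesis unfolding legal_def using g(1) undil_isometry[OF g(2)] by blast
qed

section \<open>Local finiteness and discs inside supertiles\<close>

lemma proto_dist: assumes "z \<in> proto" "w \<in> proto" shows "dist z w \<le> 3"
proof -
  have "\<bar>Re (z - w)\<bar> \<le> 1" "\<bar>Im (z - w)\<bar> \<le> 2" using assms by (auto simp: proto_def)
  then show ?thesis using cmod_le[of "z - w"] by (simp add: dist_norm)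
qed

lemma tile_dist: assumes "is_tile t" "z \<in> t" "w \<in> t" shows "dist z w \<le> 3"
proof -
  obtain h where h: "plane_isometry h" "t = h ` proto" using assms by (auto simp: is_tile_iff tile_of_def)
  then show ?thesis using assms proto_dist by (auto simp: plane_isometry_def)
qed

lemma tile_ball: assumes "is_tile t" shows "\<exists>m. ball m (1/4) \<subseteq> interior t"
proof -
  obtain h where h: "plane_isometry h" "t = h ` proto" using assms by (auto simp: is_tile_iff tile_of_def)
  have "ball (Complex (1/4) (1/4)) (1/4) \<subseteq> interior proto"
  proof
    fix z assume "z \<in> ball (Complex (1/4) (1/4)) (1/4)"
    then have "norm (Complex (1/4) (1/4) - z) < 1/4" by (simp add: dist_norm)
    then have "\<bar>1/4 - Re z\<bar> < 1/4" "\<bar>1/4 - Im z\<bar> < 1/4"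
      using abs_Re_le_cmod[of "Complex (1/4) (1/4) - z"] abs_Im_le_cmod[of "Complex (1/4) (1/4) - z"] by auto
    then show "z \<in> interior proto" unfolding proto_interior mem_Collect_eq abs_less_iff by auto
  qed
  then have "h ` ball (Complex (1/4) (1/4)) (1/4) \<subseteq> interior t"
    unfolding h(2) plane_isometry_interior[OF h(1)] by (rule image_mono)
  moreover have "ball (h (Complex (1/4) (1/4))) (1/4) \<subseteq> h ` ball (Complex (1/4) (1/4)) (1/4)"
  proof
    fix z assume "z \<in> ball (h (Complex (1/4) (1/4))) (1/4)"
    then have "dist (h (Complex (1/4) (1/4))) (h (ginv h z)) < 1/4" using h(1) by simp
    then have "ginv h z \<in> ball (Complex (1/4) (1/4)) (1/4)"
      using h(1) by (simp only: plane_isometry_def mem_ball)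
    then show "z \<in> h ` ball (Complex (1/4) (1/4)) (1/4)"
      using h(1) by (metis image_eqI plane_isometry_inv_comp(3))
  qed
  ultimately show ?thesis by blast
qed

text \<open>A packing argument. Every tile contains a disc of radius 1/4; the centres of the discs
  lie in a compact region with a finite net of radius 1/8, and two centres near the same net point
  would be less than 1/4 apart, making their tiles overlap.\<close>

lemma patch_locally_finite: assumes P: "patch P" shows "finite {t \<in> P. t \<inter> cball z r \<noteq> {}}"
proof -
  let ?A = "{t \<in> P. t \<inter> cball z r \<noteq> {}}"
  have "\<forall>t\<in>P. \<exists>m. ball m (1/4) \<subseteq> interior t" using tile_ball patch_is_tile[OF P] by blast
  then obtain m where m: "\<And>t. t \<in> P \<Longrightarrow> ball (m t) (1/4) \<subseteq> interior t" by metis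
  have mt: "m t \<in> interior t" if "t \<in> P" for t
    using m[OF that] by (meson centre_in_ball divide_pos_pos subsetD zero_less_numeral zero_less_one)
  obtain K where K: "finite K" "cball z (r + 3) \<subseteq> (\<Union>x\<in>K. ball x (1/8))"
  proof -
    have "compact (cball z (r + 3))" by simp
    moreover have "cball z (r + 3) \<subseteq> (\<Union>x\<in>UNIV. ball x (1/8))"
    proof
      fix x show "x \<in> (\<Union>y\<in>UNIV. ball y (1/8))" by (rule UN_I[of x]) simp_all
    qed
    ultimately obtain C where "finite C" "cball z (r + 3) \<subseteq> (\<Union>x\<in>C. ball x (1/8))"
      using compactE_image[of "cball z (r + 3)" UNIV "\<lambda>x. ball x (1/8)"] by (metis open_ball)
    then show ?thesis using that by blast
  qed
  have "\<exists>x\<in>K. m t \<in> ball x (1/8)" if t: "t \<in> ?A" for t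
  proof -
    obtain w where w: "w \<in> t" "dist z w \<le> r" using t by auto
    have "dist w (m t) \<le> 3"
      using t w mt[of t] interior_subset[of t] tile_dist[of t w "m t"] patch_is_tile[OF P] by blast
    then have "m t \<in> cball z (r + 3)" using w(2) dist_triangle[of z "m t" w] by simp
    then show ?thesis using K(2) by blast
  qed
  then obtain k where k: "\<And>t. t \<in> ?A \<Longrightarrow> k t \<in> K \<and> m t \<in> ball (k t) (1/8)" by metis
  have "inj_on k ?A"
  proof (rule inj_onI)
    fix s t assume st: "s \<in> ?A" "t \<in> ?A" "k s = k t"
    have "dist (m s) (m t) < 1/4"
      using k[OF st(1)] k[OF st(2)] st(3) dist_triangle3[of "m s" "m t" "k s"] by simp
    then have "m t \<in> interior s" using m[of s] st(1) by auto
    then show "s = t" using patch_eqI[OF P _ _ _ mt] st by blast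
  qed
  then show ?thesis using K(1) k by (meson finite_imageD finite_subset image_subsetI)
qed

text \<open>A tile that meets an open set covered by \<open>Q\<close> has interior points there, and
  these lie in tiles of \<open>Q\<close>; in a patch such tiles coincide.\<close>

lemma patch_covering:
  assumes "patch S" "Q \<subseteq> S" "open U" "U \<subseteq> \<Union>Q" "x \<in> S" "x \<inter> U \<noteq> {}" shows "x \<in> Q"
proof -
  have "U \<inter> interior x \<noteq> {}" using open_meets_tile[OF patch_is_tile[OF assms(1,5)] assms(3)] assms(6) by blast
  then obtain z q where z: "z \<in> U" "z \<in> interior x" "q \<in> Q" "z \<in> q" using assms(4) by blast
  then show ?thesis using patch_eqI'[OF assms(1,5) subsetD[OF assms(2) z(3)] z(2,4)] by simp
qed

lemma tiling_subset_eq: assumes "patch B" "\<Union>A = UNIV" "A \<subseteq> B" shows "A = B"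
proof -
  have "x \<in> A" if "x \<in> B" for x
  proof (rule patch_covering[OF assms(1,3) open_UNIV _ that])
    show "x \<inter> UNIV \<noteq> {}"
      using is_tile_interior_nonempty[OF patch_is_tile[OF assms(1) that]] interior_subset[of x] by auto
  qed (simp add: assms(2))
  then show ?thesis using assms(3) by blast
qed

definition near :: "tile set \<Rightarrow> complex \<Rightarrow> real \<Rightarrow> tile set" where
  "near T z r = {t \<in> T. t \<inter> cball z r \<noteq> {}}"

lemma near_cover: "\<Union>T = UNIV \<Longrightarrow> ball z r \<subseteq> \<Union>(near T z r)"
proof
  fix x assume T: "\<Union>T = UNIV" and x: "x \<in> ball z r"
  obtain t where "t \<in> T" "x \<in> t" using T by blast
  moreover have "x \<in> cball z r" using x by simp
  ultimately show "x \<in> \<Union>(near T z r)" unfolding near_def by blast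
qed

text \<open>Transfers facts about supertiles to tilings. The moved tiles cover the whole image disc,
  so the supertile has no further tiles near \<open>g z\<close>.\<close>

lemma pinwheel_near:
  assumes T: "T \<in> pinwheel_space"
  obtains t n g where "is_tile t" "plane_isometry g" "move g (near T z r) \<subseteq> (subst ^^ n) {t}"
    "ball (g z) r \<subseteq> \<Union>(move g (near T z r))"
proof -
  have P: "patch T" "\<Union>T = UNIV" using T by (simp_all add: pinwheel_space_iff)
  have "finite (near T z r)" unfolding near_def by (rule patch_locally_finite[OF P(1)])
  moreover have "near T z r \<subseteq> T" by (auto simp: near_def)
  ultimately have "legal (near T z r)" using T by (simp add: pinwheel_space_iff)
  then obtain t n g where g: "is_tile t" "plane_isometry g" "move g (near T z r) \<subseteq> (subst ^^ n) {t}"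
    by (auto simp: legal_def)
  have "ball (g z) r \<subseteq> \<Union>(move g (near T z r))"
  proof
    fix x assume "x \<in> ball (g z) r"
    then have "dist (g z) (g (ginv g x)) < r" using g(2) by simp
    then have "ginv g x \<in> ball z r" using g(2) by (simp only: plane_isometry_def mem_ball)
    then obtain s where "s \<in> near T z r" "ginv g x \<in> s" using near_cover[OF P(2)] by blast
    then have "g (ginv g x) \<in> g ` s" "g ` s \<in> move g (near T z r)" by (auto simp: move_def)
    then show "x \<in> \<Union>(move g (near T z r))" using g(2) by auto
  qed
  then show ?thesis using that g by blast
qed

text \<open>All possible parents are collected, so no choice is made and \<open>decomp T\<close>
  inherits the symmetries of \<open>T\<close>.\<close>

definition decomp :: "tile set \<Rightarrow> tile set" where
  "decomp T = {t. is_tile t \<and> subst_tile t \<subseteq> T}"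

text \<open>Around \<open>x\<close> the tiling looks like a supertile of positive order, in which
  \<open>x\<close> has a parent. All children of that parent lie in the disc under view, hence in
  the tiling.\<close>

lemma subst_decomp: assumes T: "T \<in> pinwheel_space" shows "subst (decomp T) = T"
proof
  show "subst (decomp T) \<subseteq> T" by (auto simp: subst_def decomp_def)
  show "T \<subseteq> subst (decomp T)"
  proof
    fix x assume x: "x \<in> T"
    have PT: "patch T" "\<Union>T = UNIV" using T by (simp_all add: pinwheel_space_iff)
    have xt: "is_tile x" by (rule patch_is_tile[OF PT(1) x])
    then obtain z where z: "z \<in> x" using is_tile_interior_nonempty interior_subset by blast
    \<comment> \<open>The radius 20 serves twice: such a disc does not fit into a single tile, whose
      diameter is at most 3, so the order is positive; and the children of the parent stay within
      \<open>sqrt 5 * 3 \<le> 9\<close> of \<open>g z\<close>.\<close>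
    obtain t n g where g: "is_tile t" "plane_isometry g" "move g (near T z 20) \<subseteq> (subst ^^ n) {t}"
      "ball (g z) 20 \<subseteq> \<Union>(move g (near T z 20))" using pinwheel_near[OF T] .
    have "n \<noteq> 0"
    proof
      assume "n = 0"
      then have "ball (g z) 20 \<subseteq> t" using g(3,4) by auto
      moreover have "g z \<in> ball (g z) 20" "g z + 10 \<in> ball (g z) 20" by (simp_all add: dist_norm)
      ultimately have "g z \<in> t" "g z + 10 \<in> t" by blast+
      then show False using tile_dist[OF g(1), of "g z" "g z + 10"] by (simp add: dist_norm)
    qed
    then obtain m where m: "n = Suc m" by (cases n) auto
    have "z \<in> cball z 20" by simp
    then have xn: "x \<in> near T z 20" using x z unfolding near_def by blast
    then have "g ` x \<in> subst ((subst ^^ m) {t})" using g(3) m by (auto simp: move_def)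
    then obtain u where u: "u \<in> (subst ^^ m) {t}" "g ` x \<in> subst_tile u" by (auto simp: subst_def)
    have pm: "patch ((subst ^^ m) {t})" "patch ((subst ^^ n) {t})"
      by (intro subst_pow_patch patch_single g)+
    have ut: "is_tile u" by (rule patch_is_tile[OF pm(1) u(1)])
    have sub: "subst_tile u \<subseteq> move g (near T z 20)"
    proof
      fix y assume y: "y \<in> subst_tile u"
      have yt: "is_tile y" by (rule subst_tile_is_tile[OF ut y])
      then obtain w where w: "w \<in> y" using is_tile_interior_nonempty interior_subset by blast
      have "w \<in> (\<lambda>z. sqrt 5 *\<^sub>R z) ` u" "g z \<in> (\<lambda>z. sqrt 5 *\<^sub>R z) ` u"
        using w y u(2) z subst_tile_Union[OF ut] by blast+
      then obtain a b where ab: "a \<in> u" "b \<in> u" "w = sqrt 5 *\<^sub>R a" "g z = sqrt 5 *\<^sub>R b" by blast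
      have "dist (g z) w = sqrt 5 * dist b a" unfolding ab
        by (simp add: dist_norm flip: scaleR_diff_right)
      also have "\<dots> \<le> 3 * 3"
        using tile_dist[OF ut ab(2,1)] real_sqrt_le_iff[of 5 9] by (intro mult_mono) auto
      finally have "w \<in> ball (g z) 20" by simp
      then have "y \<inter> ball (g z) 20 \<noteq> {}" using w by blast
      moreover have "y \<in> (subst ^^ n) {t}" using y u(1) m by (auto simp: subst_def)
      ultimately show "y \<in> move g (near T z 20)"
        using patch_covering[OF pm(2) g(3) open_ball g(4)] by blast
    qed
    define v where "v = undil (ginv g) ` u"
    have "subst_tile v = move (ginv g) (subst_tile u)"
      using subst_tile_move[OF undil_isometry[OF plane_isometry_inv[OF g(2)]] ut]
      by (simp add: v_def dil_undil)
    moreover have "\<dots> \<subseteq> near T z 20"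
      using move_mono[OF sub, of "ginv g"] by (simp add: move_inverse(1)[OF g(2)])
    ultimately have v: "v \<in> decomp T"
      using is_tile_image[OF undil_isometry[OF plane_isometry_inv[OF g(2)]] ut]
      by (auto simp: decomp_def v_def near_def)
    have "x = ginv g ` (g ` x)" using g(2) by (simp add: image_image)
    then have "x \<in> subst_tile v" using u(2) \<open>subst_tile v = _\<close> by (auto simp: move_def)
    then show "x \<in> subst (decomp T)" using v by (auto simp: subst_def)
  qed
qed

lemma legal_empty: "legal {}"
  unfolding legal_def move_def using is_tile_tile_of[OF plane_isometry_id(1)] plane_isometry_id(1) by fastforce

lemma decomp_legal: assumes T: "T \<in> pinwheel_space" and P: "P \<subseteq> decomp T" "finite P" shows "legal P"
proof (cases "P = {}")
  case False
  have t: "\<And>t. t \<in> P \<Longrightarrow> is_tile t" using P by (auto simp: decomp_def)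
  have "finite (subst_tile t)" if "t \<in> P" for t
    using t[OF that] by (auto simp: is_tile_iff subst_tile_tile_of pieces_def)
  then have "finite (subst P)" using P(2) by (auto simp: subst_def)
  moreover have "subst P \<subseteq> T" using P(1) by (auto simp: subst_def decomp_def)
  ultimately have "legal (subst P)" using T by (simp add: pinwheel_space_iff)
  then show ?thesis by (rule legal_unsubst[OF _ t False])
qed (simp add: legal_empty)

text \<open>That parents do not overlap is a statement about two of them at a time, and a pair of
  parents is legal by recognizability, hence a patch.\<close>

lemma decomp_pinwheel: assumes T: "T \<in> pinwheel_space" shows "decomp T \<in> pinwheel_space"
proof -
  have "patch (decomp T)"
  proof -
    have "interior s \<inter> interior t = {}" if "s \<in> decomp T" "t \<in> decomp T" "s \<noteq> t" for s t
      using legal_patch[OF decomp_legal[OF T, of "{s, t}"]] that by (auto simp: patch_def pairwise_def)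
    then show ?thesis by (auto simp: patch_def pairwise_def decomp_def)
  qed
  moreover have "\<Union>(decomp T) = UNIV"
  proof -
    have "(\<lambda>z. sqrt 5 *\<^sub>R z) ` \<Union>(decomp T) = UNIV"
      using subst_Union[OF \<open>patch (decomp T)\<close>] subst_decomp[OF T] T by (simp add: pinwheel_space_iff)
    then have "sqrt 5 *\<^sub>R z \<in> (\<lambda>z. sqrt 5 *\<^sub>R z) ` \<Union>(decomp T)" for z by simp
    moreover have "inj (\<lambda>z::complex. sqrt 5 *\<^sub>R z)" by (simp add: inj_on_def)
    ultimately have "z \<in> \<Union>(decomp T)" for z by (metis (no_types) inj_image_mem_iff)
    then show ?thesis by blast
  qed
  ultimately show ?thesis using decomp_legal[OF T] by (simp add: pinwheel_space_iff)
qed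

section \<open>The six symmetric stars\<close>

definition spin :: "complex \<Rightarrow> tile set \<Rightarrow> tile set" where
  "spin u P = move (\<lambda>z. u * z) P"

lemma spin_isometry: "norm u = 1 \<Longrightarrow> plane_isometry (\<lambda>z. u * z)"
  by (simp add: plane_isometry_def dist_norm norm_mult flip: right_diff_distrib)

lemma spin_spin: "spin u (spin v P) = spin (u * v) P"
  by (simp add: spin_def move_comp comp_def mult.assoc)

lemma spin_1 [simp]: "spin 1 P = P"
  by (simp add: spin_def move_def)

lemma subst_spin: assumes "norm u = 1" "patch P" shows "subst (spin u P) = spin u (subst P)"
proof -
  have "dil (\<lambda>z. u * z) = (\<lambda>z. u * z)" by (auto simp: dil_def)
  then show ?thesis
    unfolding spin_def using subst_move[OF spin_isometry[OF assms(1)]] patch_is_tile[OF assms(2)] by metis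
qed

lemma patch_spin: "norm u = 1 \<Longrightarrow> patch P \<Longrightarrow> patch (spin u P)"
  by (simp add: spin_def patch_move spin_isometry)

lemma subst_pow_spin: "norm u = 1 \<Longrightarrow> patch P \<Longrightarrow> (subst ^^ n) (spin u P) = spin u ((subst ^^ n) P)"
  by (induction n) (simp_all add: subst_spin subst_pow_patch)

lemma star_spin: assumes "norm u = 1" shows "star (spin u P) 0 = spin u (star P 0)"
proof -
  have "0 \<in> (\<lambda>z. u * z) ` t \<longleftrightarrow> 0 \<in> t" for t
    using isometry_mem_image[OF spin_isometry[OF assms], of 0 t] by simp
  then show ?thesis by (auto simp: star_def spin_def move_def)
qed

lemma spin_interior: assumes "norm u = 1" shows "0 \<in> interior (\<Union>(spin u P)) \<longleftrightarrow> 0 \<in> interior (\<Union>P)"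
proof -
  have "\<Union>(spin u P) = (\<lambda>z. u * z) ` \<Union>P" by (auto simp: spin_def move_def)
  then show ?thesis
    using isometry_mem_image[OF spin_isometry[OF assms], of 0]
    by (simp add: plane_isometry_interior[OF spin_isometry[OF assms]])
qed

text \<open>Indices 0 and 1 are the two mirror forms of the rectangle cut by a diagonal, 2 and 3
  those of two tiles sharing the inner halves of their long legs, each centred at the origin. The
  acute fans 4 and 5 need no mirror form, being rotations of their own mirror images.\<close>

definition baseF :: "nat \<Rightarrow> (complex \<Rightarrow> complex) set" where
  "baseF j = (if j = 0 then {\<lambda>z. z - (1/2 + \<i>), \<lambda>z. 1/2 + \<i> - z}
     else if j = 1 then {\<lambda>z. cnj z - (1/2 - \<i>), \<lambda>z. 1/2 - \<i> - cnj z}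
     else if j = 2 then {\<lambda>z. z - \<i>/2, \<lambda>z. \<i>/2 - z}
     else if j = 3 then {\<lambda>z. cnj z + \<i>/2, \<lambda>z. - (\<i>/2) - cnj z}
     else if j = 4 then fanA else fanB)"

lemma baseF_simps: "baseF 0 = {\<lambda>z. z - (1/2 + \<i>), \<lambda>z. 1/2 + \<i> - z}"
  "baseF 1 = {\<lambda>z. cnj z - (1/2 - \<i>), \<lambda>z. 1/2 - \<i> - cnj z}"
  "baseF 2 = {\<lambda>z. z - \<i>/2, \<lambda>z. \<i>/2 - z}"
  "baseF 3 = {\<lambda>z. cnj z + \<i>/2, \<lambda>z. - (\<i>/2) - cnj z}"
  "baseF 4 = fanA" "baseF 5 = fanB"
  by (simp_all add: baseF_def)

definition base :: "nat \<Rightarrow> tile set" where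
  "base j = tile_of ` baseF j"

lemma less_6: "j < (6::nat) \<longleftrightarrow> j = 0 \<or> j = 1 \<or> j = 2 \<or> j = 3 \<or> j = 4 \<or> j = 5"
  by auto

lemma baseF_isometry: assumes "f \<in> baseF j" shows "plane_isometry f"
proof -
  have "plane_isometry (\<lambda>z. z - (1/2 + \<i>))" by (rule euclidI[of 1 _ False "-(1/2 + \<i>)"]) (simp_all add: conj_if_def)
  moreover have "plane_isometry (\<lambda>z. 1/2 + \<i> - z)" by (rule euclidI[of "-1" _ False "1/2 + \<i>"]) (simp_all add: conj_if_def)
  moreover have "plane_isometry (\<lambda>z. cnj z - (1/2 - \<i>))" by (rule euclidI[of 1 _ True "-(1/2 - \<i>)"]) (simp_all add: conj_if_def)
  moreover have "plane_isometry (\<lambda>z. 1/2 - \<i> - cnj z)" by (rule euclidI[of "-1" _ True "1/2 - \<i>"]) (simp_all add: conj_if_def)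
  moreover have "plane_isometry (\<lambda>z. z - \<i>/2)" by (rule euclidI[of 1 _ False "-\<i>/2"]) (simp_all add: conj_if_def)
  moreover have "plane_isometry (\<lambda>z. \<i>/2 - z)" by (rule euclidI[of "-1" _ False "\<i>/2"]) (simp_all add: conj_if_def)
  moreover have "plane_isometry (\<lambda>z. cnj z + \<i>/2)" by (rule euclidI[of 1 _ True "\<i>/2"]) (simp_all add: conj_if_def)
  moreover have "plane_isometry (\<lambda>z. - (\<i>/2) - cnj z)" by (rule euclidI[of "-1" _ True "-(\<i>/2)"]) (simp_all add: conj_if_def)
  ultimately show ?thesis using assms fanAB_isometry unfolding baseF_def by (auto split: if_splits)
qed

lemma spin_tiles: "spin u (tile_of ` F) = (\<lambda>f. tile_of ((\<lambda>z. u * z) \<circ> f)) ` F"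
  by (simp add: spin_def move_def image_image tile_of_comp)

lemma spin_base: "spin u (base j) = (\<lambda>f. tile_of ((\<lambda>z. u * z) \<circ> f)) ` baseF j"
  by (simp add: base_def spin_tiles)

text \<open>The frame of the pieces is turned against the dilated tile, and \<open>up\<close>
  multiplies a rotation by this number. It is the conjugate of \<open>(2 - \<i>) / sqrt 5\<close>,
  whose square is \<open>rA\<close>; hence \<open>kap_rA\<close>.\<close>

definition kap :: complex where "kap = (2 + \<i>) / of_real (sqrt 5)"

lemma kap_norm [simp]: "norm kap = 1"
proof -
  have "norm (2 + \<i>) = sqrt 5" by (simp add: cmod_def)
  then show ?thesis by (simp add: kap_def norm_divide)
qed

lemma rA_norm [simp]: "norm rA = 1" by (simp add: rA_def cmod_def power2_eq_square)

lemma kap_rA: "kap * kap * rA = 1"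
proof -
  have "complex_of_real (sqrt 5) * of_real (sqrt 5) = 5"
    by (simp flip: of_real_mult)
  then have "kap * kap = (2 + \<i>) * (2 + \<i>) / 5" by (simp add: kap_def)
  then show ?thesis by (simp add: rA_def complex_eq_iff)
qed

lemma up_spin: "up (\<lambda>z. u * z) = (\<lambda>z. u * kap * z)"
proof
  fix z
  have s: "complex_of_real (sqrt 5) * of_real (sqrt 5) = 5" by (simp flip: of_real_mult)
  have "of_real (sqrt 5) / (2 - \<i>) = kap"
    unfolding kap_def by (subst frac_eq_eq) (simp_all add: s algebra_simps)
  then show "up (\<lambda>z. u * z) z = u * kap * z"
    unfolding up_def scaleR_conv_of_real by (metis (no_types, opaque_lifting) mult.assoc mult.commute times_divide_eq_right)
qed

lemma star_subst_spin:
  assumes P: "patch P" and u: "norm u = 1" and st: "star P 0 = spin u (tile_of ` F)"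
    and F: "\<And>f. f \<in> F \<Longrightarrow> plane_isometry f"
    and eq: "(\<Union>g\<in>F. (\<circ>) (hat g) ` kids (ginv g 0)) = (\<circ>) (\<lambda>z. d * z) ` G"
  shows "star (subst P) 0 = spin (u * kap * d) (tile_of ` G)"
proof -
  have "star (subst P) (sqrt 5 *\<^sub>R 0) = (\<lambda>f. tile_of (up (\<lambda>z. u * z) \<circ> f)) `
      (\<Union>g\<in>F. (\<circ>) (hat g) ` kids (ginv g 0))"
    by (rule star_subst_fan[OF P spin_isometry[OF u] _ _ F]) (simp_all add: st spin_tiles)
  also have "\<dots> = spin (u * kap * d) (tile_of ` G)"
    unfolding eq up_spin spin_tiles image_image by (simp add: comp_def mult.assoc)
  finally show ?thesis by simp
qed

definition next_base :: "nat \<Rightarrow> nat" where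
  "next_base j = (if j = 0 then 2 else if j = 2 then 1 else if j = 1 then 3 else if j = 3 then 0
     else if j = 4 then 5 else 4)"

text \<open>The rotation left over, besides \<open>kap\<close>, when a substituted base star is
  compared with the next base star.\<close>

definition turn :: "nat \<Rightarrow> complex" where
  "turn j = (if j = 1 \<or> j = 3 \<or> j = 4 then rA else 1)"

lemma turn_norm [simp]: "norm (turn j) = 1" by (simp add: turn_def)

lemma kids_half: "kids (1/2 + \<i>) = {q4}" "kids (\<i>/2) = {q2}"
  by (auto simp: kids_eq)

lemma kids_base:
  assumes "j < 6"
  shows "(\<Union>g\<in>baseF j. (\<circ>) (hat g) ` kids (ginv g 0)) = (\<circ>) (\<lambda>z. turn j * z) ` baseF (next_base j)"
proof -
  have iso: "ginv f 0 = p" if "f \<in> baseF j" "f p = 0" for f p j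
    by (rule ginv_eqI[OF baseF_isometry[OF that(1)] that(2)])
  have e: "hat (\<lambda>z. z - (1/2 + \<i>)) \<circ> q4 = (\<lambda>z. \<i>/2 - z)" "hat (\<lambda>z. 1/2 + \<i> - z) \<circ> q4 = (\<lambda>z. z - \<i>/2)"
    "hat (\<lambda>z. z - \<i>/2) \<circ> q2 = (\<lambda>z. 1/2 - \<i> - cnj z)" "hat (\<lambda>z. \<i>/2 - z) \<circ> q2 = (\<lambda>z. cnj z - (1/2 - \<i>))"
    "hat (\<lambda>z. cnj z - (1/2 - \<i>)) \<circ> q4 = (\<lambda>z. rA * (- (\<i>/2) - cnj z))"
    "hat (\<lambda>z. 1/2 - \<i> - cnj z) \<circ> q4 = (\<lambda>z. rA * (cnj z + \<i>/2))"
    "hat (\<lambda>z. cnj z + \<i>/2) \<circ> q2 = (\<lambda>z. rA * (1/2 + \<i> - z))"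
    "hat (\<lambda>z. - (\<i>/2) - cnj z) \<circ> q2 = (\<lambda>z. rA * (z - (1/2 + \<i>)))"
    by (auto simp: fun_eq_iff hat_alt q_defs rA_def complex_eq_iff field_simps)
  have g0: "ginv (\<lambda>z. z - (1/2 + \<i>)) 0 = 1/2 + \<i>" "ginv (\<lambda>z. 1/2 + \<i> - z) 0 = 1/2 + \<i>"
    by (rule iso[of _ 0], simp add: baseF_simps, simp)+
  have g1: "ginv (\<lambda>z. cnj z - (1/2 - \<i>)) 0 = 1/2 + \<i>" "ginv (\<lambda>z. 1/2 - \<i> - cnj z) 0 = 1/2 + \<i>"
    by (rule iso[of _ 1], simp add: baseF_simps del: One_nat_def, simp)+
  have g2: "ginv (\<lambda>z. z - \<i>/2) 0 = \<i>/2" "ginv (\<lambda>z. \<i>/2 - z) 0 = \<i>/2"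
    by (rule iso[of _ 2], simp add: baseF_simps, simp)+
  have g3: "ginv (\<lambda>z. cnj z + \<i>/2) 0 = \<i>/2" "ginv (\<lambda>z. - (\<i>/2) - cnj z) 0 = \<i>/2"
    by (rule iso[of _ 3], simp add: baseF_simps, simp)+
  note g = g0 g1 g2 g3
  have n: "next_base 0 = 2" "next_base 1 = 3" "next_base 2 = 1" "next_base 3 = 0" "next_base 4 = 5" "next_base 5 = 4"
    "turn 0 = 1" "turn 1 = rA" "turn 2 = 1" "turn 3 = rA" "turn 4 = rA" "turn 5 = 1"
    by (simp_all add: next_base_def turn_def)
  consider "j = 0" | "j = 1" | "j = 2" | "j = 3" | "j = 4" | "j = 5" using assms unfolding less_6 by blast
  then show ?thesis
  proof cases
    case 1
    show ?thesis unfolding 1 n baseF_simps Union_insert_fans g kids_half image_insert image_empty e unfolding comp_def by auto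
  next
    case 2
    show ?thesis unfolding 2 n baseF_simps Union_insert_fans g kids_half image_insert image_empty e unfolding comp_def by auto
  next
    case 3
    show ?thesis unfolding 3 n baseF_simps Union_insert_fans g kids_half image_insert image_empty e unfolding comp_def by auto
  next
    case 4
    show ?thesis unfolding 4 n baseF_simps Union_insert_fans g kids_half image_insert image_empty e unfolding comp_def by auto
  next
    case 5
    show ?thesis unfolding 5 n baseF_simps kids_fanA ..
  next
    case 6
    show ?thesis unfolding 6 n baseF_simps kids_fanB by (simp add: comp_def)
  qed
qed

lemma star_subst_base:
  assumes "patch P" "norm u = 1" "star P 0 = spin u (base j)" "j < 6"
  shows "star (subst P) 0 = spin (u * kap * turn j) (base (next_base j))"
  unfolding base_def
  by (rule star_subst_spin[OF assms(1,2) assms(3)[unfolded base_def] baseF_isometry kids_base[OF assms(4)]])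

lemma next_base_less: "j < 6 \<Longrightarrow> next_base j < 6"
  by (simp add: next_base_def)

text \<open>Four steps close either cycle of \<open>next_base\<close> and collect four factors
  \<open>kap\<close> and two factors \<open>rA\<close>. By \<open>kap_rA\<close> they cancel, so the
  star comes back without any rotation.\<close>

lemma star_subst_base_4:
  assumes "patch P" "norm u = 1" "star P 0 = spin u (base j)" "j < 6"
  shows "star ((subst ^^ 4) P) 0 = spin u (base j)"
proof -
  define v where "v w i = w * kap * turn i" for w i
  have v: "norm (v w i) = 1" if "norm w = 1" for w i using that by (simp add: v_def norm_mult)
  let ?j1 = "next_base j" let ?j2 = "next_base ?j1" let ?j3 = "next_base ?j2"
  note P1 = subst_patch[OF assms(1)] note P2 = subst_patch[OF P1] note P3 = subst_patch[OF P2]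
  note nb = next_base_less
  note s1 = star_subst_base[OF assms, folded v_def]
  note s2 = star_subst_base[OF P1 v[OF assms(2)] s1 nb[OF assms(4)], folded v_def]
  note s3 = star_subst_base[OF P2 v[OF v[OF assms(2)]] s2 nb[OF nb[OF assms(4)]], folded v_def]
  note s4 = star_subst_base[OF P3 v[OF v[OF v[OF assms(2)]]] s3 nb[OF nb[OF nb[OF assms(4)]]], folded v_def]
  have "next_base ?j3 = j \<and> v (v (v (v u j) ?j1) ?j2) ?j3 = u * (kap * kap * rA) * (kap * kap * rA)"
    using assms(4) unfolding less_6 by (elim disjE) (simp_all add: next_base_def turn_def v_def)
  then show ?thesis using s4 by (simp add: kap_rA eval_nat_numeral)
qed

lemma base_member:
  assumes "j < 6" "f \<in> baseF j" shows "\<exists>p\<in>proto. f p = 0"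
proof -
  have p: "1/2 + \<i> \<in> proto" "\<i>/2 \<in> proto" "1 \<in> proto" "2 * \<i> \<in> proto" by (auto simp: proto_def)
  consider "f (1/2 + \<i>) = 0" | "f (\<i>/2) = 0" | "f 1 = 0" | "f (2 * \<i>) = 0"
    using assms unfolding less_6 by (elim disjE; simp add: baseF_simps fanA_def fanB_def del: One_nat_def; elim disjE; simp add: complex_eq_iff)
  then show ?thesis using p by cases blast+
qed

lemma star_base: assumes "j < 6" shows "star (base j) 0 = base j"
proof -
  have "0 \<in> tile_of f" if "f \<in> baseF j" for f
    using base_member[OF assms that] unfolding tile_of_def by (metis imageI)
  then show ?thesis by (auto simp: star_def base_def)
qed

lemma base_finite: "finite (base j)"
  by (simp add: base_def baseF_def fanA_def fanB_def)

lemma base_neg: assumes "j < 6" shows "spin (-1) (base j) = base j"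
proof -
  have 1: "(\<lambda>f z. - f z) ` baseF j \<subseteq> baseF j"
  proof -
    have n: "(\<lambda>z. - (z - (1/2 + \<i>))) = (\<lambda>z. 1/2 + \<i> - z)"
      "(\<lambda>z. - (1/2 + \<i> - z)) = (\<lambda>z. z - (1/2 + \<i>))"
      "(\<lambda>z. - (cnj z - (1/2 - \<i>))) = (\<lambda>z. 1/2 - \<i> - cnj z)"
      "(\<lambda>z. - (1/2 - \<i> - cnj z)) = (\<lambda>z. cnj z - (1/2 - \<i>))"
      "(\<lambda>z. - (z - \<i>/2)) = (\<lambda>z. \<i>/2 - z)"
      "(\<lambda>z. - (\<i>/2 - z)) = (\<lambda>z. z - \<i>/2)"
      "(\<lambda>z. - (cnj z + \<i>/2)) = (\<lambda>z. - (\<i>/2) - cnj z)"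
      "(\<lambda>z. - (- (\<i>/2) - cnj z)) = (\<lambda>z. cnj z + \<i>/2)"
      "(\<lambda>z. - (2 - \<i> * cnj z)) = (\<lambda>z. - 2 + \<i> * cnj z)"
      "(\<lambda>z. - (- 2 + \<i> * cnj z)) = (\<lambda>z. 2 - \<i> * cnj z)"
      "(\<lambda>z. - (1 - cnj z)) = (\<lambda>z. - 1 + cnj z)"
      "(\<lambda>z. - (- 1 + cnj z)) = (\<lambda>z. 1 - cnj z)"
      "(\<lambda>z. - (rA * (2 + \<i> * z))) = (\<lambda>z. rA * (- 2 - \<i> * z))"
      "(\<lambda>z. - (rA * (- 2 - \<i> * z))) = (\<lambda>z. rA * (2 + \<i> * z))"
      "(\<lambda>z. - (rA * (1 - z))) = (\<lambda>z. rA * (- 1 + z))"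
      "(\<lambda>z. - (rA * (- 1 + z))) = (\<lambda>z. rA * (1 - z))"
      "(\<lambda>z. - (\<i> * (1 - cnj z))) = (\<lambda>z. \<i> * (- 1 + cnj z))"
      "(\<lambda>z. - (\<i> * (- 1 + cnj z))) = (\<lambda>z. \<i> * (1 - cnj z))"
      "(\<lambda>z. - (2 + \<i> * z)) = (\<lambda>z. - 2 - \<i> * z)"
      "(\<lambda>z. - (- 2 - \<i> * z)) = (\<lambda>z. 2 + \<i> * z)"
      "(\<lambda>z. - (\<i> * (1 - z))) = (\<lambda>z. \<i> * (- 1 + z))"
      "(\<lambda>z. - (\<i> * (- 1 + z))) = (\<lambda>z. \<i> * (1 - z))"
      by (auto simp: fun_eq_iff algebra_simps)
    have "(\<lambda>z. - f z) \<in> baseF j" if "f \<in> baseF j" for f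
    proof -
      have m: "\<forall>f\<in>baseF 0. (\<lambda>z. - f z) \<in> baseF 0" "\<forall>f\<in>baseF 1. (\<lambda>z. - f z) \<in> baseF 1"
        "\<forall>f\<in>baseF 2. (\<lambda>z. - f z) \<in> baseF 2" "\<forall>f\<in>baseF 3. (\<lambda>z. - f z) \<in> baseF 3"
        "\<forall>f\<in>baseF 4. (\<lambda>z. - f z) \<in> baseF 4" "\<forall>f\<in>baseF 5. (\<lambda>z. - f z) \<in> baseF 5"
        unfolding baseF_simps fanA_def fanB_def by (simp_all only: ball_simps n insert_iff simp_thms)
      then show ?thesis using that assms unfolding less_6 by blast
    qed
    then show ?thesis by blast
  qed
  have "(\<lambda>f z. - f z) ` (\<lambda>f z. - f z) ` baseF j = baseF j" by (simp add: image_image)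
  with image_mono[OF 1, of "\<lambda>f z. - f z"] have "baseF j \<subseteq> (\<lambda>f z. - f z) ` baseF j" by (simp only:)
  with 1 have "(\<lambda>f z. - f z) ` baseF j = baseF j" by (rule equalityI)
  then have "tile_of ` (\<lambda>f z. - f z) ` baseF j = base j" by (simp add: base_def)
  then show ?thesis by (simp add: spin_base image_image comp_def)
qed

text \<open>Finitely many closed tiles miss the origin, so a neighbourhood of it avoids them all and
  is covered by the star alone.\<close>

lemma star_interior:
  assumes P: "patch P" "finite P" and z: "0 \<in> interior (\<Union>P)" shows "0 \<in> interior (\<Union>(star P 0))"
proof -
  let ?U = "interior (\<Union>P) - \<Union>{t \<in> P. 0 \<notin> t}"
  have "closed (\<Union>{t \<in> P. 0 \<notin> t})"
    using P by (intro closed_Union) (auto intro: is_tile_compact patch_is_tile)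
  then have "open ?U" by (intro open_Diff) auto
  moreover have "0 \<in> ?U" using z by auto
  moreover have "?U \<subseteq> \<Union>(star P 0)" using interior_subset[of "\<Union>P"] by (auto simp: star_def)
  ultimately show ?thesis by (rule interiorI)
qed

section \<open>Legality of the six stars\<close>

lemma legal_tilesI:
  assumes "legal P" "plane_isometry a" "\<And>f. f \<in> F \<Longrightarrow> tile_of (a \<circ> f) \<in> subst P"
  shows "legal (tile_of ` F)"
proof -
  have "move a (tile_of ` F) \<subseteq> subst P" using assms(3) by (auto simp: move_def tile_of_comp)
  then have "legal (move a (tile_of ` F))" using legal_mono[OF legal_subst[OF assms(1)]] by blast
  from legal_move[OF this plane_isometry_inv[OF assms(2)]] show ?thesis
    by (simp add: move_inverse(1)[OF assms(2)])
qed

lemma unit_cnj: "norm u = 1 \<Longrightarrow> cnj u * u = 1"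
  using complex_norm_square[of u] by (simp add: mult.commute)

lemma legal_spin: assumes "norm u = 1" shows "legal (spin u P) \<longleftrightarrow> legal P"
proof
  assume "legal (spin u P)"
  then have "legal (spin (cnj u) (spin u P))"
    unfolding spin_def[of "cnj u"] using assms by (intro legal_move spin_isometry) simp_all
  then show "legal P" by (simp add: spin_spin unit_cnj[OF assms])
next
  assume "legal P"
  then show "legal (spin u P)" unfolding spin_def using assms by (intro legal_move spin_isometry)
qed

lemma subst_finite_cover:
  assumes "legal P" "finite P" "0 \<in> interior (\<Union>P)"
  shows "0 \<in> interior (\<Union>(star (subst P) 0))"
proof (rule star_interior)
  have P: "patch P" by (rule legal_patch[OF assms(1)])
  then show "patch (subst P)" "finite (subst P)" using assms by (auto intro: subst_patch subst_finite)
  show "0 \<in> interior (\<Union>(subst P))"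
    unfolding subst_Union[OF P] scale_interior using assms(3) by (auto intro!: image_eqI[of _ _ 0])
qed

text \<open>Legality and covering a neighbourhood pass along the cycles of \<open>next_base\<close>,
  so one star per cycle has to be exhibited directly: \<open>base_0\<close> and
  \<open>base_4\<close>.\<close>

lemma base_step:
  assumes "legal (base j)" "0 \<in> interior (\<Union>(base j))" "j < 6"
  shows "legal (base (next_base j)) \<and> 0 \<in> interior (\<Union>(base (next_base j)))"
proof -
  have st: "star (subst (base j)) 0 = spin (kap * turn j) (base (next_base j))"
    using star_subst_base[OF legal_patch[OF assms(1)], of 1 j] star_base assms(3) by simp
  have n: "norm (kap * turn j) = 1" by (simp add: norm_mult)
  have "legal (star (subst (base j)) 0)"
    by (rule legal_mono[OF legal_subst[OF assms(1)]]) (auto simp: star_def)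
  moreover have "0 \<in> interior (\<Union>(star (subst (base j)) 0))"
    by (rule subst_finite_cover[OF assms(1) base_finite assms(2)])
  ultimately show ?thesis unfolding st legal_spin[OF n] spin_interior[OF n] ..
qed

lemma legal_single: "is_tile t \<Longrightarrow> legal {t}"
  unfolding legal_def using plane_isometry_id(1) by (metis funpow_0 move_id order_refl)

lemma open_abs_box: "open {z::complex. \<bar>Re z\<bar> < 1/2 \<and> \<bar>Im z\<bar> < 1/2}"
proof -
  have "{z::complex. \<bar>Re z\<bar> < 1/2 \<and> \<bar>Im z\<bar> < 1/2} = {z. \<bar>Re z\<bar> < 1/2} \<inter> {z. \<bar>Im z\<bar> < 1/2}" by auto
  then show ?thesis by (auto intro!: open_Int open_Collect_less continuous_intros)
qed

lemma id_kids: "tile_of id \<in> P \<Longrightarrow> q \<in> pieces \<Longrightarrow> tile_of (up id \<circ> q) \<in> subst P"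
  using subst_tile_tile_of[OF plane_isometry_id(1)] by (auto simp: subst_def)

lemma g_kids: "tile_of g \<in> P \<Longrightarrow> plane_isometry g \<Longrightarrow> q \<in> pieces \<Longrightarrow> tile_of (up id \<circ> (hat g \<circ> q)) \<in> subst P"
  using subst_tile_tile_of[of g] up_comp[of id g] by (auto simp: subst_def comp_assoc)

lemma base_0: "legal (base 0) \<and> 0 \<in> interior (\<Union>(base 0))"
proof
  \<comment> \<open>\<open>3/2 + \<i>\<close> is the centre of the rectangle formed by the pieces
    \<open>q3\<close> and \<open>q4\<close>.\<close>
  define a where "a z = up id (z + (3/2 + \<i>))" for z
  have a: "plane_isometry a"
    using plane_isometry_comp[OF up_isometry[OF plane_isometry_id(1)], of "\<lambda>z. z + (3/2 + \<i>)"]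
    by (simp add: plane_isometry_def comp_def a_def[abs_def])
  have e: "a \<circ> (\<lambda>z. z - (1/2 + \<i>)) = up id \<circ> q3" "a \<circ> (\<lambda>z. 1/2 + \<i> - z) = up id \<circ> q4"
    by (auto simp: a_def q_defs fun_eq_iff algebra_simps)
  show "legal (base 0)" unfolding base_def
  proof (rule legal_tilesI[OF legal_single[OF is_tile_tile_of[OF plane_isometry_id(1)]] a])
    fix f assume "f \<in> baseF 0"
    then show "tile_of (a \<circ> f) \<in> subst {tile_of id}"
      using id_kids[of "{tile_of id}" q3] id_kids[of "{tile_of id}" q4] e by (auto simp: baseF_simps pieces_def)
  qed
  have "z \<in> \<Union>(base 0)" if z: "\<bar>Re z\<bar> < 1/2" "\<bar>Im z\<bar> < 1/2" for z
  proof -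
    have "z + (1/2 + \<i>) \<in> proto \<or> 1/2 + \<i> - z \<in> proto" using z by (auto simp: proto_def abs_less_iff)
    then have "z \<in> (\<lambda>z. z - (1/2 + \<i>)) ` proto \<or> z \<in> (\<lambda>z. 1/2 + \<i> - z) ` proto"
      by (force simp: image_iff)
    then show ?thesis by (auto simp: base_def baseF_simps tile_of_def)
  qed
  then show "0 \<in> interior (\<Union>(base 0))" by (intro interiorI[OF open_abs_box]) auto
qed

text \<open>A chain of adjacencies makes the fan legal: \<open>q3\<close> and \<open>q2\<close>
  share a long leg inside one dilated tile (\<open>gLm\<close>); their children \<open>q5\<close>
  share a hypotenuse (\<open>gHm\<close>); the children \<open>q4\<close>, \<open>q5\<close> on both
  sides of it form the rhombus \<open>fanM\<close>, whose substitution has \<open>fanA\<close> at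
  the centre.\<close>

lemma base_4: "legal (base 4) \<and> 0 \<in> interior (\<Union>(base 4))"
proof -
  have L: "legal (tile_of ` {id, gLm})"
  proof (rule legal_tilesI[OF legal_single[OF is_tile_tile_of[OF plane_isometry_id(1)]]
        plane_isometry_comp[OF up_isometry[OF plane_isometry_id(1)] q_isometry(3)]])
    fix f assume "f \<in> {id, gLm}"
    moreover have "up id \<circ> q3 \<circ> gLm = up id \<circ> q2" by (auto simp: fun_eq_iff q_defs g_defs)
    ultimately show "tile_of (up id \<circ> q3 \<circ> f) \<in> subst {tile_of id}"
      using id_kids[of "{tile_of id}" q3] id_kids[of "{tile_of id}" q2] by (auto simp: pieces_def)
  qed
  have H: "legal (tile_of ` {id, gHm})"
  proof (rule legal_tilesI[OF L plane_isometry_comp[OF up_isometry[OF plane_isometry_id(1)] q_isometry(5)]])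
    fix f assume "f \<in> {id, gHm}"
    moreover have "q5 \<circ> gHm = hat gLm \<circ> q5" by (auto simp: mapeq field_simps)
    ultimately show "tile_of (up id \<circ> q5 \<circ> f) \<in> subst (tile_of ` {id, gLm})"
      using id_kids[of "tile_of ` {id, gLm}" q5] g_kids[of gLm "tile_of ` {id, gLm}" q5]
      by (auto simp: pieces_def comp_assoc)
  qed
  have M: "legal (tile_of ` fanM)"
  proof (rule legal_tilesI[OF H plane_isometry_comp[OF up_isometry[OF plane_isometry_id(1)] q_isometry(4)]])
    fix f assume "f \<in> fanM"
    moreover have "q4 \<circ> gSm = q5" "q4 \<circ> gLm = hat gHm \<circ> q4" "q4 \<circ> gM3 = hat gHm \<circ> q5"
      by (auto simp: mapeq field_simps)
    ultimately show "tile_of (up id \<circ> q4 \<circ> f) \<in> subst (tile_of ` {id, gHm})"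
      using id_kids[of "tile_of ` {id, gHm}" q4] id_kids[of "tile_of ` {id, gHm}" q5]
        g_kids[of gHm "tile_of ` {id, gHm}" q4] g_kids[of gHm "tile_of ` {id, gHm}" q5]
      by (auto simp: pieces_def comp_assoc fanM_def)
  qed
  have "z \<in> \<Union>(tile_of ` fanM)" if z: "\<bar>Re z\<bar> < 1/2" "\<bar>Im z\<bar> < 1/2" for z
  proof -
    have "\<exists>f\<in>fanM. z = f (Complex \<bar>Re z\<bar> \<bar>Im z\<bar>)"
      by (auto simp: fanM_def g_defs complex_eq_iff abs_if)
    moreover have "Complex \<bar>Re z\<bar> \<bar>Im z\<bar> \<in> proto" using z by (auto simp: proto_def)
    ultimately show ?thesis unfolding tile_of_def by blast
  qed
  then have "0 \<in> interior (\<Union>(tile_of ` fanM))" by (intro interiorI[OF open_abs_box]) auto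
  then have cov: "0 \<in> interior (\<Union>(star (subst (tile_of ` fanM)) 0))"
    by (intro subst_finite_cover[OF M]) (auto simp: fanM_def)
  have "f 0 = 0" if "f \<in> fanM" for f using that by (auto simp: fanM_def g_defs)
  then have "star (tile_of ` fanM) 0 = spin 1 (tile_of ` fanM)"
    by (force simp: star_def tile_of_def proto_def image_iff)
  moreover have "(\<Union>g\<in>fanM. (\<circ>) (hat g) ` kids (ginv g 0)) = (\<circ>) (\<lambda>z. 1 * z) ` fanA"
    unfolding kids_fanM by (simp add: comp_def)
  ultimately have "star (subst (tile_of ` fanM)) 0 = spin (1 * kap * 1) (tile_of ` fanA)"
    by (intro star_subst_spin[OF legal_patch[OF M] _ _ fan_isometry(1)]) simp_all
  then have st: "star (subst (tile_of ` fanM)) 0 = spin kap (base 4)"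
    by (simp add: base_def baseF_simps)
  have "legal (star (subst (tile_of ` fanM)) 0)"
    by (rule legal_mono[OF legal_subst[OF M]]) (auto simp: star_def)
  then show ?thesis using cov unfolding st legal_spin[OF kap_norm] spin_interior[OF kap_norm] ..
qed

lemma base_legal_cover: assumes "j < 6" shows "legal (base j)" "0 \<in> interior (\<Union>(base j))"
proof -
  have 2: "legal (base 2) \<and> 0 \<in> interior (\<Union>(base 2))" using base_step[of 0] base_0 by (simp add: next_base_def)
  have 1: "legal (base 1) \<and> 0 \<in> interior (\<Union>(base 1))" using base_step[of 2] 2 by (simp add: next_base_def)
  have 3: "legal (base 3) \<and> 0 \<in> interior (\<Union>(base 3))" using base_step[of 1] 1 by (simp add: next_base_def)
  have 5: "legal (base 5) \<and> 0 \<in> interior (\<Union>(base 5))" using base_step[of 4] base_4 by (simp add: next_base_def)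
  show "legal (base j)" "0 \<in> interior (\<Union>(base j))"
    using assms base_0 1 2 3 base_4 5 unfolding less_6 by auto
qed

section \<open>The six stars are inequivalent under rotation\<close>

lemma spin_inject:
  assumes "spin w (tile_of ` F) = tile_of ` G" "norm w = 1" "\<And>f. f \<in> F \<Longrightarrow> plane_isometry f"
    "\<And>g. g \<in> G \<Longrightarrow> plane_isometry g" "f \<in> F"
  obtains g where "g \<in> G" "g = (\<lambda>z. w * f z)"
proof -
  have "tile_of ((\<lambda>z. w * z) \<circ> f) \<in> tile_of ` G" using assms(1,5) unfolding spin_tiles by blast
  then obtain g where "g \<in> G" "tile_of ((\<lambda>z. w * z) \<circ> f) = tile_of g" by blast
  moreover from this have "(\<lambda>z. w * z) \<circ> f = g"
    using assms by (intro tile_of_inj plane_isometry_comp spin_isometry) auto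
  ultimately show ?thesis using that by (auto simp: comp_def)
qed

text \<open>By rigidity equal stars have equal placements, so \<open>w\<close> times a map of one
  list lies in the other list. The values at 0, 1 and \<open>2 * \<i>\<close> are linear conditions
  on \<open>Re w\<close> and \<open>Im w\<close>, which leave only the half-turn common to all six
  stars.\<close>

lemma base_inequivalent:
  assumes eq: "spin w (base i) = base j" and w: "norm w = 1" and ij: "i < 6" "j < 6"
  shows "i = j \<and> (w = 1 \<or> w = -1)"
proof -
  define a b where "a = Re w" and "b = Im w"
  have w': "w = Complex a b" by (simp add: a_def b_def)
  have n: "a * a + b * b = 1" using w by (simp add: w' cmod_def power2_eq_square)
  have ev: "\<exists>g\<in>baseF j. g 0 = w * f 0 \<and> g 1 = w * f 1 \<and> g (2 * \<i>) = w * f (2 * \<i>)" if fi: "f \<in> baseF i" for f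
  proof -
    obtain g where "g \<in> baseF j" "g = (\<lambda>z. w * f z)"
      using spin_inject[OF eq[unfolded base_def] w baseF_isometry baseF_isometry fi] .
    then show ?thesis by (intro bexI[of _ g]) simp_all
  qed
  have f: "(\<lambda>z. z - (1/2 + \<i>)) \<in> baseF 0" "(\<lambda>z. cnj z - (1/2 - \<i>)) \<in> baseF 1" "(\<lambda>z. z - \<i>/2) \<in> baseF 2"
    "(\<lambda>z. cnj z + \<i>/2) \<in> baseF 3" "(\<lambda>z. 2 - \<i> * cnj z) \<in> baseF 4" "(\<lambda>z. 1 - cnj z) \<in> baseF 4"
    "(\<lambda>z. 2 - \<i> * cnj z) \<in> baseF 5" "(\<lambda>z. \<i> * (1 - cnj z)) \<in> baseF 5"
    by (simp_all add: baseF_simps fanA_def fanB_def del: One_nat_def)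
  consider "i = 0" | "i = 1" | "i = 2" | "i = 3" | "i = 4" | "i = 5" using ij(1) unfolding less_6 by blast
  then show ?thesis
  proof cases
    case 1
    show ?thesis using ev[unfolded 1, OF f(1)] ij(2) unfolding less_6 1
      by (elim disjE; simp add: baseF_simps fanA_def fanB_def w' rA_def complex_eq_iff del: One_nat_def; (elim disjE)?; argo)
  next
    case 2
    show ?thesis using ev[unfolded 2, OF f(2)] ij(2) unfolding less_6 2
      by (elim disjE; simp add: baseF_simps fanA_def fanB_def w' rA_def complex_eq_iff del: One_nat_def; (elim disjE)?; argo)
  next
    case 3
    show ?thesis using ev[unfolded 3, OF f(3)] ij(2) unfolding less_6 3
      by (elim disjE; simp add: baseF_simps fanA_def fanB_def w' rA_def complex_eq_iff del: One_nat_def; (elim disjE)?; argo)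
  next
    case 4
    show ?thesis using ev[unfolded 4, OF f(4)] ij(2) unfolding less_6 4
      by (elim disjE; simp add: baseF_simps fanA_def fanB_def w' rA_def complex_eq_iff del: One_nat_def; (elim disjE)?; argo)
  next
    case 5
    \<comment> \<open>\<open>fanA\<close> and \<open>fanB\<close> share the map
      \<open>2 - \<i> * cnj z\<close>, so a second map is needed to tell them apart.\<close>
    show ?thesis using ev[unfolded 5, OF f(5)] ev[unfolded 5, OF f(6)] ij(2) unfolding less_6 5
      by (elim disjE; simp add: baseF_simps fanA_def fanB_def w' rA_def complex_eq_iff del: One_nat_def; (elim disjE)?; argo)
  next
    case 6
    show ?thesis using ev[unfolded 6, OF f(7)] ev[unfolded 6, OF f(8)] ij(2) unfolding less_6 6
      by (elim disjE; simp add: baseF_simps fanA_def fanB_def w' rA_def complex_eq_iff del: One_nat_def; (elim disjE)?; argo)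
  qed
qed

section \<open>Central stars of invariant tilings\<close>

lemma rotation_pi: "rotation pi = uminus"
  by (auto simp: rotation_def fun_eq_iff)

lemma invariant_iff: "T \<in> invariant_tilings H2 \<longleftrightarrow> T \<in> pinwheel_space \<and> spin (-1) T = T"
  by (auto simp: invariant_tilings_def H2_eq rotation_pi spin_def move_def)

lemma fan_move:
  assumes "fan G p (move g S) (g c)" "plane_isometry g" shows "fan G p S c"
proof -
  obtain h where h: "plane_isometry h" "move g S = (\<lambda>f. tile_of (h \<circ> f)) ` G" "g c = h p"
    using assms by (auto simp: fan_def)
  have "S = move (ginv g) ((\<lambda>f. tile_of (h \<circ> f)) ` G)"
    using h(2) move_inverse(1)[OF assms(2), of S] by simp
  also have "\<dots> = (\<lambda>f. tile_of ((ginv g \<circ> h) \<circ> f)) ` G"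
    by (simp add: move_def image_image tile_of_comp[symmetric] comp_assoc)
  finally have "S = (\<lambda>f. tile_of ((ginv g \<circ> h) \<circ> f)) ` G" .
  moreover have "c = (ginv g \<circ> h) p" using h(3) plane_isometry_inv_comp(4)[OF assms(2), of c] by simp
  ultimately show ?thesis
    unfolding fan_def using plane_isometry_comp[OF plane_isometry_inv[OF assms(2)] h(1)] by blast
qed

text \<open>A disc about the origin sits in a supertile, so the classification of stars applies. The
  half-turn of the tiling turns into the reflection at \<open>g 0\<close>, whether or not
  \<open>g\<close> preserves orientation.\<close>

lemma invariant_star_symmetric:
  assumes T: "T \<in> invariant_tilings H2" shows "symmetric_star (star T 0) 0"
proof -
  have om: "T \<in> pinwheel_space" and neg: "spin (-1) T = T" using T by (simp_all add: invariant_iff)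
  obtain t n g where g: "is_tile t" "plane_isometry g" "move g (near T 0 1) \<subseteq> (subst ^^ n) {t}"
    "ball (g 0) 1 \<subseteq> \<Union>(move g (near T 0 1))" using pinwheel_near[OF om] .
  let ?P = "(subst ^^ n) {t}"
  have P: "patch ?P" by (intro subst_pow_patch patch_single g)
  have st: "star ?P (g 0) = move g (star T 0)"
  proof
    show "star ?P (g 0) \<subseteq> move g (star T 0)"
    proof
      fix x assume x: "x \<in> star ?P (g 0)"
      then have "x \<inter> ball (g 0) 1 \<noteq> {}" by (auto simp: star_def)
      then have "x \<in> move g (near T 0 1)"
        using patch_covering[OF P g(3) open_ball g(4)] x by (simp add: star_def)
      then obtain s where s: "s \<in> T" "x = g ` s" by (auto simp: move_def near_def)
      then have "0 \<in> s" using x isometry_mem_image[OF g(2)] by (simp add: star_def)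
      then show "x \<in> move g (star T 0)" using s by (auto simp: star_def move_def)
    qed
    show "move g (star T 0) \<subseteq> star ?P (g 0)"
    proof
      fix x assume "x \<in> move g (star T 0)"
      then obtain s where s: "s \<in> T" "0 \<in> s" "x = g ` s" by (auto simp: move_def star_def)
      moreover have "0 \<in> cball (0::complex) 1" by simp
      ultimately have "s \<in> near T 0 1" unfolding near_def by blast
      then show "x \<in> star ?P (g 0)" using s g(3) by (auto simp: star_def move_def)
    qed
  qed
  have "ball (g 0) 1 \<subseteq> \<Union>?P" using g(3,4) by blast
  then have "g 0 \<in> interior (\<Union>?P)" by (rule interiorI[OF open_ball centre_in_ball[THEN iffD2, OF zero_less_one]])
  from star_classification[OF g(1) this] have cl: "point_star (move g (star T 0)) (g 0) \<or> inner_star (move g (star T 0)) (g 0)"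
    unfolding st .
  have "(\<lambda>z. 2 * g 0 - z) ` x \<in> move g (star T 0)" if x: "x \<in> move g (star T 0)" for x
  proof -
    obtain s where s: "s \<in> T" "0 \<in> s" "x = g ` s" using x by (auto simp: move_def star_def)
    have "uminus ` s \<in> spin (-1) T" using s(1) by (auto simp: spin_def move_def)
    then have "uminus ` s \<in> star T 0" using neg s(2) by (auto simp: star_def intro!: image_eqI[of _ _ 0])
    moreover have "(\<lambda>z. 2 * g 0 - z) ` x = g ` uminus ` s"
      unfolding s(3) image_image isometry_reflect[OF g(2)] by simp
    ultimately show ?thesis by (simp add: move_def)
  qed
  from symmetric_stars[OF cl this] have "symmetric_star (move g (star T 0)) (g 0)" .
  then show ?thesis unfolding symmetric_star_def using fan_move[OF _ g(2)] by blast
qed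

text \<open>The half-turn commutes with the dilation and \<open>decomp\<close> involves no choice,
  so parents are mapped to parents. Applying the half-turn twice turns the inclusion into an
  equality.\<close>

lemma decomp_invariant:
  assumes T: "T \<in> invariant_tilings H2" shows "decomp T \<in> invariant_tilings H2"
proof -
  have neg: "spin (-1) T = T" using T by (simp add: invariant_iff)
  have "dil (\<lambda>z. (-1) * z) = (\<lambda>z. (-1) * z)" by (auto simp: dil_def)
  then have st: "subst_tile ((\<lambda>z. (-1) * z) ` t) = spin (-1) (subst_tile t)" if "is_tile t" for t
    using subst_tile_move[OF spin_isometry[of "-1"] that] by (simp add: spin_def)
  have "(\<lambda>z. (-1) * z) ` t \<in> decomp T" if "t \<in> decomp T" for t
  proof -
    have t: "is_tile t" "subst_tile t \<subseteq> T" using that by (auto simp: decomp_def)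
    have "spin (-1) (subst_tile t) \<subseteq> spin (-1) T" unfolding spin_def by (rule move_mono[OF t(2)])
    then show ?thesis using st[OF t(1)] neg is_tile_image[OF spin_isometry[of "-1"] t(1)] by (simp add: decomp_def)
  qed
  then have sub: "spin (-1) (decomp T) \<subseteq> decomp T" unfolding spin_def move_def by blast
  then have "spin (-1) (spin (-1) (decomp T)) \<subseteq> spin (-1) (decomp T)"
    unfolding spin_def by (rule move_mono)
  then have "spin (-1) (decomp T) = decomp T" using sub by (simp add: spin_spin)
  then show ?thesis using T decomp_pinwheel by (simp add: invariant_iff)
qed

definition based :: "tile set \<Rightarrow> bool" where
  "based S \<longleftrightarrow> (\<exists>j<6. \<exists>u. norm u = 1 \<and> S = spin u (base j))"

lemma basedI: "j < 6 \<Longrightarrow> norm u = 1 \<Longrightarrow> S = spin u (base j) \<Longrightarrow> based S"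
  unfolding based_def by blast

lemma spin_base_eq:
  assumes "(\<lambda>f. h \<circ> f) ` G = (\<lambda>f z. u * f z) ` baseF j"
  shows "(\<lambda>f. tile_of (h \<circ> f)) ` G = spin u (base j)"
proof -
  have "(\<lambda>f. tile_of (h \<circ> f)) ` G = tile_of ` (\<lambda>f. h \<circ> f) ` G" by (simp add: image_image)
  then show ?thesis unfolding assms spin_base by (simp add: image_image comp_def)
qed

text \<open>The frame \<open>h\<close> may reverse orientation. For the two-tile stars this leads to
  the mirror indices 1 and 3; conjugation takes \<open>fanA\<close> to its rotation by
  \<open>cnj rA\<close> and \<open>fanB\<close> to itself, so for the fans it only changes the
  rotation.\<close>

lemma fan_based:
  "fan {id, gHr} (1/2 + \<i>) S 0 \<Longrightarrow> based S" "fan {id, gLr} (\<i>/2) S 0 \<Longrightarrow> based S"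
  "fan fanA 0 S 0 \<Longrightarrow> based S" "fan fanB 0 S 0 \<Longrightarrow> based S"
proof -
  assume "fan {id, gHr} (1/2 + \<i>) S 0"
  then obtain h where h: "plane_isometry h" "S = (\<lambda>g. tile_of (h \<circ> g)) ` {id, gHr}" "0 = h (1/2 + \<i>)"
    by (auto simp: fan_def)
  obtain b w v where hb: "norm w = 1" "h = euclid b w v" using h(1) plane_isometry_iff by auto
  have v: "v = - (w * conj_if b (1/2 + \<i>))" using h(3) by (simp add: hb euclid_def eq_neg_iff_add_eq_0 add.commute)
  show "based S"
  proof (cases b)
    case True
    have "h \<circ> id = (\<lambda>z. w * (cnj z - (1/2 - \<i>)))" "h \<circ> gHr = (\<lambda>z. w * (1/2 - \<i> - cnj z))"
      by (auto simp: hb v True euclid_def conj_if_def g_defs fun_eq_iff algebra_simps)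
    then have "(\<lambda>f. h \<circ> f) ` {id, gHr} = (\<lambda>f z. w * f z) ` baseF 1"
      unfolding baseF_simps by (simp only: image_insert image_empty)
    from spin_base_eq[OF this] show ?thesis using basedI[of 1, OF _ hb(1)] h(2) by simp
  next
    case False
    have "h \<circ> id = (\<lambda>z. w * (z - (1/2 + \<i>)))" "h \<circ> gHr = (\<lambda>z. w * (1/2 + \<i> - z))"
      by (auto simp: hb v False euclid_def conj_if_def g_defs fun_eq_iff algebra_simps)
    then have "(\<lambda>f. h \<circ> f) ` {id, gHr} = (\<lambda>f z. w * f z) ` baseF 0"
      unfolding baseF_simps by (simp only: image_insert image_empty)
    from spin_base_eq[OF this] show ?thesis using basedI[of 0, OF _ hb(1)] h(2) by simp
  qed
next
  assume "fan {id, gLr} (\<i>/2) S 0"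
  then obtain h where h: "plane_isometry h" "S = (\<lambda>g. tile_of (h \<circ> g)) ` {id, gLr}" "0 = h (\<i>/2)"
    by (auto simp: fan_def)
  obtain b w v where hb: "norm w = 1" "h = euclid b w v" using h(1) plane_isometry_iff by auto
  have v: "v = - (w * conj_if b (\<i>/2))" using h(3) by (simp add: hb euclid_def eq_neg_iff_add_eq_0 add.commute)
  show "based S"
  proof (cases b)
    case True
    have "h \<circ> id = (\<lambda>z. w * (cnj z + \<i>/2))" "h \<circ> gLr = (\<lambda>z. w * (- (\<i>/2) - cnj z))"
      by (auto simp: hb v True euclid_def conj_if_def g_defs fun_eq_iff algebra_simps)
    then have "(\<lambda>f. h \<circ> f) ` {id, gLr} = (\<lambda>f z. w * f z) ` baseF 3"
      unfolding baseF_simps by (simp only: image_insert image_empty)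
    from spin_base_eq[OF this] show ?thesis using basedI[of 3, OF _ hb(1)] h(2) by simp
  next
    case False
    have "h \<circ> id = (\<lambda>z. w * (z - \<i>/2))" "h \<circ> gLr = (\<lambda>z. w * (\<i>/2 - z))"
      by (auto simp: hb v False euclid_def conj_if_def g_defs fun_eq_iff algebra_simps)
    then have "(\<lambda>f. h \<circ> f) ` {id, gLr} = (\<lambda>f z. w * f z) ` baseF 2"
      unfolding baseF_simps by (simp only: image_insert image_empty)
    from spin_base_eq[OF this] show ?thesis using basedI[of 2, OF _ hb(1)] h(2) by simp
  qed
next
  assume "fan fanA 0 S 0"
  then obtain h where h: "plane_isometry h" "S = (\<lambda>g. tile_of (h \<circ> g)) ` fanA" "0 = h 0"
    by (auto simp: fan_def)
  obtain b w v where hb: "norm w = 1" "h = euclid b w v" using h(1) plane_isometry_iff by auto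
  have v: "v = 0" using h(3) by (simp add: hb euclid_def conj_if_def split: if_splits)
  show "based S"
  proof (cases b)
    case True
    have r: "cnj rA * (rA * x) = x" for x using unit_cnj[OF rA_norm] by (simp flip: mult.assoc)
    have e: "(\<lambda>f. h \<circ> f) ` fanA = (\<lambda>f z. w * cnj (f z)) ` fanA"
      by (simp add: hb v True euclid_def conj_if_def comp_def)
    have "(\<lambda>f z. w * cnj (f z)) ` fanA = (\<lambda>f z. w * (cnj rA * f z)) ` fanA"
      unfolding fanA_def image_insert image_empty r complex_cnj_mult complex_cnj_diff complex_cnj_add
        complex_cnj_minus complex_cnj_cnj complex_cnj_i complex_cnj_one complex_cnj_numeral
        minus_mult_left[symmetric] diff_minus_eq_add add_uminus_conv_diff by blast
    then have "(\<lambda>f. h \<circ> f) ` fanA = (\<lambda>f z. (w * cnj rA) * f z) ` baseF 4"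
      unfolding e baseF_simps by (simp add: mult.assoc)
    from spin_base_eq[OF this] show ?thesis
      using basedI[of 4 "w * cnj rA"] hb(1) h(2) by (simp add: norm_mult)
  next
    case False
    have "(\<lambda>f. h \<circ> f) ` fanA = (\<lambda>f z. w * f z) ` baseF 4"
      by (simp add: hb v False euclid_def conj_if_def comp_def baseF_simps)
    from spin_base_eq[OF this] show ?thesis using basedI[of 4, OF _ hb(1)] h(2) by simp
  qed
next
  assume "fan fanB 0 S 0"
  then obtain h where h: "plane_isometry h" "S = (\<lambda>g. tile_of (h \<circ> g)) ` fanB" "0 = h 0"
    by (auto simp: fan_def)
  obtain b w v where hb: "norm w = 1" "h = euclid b w v" using h(1) plane_isometry_iff by auto
  have v: "v = 0" using h(3) by (simp add: hb euclid_def conj_if_def split: if_splits)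
  have "(\<lambda>f. h \<circ> f) ` fanB = (\<lambda>f z. w * f z) ` baseF 5"
  proof (cases b)
    case True
    have e: "(\<lambda>f. h \<circ> f) ` fanB = (\<lambda>f z. w * cnj (f z)) ` fanB"
      by (simp add: hb v True euclid_def conj_if_def comp_def)
    have c: "cnj (2 - \<i> * cnj z) = 2 + \<i> * z" "cnj (- 2 + \<i> * cnj z) = - 2 - \<i> * z"
      "cnj (\<i> * (1 - cnj z)) = \<i> * (- 1 + z)" "cnj (\<i> * (- 1 + cnj z)) = \<i> * (1 - z)"
      "cnj (2 + \<i> * z) = 2 - \<i> * cnj z" "cnj (- 2 - \<i> * z) = - 2 + \<i> * cnj z"
      "cnj (\<i> * (1 - z)) = \<i> * (- 1 + cnj z)" "cnj (\<i> * (- 1 + z)) = \<i> * (1 - cnj z)" for z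
      by (simp_all add: algebra_simps)
    show ?thesis unfolding e unfolding baseF_simps fanB_def image_insert image_empty c complex_cnj_cnj
      by (rule equalityI; rule subsetI; elim insertE emptyE; hypsubst; simp only: insert_iff empty_iff simp_thms)
  next
    case False
    show ?thesis
      by (simp add: hb v False euclid_def conj_if_def comp_def baseF_simps)
  qed
  from spin_base_eq[OF this] show "based S" using basedI[of 5, OF _ hb(1)] h(2) by simp
qed

text \<open>The rhombus is symmetric as well and has to be excluded. The central star is the
  substitution of the central star of the parent tiling, which is again invariant; all symmetric
  types substitute to base stars, a rhombus to \<open>fanA\<close>, and none to a rhombus.\<close>

lemma invariant_star_based:
  assumes T: "T \<in> invariant_tilings H2" shows "based (star T 0)"
proof -
  let ?D = "decomp T"
  have om: "T \<in> pinwheel_space" using T by (simp add: invariant_iff)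
  have D: "patch ?D" using decomp_pinwheel[OF om] by (simp add: pinwheel_space_iff)
  have TD: "star T 0 = star (subst ?D) (sqrt 5 *\<^sub>R 0)" using subst_decomp[OF om] by simp
  have step: "based (star T 0)" if "based (star ?D 0)"
  proof -
    obtain j u where ju: "j < 6" "norm u = 1" "star ?D 0 = spin u (base j)"
      using \<open>based (star ?D 0)\<close> by (auto simp: based_def)
    from star_subst_base[OF D ju(2,3,1)] show ?thesis
      unfolding TD using next_base_less[OF ju(1)] ju(2)
      by (intro basedI[of "next_base j" "u * kap * turn j"]) (simp_all add: norm_mult)
  qed
  show ?thesis
    using invariant_star_symmetric[OF decomp_invariant[OF T]] unfolding symmetric_star_def
  proof (elim disjE)
    assume "fan fanM 0 (star ?D 0) 0"
    from step_fanM[OF D this] show ?thesis unfolding TD using fan_based(3) by simp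
  qed (use step fan_based in blast)+
qed

section \<open>The invariant tilings\<close>

text \<open>The fourth power of the substitution fixes each symmetric star, so the stars grow to
  tilings under iteration.\<close>

definition growth :: "tile set \<Rightarrow> tile set" where
  "growth S = (\<Union>k. (subst ^^ (4 * k)) S)"

lemma subst_pow_mono: "P \<subseteq> Q \<Longrightarrow> (subst ^^ n) P \<subseteq> (subst ^^ n) Q"
  by (induction n) (simp_all add: subst_mono)

lemma legal_subst_pow: "legal P \<Longrightarrow> legal ((subst ^^ n) P)"
  by (induction n) (simp_all add: legal_subst)

lemma based_props:
  assumes "based S"
  shows "legal S" "0 \<in> interior (\<Union>S)" "star S 0 = S" "spin (-1) S = S" "S \<subseteq> (subst ^^ 4) S"
proof -
  obtain j u where ju: "j < 6" "norm u = 1" "S = spin u (base j)" using assms by (auto simp: based_def)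
  show L: "legal S" unfolding ju(3) legal_spin[OF ju(2)] by (rule base_legal_cover[OF ju(1)])
  show "0 \<in> interior (\<Union>S)" unfolding ju(3) spin_interior[OF ju(2)] by (rule base_legal_cover[OF ju(1)])
  show st: "star S 0 = S" unfolding ju(3) star_spin[OF ju(2)] star_base[OF ju(1)] ..
  have "spin (-1) (spin u (base j)) = spin u (spin (-1) (base j))" by (simp add: spin_spin)
  then show "spin (-1) S = S" unfolding ju(3) base_neg[OF ju(1)] .
  have "star ((subst ^^ 4) S) 0 = S"
    using star_subst_base_4[OF legal_patch[OF L] ju(2) _ ju(1)] st ju(3) by simp
  then show "S \<subseteq> (subst ^^ 4) S" by (auto simp: star_def)
qed

lemma growth_incseq:
  assumes "based S" "k \<le> l" shows "(subst ^^ (4 * k)) S \<subseteq> (subst ^^ (4 * l)) S"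
proof (rule lift_Suc_mono_le[OF _ assms(2)])
  fix n
  have "(subst ^^ (4 * Suc n)) S = (subst ^^ (4 * n)) ((subst ^^ 4) S)"
    by (simp add: funpow_add[symmetric] add.commute flip: comp_apply[of "subst ^^ (4 * n)" "subst ^^ 4"])
  then show "(subst ^^ (4 * n)) S \<subseteq> (subst ^^ (4 * Suc n)) S"
    using subst_pow_mono[OF based_props(5)[OF assms(1)]] by simp
qed

lemma growth_finite_subset:
  assumes S: "based S" and P: "finite P" "P \<subseteq> growth S" shows "\<exists>k. P \<subseteq> (subst ^^ (4 * k)) S"
  using P
proof (induction P rule: finite_induct)
  case (insert x P)
  then obtain k l where "P \<subseteq> (subst ^^ (4 * k)) S" "x \<in> (subst ^^ (4 * l)) S" by (auto simp: growth_def)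
  then have "insert x P \<subseteq> (subst ^^ (4 * max k l)) S"
    using growth_incseq[OF S, of k "max k l"] growth_incseq[OF S, of l "max k l"] by auto
  then show ?case by blast
qed simp

lemma subst_pow_Union:
  assumes "patch P" shows "\<Union>((subst ^^ n) P) = (\<lambda>z. (sqrt 5 ^ n) *\<^sub>R z) ` \<Union>P"
proof (induction n)
  case (Suc n)
  have "\<Union>((subst ^^ Suc n) P) = (\<lambda>z. sqrt 5 *\<^sub>R z) ` \<Union>((subst ^^ n) P)"
    using subst_Union[OF subst_pow_patch[OF assms]] by simp
  then show ?case unfolding Suc.IH image_image by simp
qed simp

text \<open>Finite parts lie in a single stage and are legal as such. The star contains a disc about
  the origin, and its iterated dilations exhaust the plane.\<close>

lemma growth_pinwheel: assumes S: "based S" shows "growth S \<in> pinwheel_space"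
proof -
  note B = based_props[OF S]
  have fin: "legal P" if "P \<subseteq> growth S" "finite P" for P
    using growth_finite_subset[OF S that(2,1)] legal_mono[OF legal_subst_pow[OF B(1)]] by blast
  have "patch (growth S)"
  proof -
    have "is_tile t" if "t \<in> growth S" for t
      using patch_is_tile[OF legal_patch[OF fin[of "{t}"]]] that by simp
    moreover have "interior s \<inter> interior t = {}" if "s \<in> growth S" "t \<in> growth S" "s \<noteq> t" for s t
      using legal_patch[OF fin[of "{s, t}"]] that by (auto simp: patch_def pairwise_def)
    ultimately show ?thesis by (auto simp: patch_def pairwise_def)
  qed
  moreover have "z \<in> \<Union>(growth S)" for z
  proof -
    obtain e where e: "e > 0" "ball 0 e \<subseteq> \<Union>S" using B(2) by (auto simp: mem_interior)
    have "(1::real) < sqrt 5" by simp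
    then obtain n where n: "norm z / e < sqrt 5 ^ n" using real_arch_pow by blast
    have "sqrt 5 ^ n \<le> sqrt 5 ^ (4 * n)" using \<open>1 < sqrt 5\<close> by (intro power_increasing) auto
    with n have "norm z / e < sqrt 5 ^ (4 * n)" by (rule less_le_trans)
    then have "(1 / sqrt 5 ^ (4 * n)) *\<^sub>R z \<in> ball 0 e"
      using e(1) by (simp add: field_simps)
    then have "(1 / sqrt 5 ^ (4 * n)) *\<^sub>R z \<in> \<Union>S" using e(2) by blast
    then have "(sqrt 5 ^ (4 * n)) *\<^sub>R ((1 / sqrt 5 ^ (4 * n)) *\<^sub>R z) \<in> \<Union>((subst ^^ (4 * n)) S)"
      unfolding subst_pow_Union[OF legal_patch[OF B(1)]] by (rule imageI)
    then show ?thesis by (auto simp: growth_def)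
  qed
  ultimately show ?thesis using fin by (auto simp: pinwheel_space_iff)
qed

lemma star_eqI:
  assumes "patch T" "S \<subseteq> T" "0 \<in> interior (\<Union>S)" "star S 0 = S" shows "star T 0 = S"
proof
  show "S \<subseteq> star T 0" using assms(2,4) by (auto simp: star_def)
  show "star T 0 \<subseteq> S"
  proof
    fix x assume "x \<in> star T 0"
    then have "x \<in> T" "x \<inter> interior (\<Union>S) \<noteq> {}" using assms(3) by (auto simp: star_def)
    then show "x \<in> S" using patch_covering[OF assms(1,2) open_interior interior_subset] by blast
  qed
qed

lemma growth_superset: "S \<subseteq> growth S"
  unfolding growth_def using UN_upper[of 0 UNIV "\<lambda>k. (subst ^^ (4 * k)) S"] by simp

lemma star_growth: assumes "based S" shows "star (growth S) 0 = S"
proof (rule star_eqI[OF _ growth_superset based_props(2,3)[OF assms]])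
  show "patch (growth S)" using growth_pinwheel[OF assms] by (simp add: pinwheel_space_iff)
qed

lemma growth_spin: assumes "norm u = 1" "patch S" shows "growth (spin u S) = spin u (growth S)"
  unfolding growth_def subst_pow_spin[OF assms] by (auto simp: spin_def move_def)

lemma growth_invariant: assumes "based S" shows "growth S \<in> invariant_tilings H2"
proof -
  have "growth (spin (-1) S) = spin (-1) (growth S)"
    using based_props(1)[OF assms] by (intro growth_spin legal_patch) simp_all
  then show ?thesis
    unfolding invariant_iff based_props(4)[OF assms] using growth_pinwheel[OF assms] by simp
qed

lemma decomp_pow:
  assumes "T \<in> invariant_tilings H2"
  shows "(decomp ^^ n) T \<in> invariant_tilings H2 \<and> (subst ^^ n) ((decomp ^^ n) T) = T"
proof (induction n)
  case (Suc n)
  have om: "(decomp ^^ n) T \<in> pinwheel_space" using Suc by (simp add: invariant_iff)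
  have "(subst ^^ Suc n) ((decomp ^^ Suc n) T) = (subst ^^ n) (subst (decomp ((decomp ^^ n) T)))"
    by (simp add: funpow_swap1)
  then show ?case using Suc decomp_invariant subst_decomp[OF om] by simp
qed (use assms in simp)

text \<open>Four substitutions leave every base star unchanged, so the star four levels up can be
  read off from the star below.\<close>

lemma star_decomp_4:
  assumes "T \<in> invariant_tilings H2" shows "star ((decomp ^^ 4) T) 0 = star T 0"
proof -
  note D = decomp_pow[OF assms, of 4]
  have P: "patch ((decomp ^^ 4) T)" using D by (simp add: invariant_iff pinwheel_space_iff)
  obtain j u where ju: "j < 6" "norm u = 1" "star ((decomp ^^ 4) T) 0 = spin u (base j)"
    using invariant_star_based[OF conjunct1[OF D]] unfolding based_def by blast
  have "star ((subst ^^ 4) ((decomp ^^ 4) T)) 0 = spin u (base j)"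
    by (rule star_subst_base_4[OF P ju(2,3,1)])
  then show ?thesis using D ju(3) by simp
qed

lemma star_decomp_4k:
  assumes "T \<in> invariant_tilings H2" shows "star ((decomp ^^ (4 * k)) T) 0 = star T 0"
proof (induction k)
  case (Suc k)
  have "(decomp ^^ (4 * Suc k)) T = (decomp ^^ 4) ((decomp ^^ (4 * k)) T)"
    by (simp add: funpow_add)
  then show ?case using star_decomp_4[OF conjunct1[OF decomp_pow[OF assms]]] Suc by simp
qed simp

text \<open>The star occurs unchanged in all parent tilings of order \<open>4 * k\<close>, so all
  its iterates lie in the tiling; their union already fills the plane, leaving no room for other
  tiles.\<close>

lemma invariant_eq_growth:
  assumes T: "T \<in> invariant_tilings H2" shows "T = growth (star T 0)"
proof -
  have S: "based (star T 0)" by (rule invariant_star_based[OF T])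
  have "growth (star T 0) \<subseteq> T"
  proof -
    have "(subst ^^ (4 * k)) (star T 0) \<subseteq> T" for k
    proof -
      have "star T 0 \<subseteq> (decomp ^^ (4 * k)) T" using star_decomp_4k[OF T, of k] by (auto simp: star_def)
      from subst_pow_mono[OF this, of "4 * k"] show ?thesis using decomp_pow[OF T, of "4 * k"] by simp
    qed
    then show ?thesis by (auto simp: growth_def)
  qed
  then show ?thesis
    using tiling_subset_eq[of T "growth (star T 0)"] growth_pinwheel[OF S] T
    by (auto simp: invariant_iff pinwheel_space_iff)
qed

section \<open>The six families of invariant tilings\<close>

definition inv_tiling :: "nat \<Rightarrow> complex \<Rightarrow> tile set" where
  "inv_tiling j u = growth (spin u (base j))"

lemma inv_tiling_star: "j < 6 \<Longrightarrow> norm u = 1 \<Longrightarrow> star (inv_tiling j u) 0 = spin u (base j)"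
  unfolding inv_tiling_def by (rule star_growth) (rule basedI; simp)

lemma inv_tiling_invariant: "j < 6 \<Longrightarrow> norm u = 1 \<Longrightarrow> inv_tiling j u \<in> invariant_tilings H2"
  unfolding inv_tiling_def by (rule growth_invariant) (rule basedI; simp)

lemma inv_tiling_spin:
  assumes "j < 6" "norm u = 1" "norm v = 1" shows "spin v (inv_tiling j u) = inv_tiling j (v * u)"
proof -
  have "patch (spin u (base j))" by (intro patch_spin assms legal_patch base_legal_cover)
  then show ?thesis unfolding inv_tiling_def by (simp add: growth_spin[symmetric] assms spin_spin)
qed

lemma inv_tiling_uminus: assumes "j < 6" "norm u = 1" shows "inv_tiling j (- u) = inv_tiling j u"
  using inv_tiling_spin[OF assms, of "-1"] inv_tiling_invariant[OF assms] by (simp add: invariant_iff)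

lemma invariant_tilings_eq: "invariant_tilings H2 = {inv_tiling j u | j u. j < 6 \<and> norm u = 1}"
proof
  show "invariant_tilings H2 \<subseteq> {inv_tiling j u | j u. j < 6 \<and> norm u = 1}"
  proof
    fix T assume T: "T \<in> invariant_tilings H2"
    obtain j u where ju: "j < 6" "norm u = 1" "star T 0 = spin u (base j)"
      using invariant_star_based[OF T] unfolding based_def by blast
    then show "T \<in> {inv_tiling j u | j u. j < 6 \<and> norm u = 1}"
      using invariant_eq_growth[OF T] unfolding inv_tiling_def by auto
  qed
qed (auto intro: inv_tiling_invariant)

text \<open>The star at the origin recovers the index and the rotation, the latter up to the
  half-turn that fixes every base star.\<close>

lemma inv_tiling_eqD:
  assumes "inv_tiling i u = inv_tiling j v" "i < 6" "j < 6" "norm u = 1" "norm v = 1"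
  shows "i = j \<and> (u = v \<or> u = - v)"
proof -
  have "spin u (base i) = spin v (base j)"
    using inv_tiling_star[OF assms(2,4)] inv_tiling_star[OF assms(3,5)] assms(1) by simp
  then have "spin (cnj v) (spin u (base i)) = spin (cnj v) (spin v (base j))" by simp
  then have "spin (cnj v * u) (base i) = base j" by (simp add: spin_spin unit_cnj assms)
  then have "i = j \<and> (cnj v * u = 1 \<or> cnj v * u = -1)"
    using assms by (intro base_inequivalent) (simp_all add: norm_mult)
  moreover have "v * (cnj v * u) = u" using unit_cnj[OF assms(5)] by (simp add: mult.commute mult.left_commute)
  ultimately show ?thesis by (metis mult.right_neutral mult_minus_right)
qed

lemma rotation_spin: "move (rotation \<theta>) T = spin (cis \<theta>) T"
  by (simp add: spin_def rotation_def[abs_def])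

lemma card_orbits: "card (invariant_tilings H2 // rotation_related) = 6"
proof -
  define orb where "orb j = {inv_tiling j u | u. norm u = 1}" for j
  have rel: "rotation_related `` {inv_tiling j u} = orb j" if "j < 6" "norm u = 1" for j u
  proof
    show "rotation_related `` {inv_tiling j u} \<subseteq> orb j"
      using that by (auto simp: rotation_related_def rotation_spin inv_tiling_spin orb_def norm_mult)
    show "orb j \<subseteq> rotation_related `` {inv_tiling j u}"
    proof
      fix T assume "T \<in> orb j"
      then obtain v where v: "norm v = 1" "T = inv_tiling j v" by (auto simp: orb_def)
      have "norm (v * cnj u) = 1" using v that by (simp add: norm_mult)
      then obtain \<theta> where th: "v * cnj u = cis \<theta>" by (metis complex_norm_eq_1_exp cis_conv_exp)
      have e: "v * cnj u * u = v" using unit_cnj[OF that(2)] by (simp add: mult.assoc)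
      have "T = spin (cis \<theta>) (inv_tiling j u)"
        unfolding v(2) th[symmetric] inv_tiling_spin[OF that \<open>norm (v * cnj u) = 1\<close>] e ..
      then show "T \<in> rotation_related `` {inv_tiling j u}"
        by (auto simp: rotation_related_def rotation_spin)
    qed
  qed
  have "invariant_tilings H2 // rotation_related = orb ` {..<6}"
  proof -
    have "orb j \<in> invariant_tilings H2 // rotation_related" if "j < 6" for j
      using rel[OF that, of 1] quotientI[OF inv_tiling_invariant[OF that, of 1], of rotation_related] by simp
    moreover have "X \<in> orb ` {..<6}" if "X \<in> invariant_tilings H2 // rotation_related" for X
      using that rel unfolding invariant_tilings_eq by (auto elim!: quotientE)
    ultimately show ?thesis by auto
  qed
  moreover have "inj_on orb {..<6}"
  proof (rule inj_onI)
    fix i j assume ij: "i \<in> {..<6}" "j \<in> {..<6::nat}" "orb i = orb j"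
    have "inv_tiling i 1 \<in> orb i" unfolding orb_def by (intro CollectI exI[of _ 1]) simp
    then have "inv_tiling i 1 \<in> orb j" unfolding ij(3) .
    then obtain v where "norm v = 1" "inv_tiling i 1 = inv_tiling j v" by (auto simp: orb_def)
    then show "i = j" using inv_tiling_eqD[of i 1 j v] ij by simp
  qed
  ultimately show ?thesis by (simp add: card_image)
qed

section \<open>The topology of the space of invariant tilings\<close>

text \<open>\<open>csqrt\<close> selects one of two opposite rotations. Both give the same tiling by
  \<open>inv_tiling_uminus\<close>, so the jump of the root does no harm.\<close>

definition circle_map :: "nat \<times> complex \<Rightarrow> tile set" where
  "circle_map = (\<lambda>(j, z). inv_tiling j (csqrt z))"

lemma circle_map_square: assumes "j < 6" "norm u = 1" shows "circle_map (j, u\<^sup>2) = inv_tiling j u"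
proof -
  have "(csqrt (u\<^sup>2))\<^sup>2 = u\<^sup>2" by simp
  then have "csqrt (u\<^sup>2) = u \<or> csqrt (u\<^sup>2) = - u" by (simp only: power2_eq_iff)
  moreover have "circle_map (j, u\<^sup>2) = inv_tiling j (csqrt (u\<^sup>2))" by (simp only: circle_map_def prod.case)
  ultimately show ?thesis using inv_tiling_uminus[OF assms] by metis
qed

lemma unit_square: assumes "norm (z::complex) = 1" obtains u where "norm u = 1" "z = u\<^sup>2"
proof -
  have "norm (csqrt z) = 1" using assms by simp
  then show ?thesis using that[of "csqrt z"] by simp
qed

abbreviation circles :: "(nat \<times> complex) topology" where
  "circles \<equiv> sum_topology (\<lambda>_. top_of_set (sphere (0::complex) 1)) {..<6::nat}"

lemma close_spin: assumes "\<bar>\<beta>\<bar> < \<epsilon>" shows "tilings_close \<epsilon> T (spin (cis \<beta>) T)"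
proof -
  have "\<epsilon> > 0" using assms by linarith
  moreover have "move (\<lambda>z. rotation \<beta> z + 0) T = move (\<lambda>z. rotation 0 z + 0) (spin (cis \<beta>) T)"
    by (simp add: spin_def rotation_def move_def)
  ultimately show ?thesis
    unfolding tilings_close_def using assms
    by (intro exI[of _ \<beta>] exI[of _ 0]) simp
qed

text \<open>Continuity is not taken from \<open>csqrt\<close> but from the rotation action: a nearby
  point of the circle is reached by a small rotation of the tiling, and a slightly rotated tiling is
  close.\<close>

lemma circle_map_continuous: "continuous_map circles pinwheel_topology circle_map"
  unfolding continuous_map_def
proof (intro conjI allI impI)
  show "circle_map \<in> topspace circles \<rightarrow> topspace pinwheel_topology"
    using inv_tiling_invariant by (auto simp: circle_map_def invariant_iff)
  fix U assume "openin pinwheel_topology U"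
  then have U: "pinwheel_open U" by (simp add: openin_pinwheel_topology)
  show "openin circles {x \<in> topspace circles. circle_map x \<in> U}"
    unfolding openin_sum_topology
  proof (intro conjI ballI)
    fix j assume j: "j \<in> {..<6::nat}"
    have eq: "{x. (j, x) \<in> {x \<in> topspace circles. circle_map x \<in> U}} = {z \<in> sphere 0 1. circle_map (j, z) \<in> U}"
      using j by auto
    show "openin (top_of_set (sphere 0 1)) {x. (j, x) \<in> {x \<in> topspace circles. circle_map x \<in> U}}"
      unfolding eq openin_euclidean_subtopology_iff
    proof (intro conjI ballI)
      fix z assume "z \<in> {z \<in> sphere 0 1. circle_map (j, z) \<in> U}"
      then have z: "norm z = 1" "circle_map (j, z) \<in> U" by simp_all
      obtain u where u: "norm u = 1" "z = u\<^sup>2" by (rule unit_square[OF z(1)])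
      obtain e where e: "e > 0" "\<And>T'. T' \<in> pinwheel_space \<Longrightarrow> tilings_close e (circle_map (j, z)) T' \<Longrightarrow> T' \<in> U"
        using U z(2) unfolding pinwheel_open_def by blast
      have "isCont Arg 1" by (rule continuous_at_Arg) (simp add: complex_nonpos_Reals_iff)
      then obtain d where d: "d > 0" "\<And>w. dist w 1 < d \<Longrightarrow> dist (Arg w) (Arg 1) < e"
        using e(1) unfolding continuous_at_eps_delta by blast
      show "\<exists>d>0. \<forall>y\<in>sphere 0 1. dist y z < d \<longrightarrow> y \<in> {z \<in> sphere 0 1. circle_map (j, z) \<in> U}"
      proof (intro exI[of _ d] conjI ballI impI d(1))
        fix y :: complex assume y: "y \<in> sphere 0 1" "dist y z < d"
        have z0: "z \<noteq> 0" using z(1) by auto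
        have "y / z - 1 = (y - z) / z" using z0 by (simp add: diff_divide_distrib)
        then have "dist (y / z) 1 < d" using y(2) z(1) by (simp add: dist_norm norm_divide)
        then have a: "\<bar>Arg (y / z)\<bar> < e" using d(2)[of "y / z"] by (simp add: dist_real_def)
        have c: "y / z = cis (Arg (y / z))" using y(1) z(1) rcis_cmod_Arg[of "y / z"] by (simp add: rcis_def norm_divide)
        \<comment> \<open>Half of the angle, because the coordinate on the circle is the square of
          the rotation.\<close>
        define w where "w = cis (Arg (y / z) / 2)"
        have "w\<^sup>2 = cis (Arg (y / z))" unfolding w_def power2_eq_square cis_mult by simp
        then have w: "w\<^sup>2 = y / z" by (simp only: c[symmetric])
        have "norm w = 1" by (simp add: w_def)
        have "y = (w * u)\<^sup>2" using w u(2) z0 by (simp add: power_mult_distrib)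
        then have "circle_map (j, y) = spin w (circle_map (j, z))"
          using j u \<open>norm w = 1\<close> by (simp add: circle_map_square inv_tiling_spin norm_mult)
        moreover have "tilings_close e (circle_map (j, z)) (spin w (circle_map (j, z)))"
          unfolding w_def by (rule close_spin) (use a in simp)
        moreover have "circle_map (j, y) \<in> pinwheel_space"
          using j y(1) inv_tiling_invariant[of j "csqrt y"] by (simp add: circle_map_def invariant_iff)
        ultimately show "y \<in> {z \<in> sphere 0 1. circle_map (j, z) \<in> U}" using e(2) y(1) by simp
      qed
    qed auto
  qed auto
qed

text \<open>As \<open>1/100 < 1/4\<close>, the centre of a disc inside \<open>s\<close> is interior
  to both translates. In a patch they then coincide, and rigidity excludes a nonzero translation
  between them.\<close>

lemma translate_overlap:
  assumes T: "patch T" and s: "is_tile s" "(\<lambda>z. z + v) ` s \<in> T" "(\<lambda>z. z - v) ` s \<in> T" and v: "norm v < 1/100"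
  shows "v = 0"
proof -
  have iso: "plane_isometry (\<lambda>z. z + v)" "plane_isometry (\<lambda>z. z - v)"
    by (simp_all add: plane_isometry_def dist_norm)
  obtain m where m: "ball m (1/4) \<subseteq> interior s" using tile_ball[OF s(1)] by blast
  have "m - v \<in> ball m (1/4)" "m + v \<in> ball m (1/4)" using v by (simp_all add: dist_norm)
  then have "m - v \<in> interior s" "m + v \<in> interior s" using m by blast+
  then have "m \<in> interior ((\<lambda>z. z + v) ` s)" "m \<in> interior ((\<lambda>z. z - v) ` s)"
    unfolding plane_isometry_interior[OF iso(1)] plane_isometry_interior[OF iso(2)] by (force simp: image_iff)+
  then have eq: "(\<lambda>z. z + v) ` s = (\<lambda>z. z - v) ` s" by (rule patch_eqI[OF T s(2,3)])
  obtain h where h: "plane_isometry h" "s = tile_of h" using s(1) is_tile_iff by auto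
  have "(\<lambda>z. z + v) \<circ> h = (\<lambda>z. z - v) \<circ> h"
    by (intro tile_of_inj plane_isometry_comp iso h(1)) (use eq in \<open>simp add: h(2) tile_of_comp\<close>)
  then have "h 0 + v = h 0 - v" by (metis comp_apply)
  then show ?thesis by simp
qed

text \<open>The displacement \<open>v\<close> is allowed so that the set is open in the whole tiling
  space. On invariant tilings it must vanish, so there the set cuts out exactly the image of
  \<open>V\<close>.\<close>

definition small_motions :: "(nat \<times> complex) set \<Rightarrow> tile set set" where
  "small_motions V = {T \<in> pinwheel_space. \<exists>j u v. j < 6 \<and> norm u = 1 \<and> (j, u\<^sup>2) \<in> V \<and> norm v < 1/100 \<and>
     move (\<lambda>z. u * z + v) (base j) \<subseteq> T}"

lemma base_ne: "base j \<noteq> {}"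
  by (simp add: base_def baseF_def fanA_def fanB_def)

text \<open>The base star and the tiling both have the half-turn symmetry, so a tile displaced by
  \<open>v\<close> is accompanied by one displaced by \<open>- v\<close>; hence
  \<open>v = 0\<close>, and the centred star determines the tiling.\<close>

lemma small_motions_invariant:
  assumes "T \<in> invariant_tilings H2" "T \<in> small_motions V" shows "T \<in> circle_map ` V"
proof -
  have P: "patch T" and neg: "spin (-1) T = T" using assms(1) by (simp_all add: invariant_iff pinwheel_space_iff)
  obtain j u v where ju: "j < 6" "norm u = 1" "(j, u\<^sup>2) \<in> V" "norm v < 1/100"
    "move (\<lambda>z. u * z + v) (base j) \<subseteq> T" using assms(2) unfolding small_motions_def by blast
  have bneg: "spin (-1) (base j) = base j" by (rule base_neg[OF ju(1)])
  obtain t where t: "t \<in> base j" using base_ne by blast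
  define s where "s = (\<lambda>z. u * z) ` t"
  have st: "is_tile s"
    unfolding s_def using is_tile_image[OF spin_isometry[OF ju(2)] patch_is_tile[OF legal_patch[OF base_legal_cover(1)[OF ju(1)]] t]] .
  have "(\<lambda>z. u * z + v) ` t \<in> T" using ju(5) t by (auto simp: move_def)
  then have 1: "(\<lambda>z. z + v) ` s \<in> T" by (simp add: s_def image_image)
  have "(\<lambda>z. (-1) * z) ` t \<in> base j" using bneg t by (auto simp: spin_def move_def)
  then have "(\<lambda>z. u * z + v) ` (\<lambda>z. (-1) * z) ` t \<in> T" using ju(5) by (auto simp: move_def)
  then have "(\<lambda>z. (-1) * z) ` (\<lambda>z. u * z + v) ` (\<lambda>z. (-1) * z) ` t \<in> spin (-1) T" unfolding spin_def move_def by (rule imageI)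
  moreover have "(\<lambda>z. (-1) * z) ` (\<lambda>z. u * z + v) ` (\<lambda>z. (-1) * z) ` t = (\<lambda>z. z - v) ` s"
    by (simp add: s_def image_image)
  ultimately have 2: "(\<lambda>z. z - v) ` s \<in> T" using neg by simp
  have "v = 0" by (rule translate_overlap[OF P st 1 2 ju(4)])
  then have sub: "spin u (base j) \<subseteq> T" using ju(5) by (simp add: spin_def)
  have B: "based (spin u (base j))" using ju by (intro basedI) auto
  have "star T 0 = spin u (base j)"
    by (rule star_eqI[OF P sub based_props(2,3)[OF B]])
  then have "T = inv_tiling j u" using invariant_eq_growth[OF assms(1)] by (simp add: inv_tiling_def)
  then show ?thesis using circle_map_square[OF ju(1,2)] ju(3) by force
qed

lemma small_motions_open:
  assumes V: "\<And>j. j < 6 \<Longrightarrow> openin (top_of_set (sphere 0 1)) {z. (j, z) \<in> V}"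
  shows "pinwheel_open (small_motions V)"
  unfolding pinwheel_open_def
proof (intro conjI ballI)
  fix T assume "T \<in> small_motions V"
  then obtain j u v where ju: "j < 6" "norm u = 1" "(j, u\<^sup>2) \<in> V" "norm v < 1/100"
    "move (\<lambda>z. u * z + v) (base j) \<subseteq> T" unfolding small_motions_def by blast
  obtain d where d: "d > 0" "\<And>z. norm z = 1 \<Longrightarrow> dist z (u\<^sup>2) < d \<Longrightarrow> (j, z) \<in> V"
    using V[OF ju(1)] ju(3) unfolding openin_euclidean_subtopology_iff by (auto simp: sphere_def)
  \<comment> \<open>The bound 1/4 keeps the star inside the ball where the tilings agree. The bound
    \<open>d / 5\<close> controls the square of the rotation, which changes by less than
    \<open>4 * e\<close>. The last bound leaves room for the added displacement, which is below
    \<open>2 * e\<close>.\<close>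
  define e where "e = min (1/4) (min (d / 5) ((1/100 - norm v) / 3))"
  have e: "e > 0" "e \<le> 1/4" "e \<le> d / 5" using d(1) ju(4) by (auto simp: e_def)
  have e4: "e \<le> (1/100 - norm v) / 3" unfolding e_def by (intro min.coboundedI2 order_refl)
  show "\<exists>e>0. \<forall>T'\<in>pinwheel_space. tilings_close e T T' \<longrightarrow> T' \<in> small_motions V"
  proof (intro exI[of _ e] conjI ballI impI e(1))
    fix T' assume T': "T' \<in> pinwheel_space" "tilings_close e T T'"
    obtain a w b x where c: "\<bar>a\<bar> < e" "norm w < e" "\<bar>b\<bar> < e" "norm x < e" and
      eq: "tiles_meeting (ball 0 (1 / e)) (move (\<lambda>z. rotation a z + w) T) =
        tiles_meeting (ball 0 (1 / e)) (move (\<lambda>z. rotation b z + x) T')"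
      using T'(2) unfolding tilings_close_def by blast
    \<comment> \<open>\<open>u'\<close> and \<open>v'\<close> describe the first small motion,
      applied to the placed star, followed by the inverse of the second one.\<close>
    define u' where "u' = cis (a - b) * u"
    define v' where "v' = cis (a - b) * v + cis (- b) * (w - x)"
    have "t' \<in> T'" if t': "t' \<in> move (\<lambda>z. u' * z + v') (base j)" for t'
    proof -
      obtain t where t: "t \<in> base j" "t' = (\<lambda>z. u' * z + v') ` t" using t' by (auto simp: move_def)
      have z: "0 \<in> t" using star_base[OF ju(1)] t(1) by (auto simp: star_def)
      define y where "y = (\<lambda>z. rotation a z + w) ` (\<lambda>z. u * z + v) ` t"
      have "y \<in> move (\<lambda>z. rotation a z + w) T" using ju(5) t(1) by (auto simp: y_def move_def)
      moreover have "rotation a v + w \<in> y" unfolding y_def image_image using z by (intro image_eqI[of _ _ 0]) simp_all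
      moreover have "rotation a v + w \<in> ball 0 (1 / e)"
      proof -
        have "norm (rotation a v + w) \<le> norm v + norm w"
          using norm_triangle_ineq[of "rotation a v" w] by (simp add: rotation_def norm_mult)
        also have "\<dots> < 1" using ju(4) c(2) e(2) by linarith
        also have "1 \<le> 1 / e" using e(1,2) by (simp add: field_simps)
        finally show ?thesis by simp
      qed
      ultimately have "y \<in> tiles_meeting (ball 0 (1 / e)) (move (\<lambda>z. rotation a z + w) T)"
        unfolding tiles_meeting_def by blast
      then have "y \<in> move (\<lambda>z. rotation b z + x) T'" unfolding eq by (simp add: tiles_meeting_def)
      then obtain s where s: "s \<in> T'" "y = (\<lambda>z. rotation b z + x) ` s" by (auto simp: move_def)
      have r: "cis (- b) * (rotation b z + x - x) = z" for z
        by (simp add: rotation_def cis_mult flip: mult.assoc)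
      have "s = (\<lambda>z. cis (- b) * (z - x)) ` y" unfolding s(2) image_image r by simp
      also have "\<dots> = t'"
      proof -
        have "cis (- b) * (rotation a (u * z + v) + w - x) = u' * z + v'" for z
        proof -
          have "cis (a - b) = cis (- b) * cis a" by (simp add: cis_mult)
          then show ?thesis by (simp add: u'_def v'_def rotation_def algebra_simps)
        qed
        then show ?thesis unfolding y_def t(2) image_image by simp
      qed
      finally show ?thesis using s(1) by simp
    qed
    then have "move (\<lambda>z. u' * z + v') (base j) \<subseteq> T'" by blast
    moreover have "norm u' = 1" using ju(2) by (simp add: u'_def norm_mult)
    moreover have "norm v' < 1/100"
    proof -
      have "norm (w - x) \<le> norm w + norm x" by (rule norm_triangle_ineq4)
      moreover have "norm v' \<le> norm v + norm (w - x)"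
        unfolding v'_def using norm_triangle_ineq[of "cis (a - b) * v" "cis (- b) * (w - x)"] by (simp add: norm_mult)
      moreover have "3 * e \<le> 1/100 - norm v" using e4 by simp
      ultimately show ?thesis using c(2,4) ju(4) e(1) by linarith
    qed
    moreover have "(j, u'\<^sup>2) \<in> V"
    proof (rule d(2))
      show "norm (u'\<^sup>2) = 1" using \<open>norm u' = 1\<close> by (simp add: norm_power)
      have "cis (a - b) * cis (a - b) = cis (2 * (a - b))" unfolding cis_mult by simp
      then have "u'\<^sup>2 = cis (2 * (a - b)) * u\<^sup>2" by (simp add: u'_def power_mult_distrib power2_eq_square)
      then have "dist (u'\<^sup>2) (u\<^sup>2) = norm ((cis (2 * (a - b)) - 1) * u\<^sup>2)" by (simp add: dist_norm algebra_simps)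
      also have "\<dots> = norm (cis (2 * (a - b)) - 1)" using ju(2) by (simp add: norm_mult norm_power)
      also have "\<dots> = norm (exp (\<i> * complex_of_real (2 * (a - b))) - 1)" by (simp add: cis_conv_exp)
      also have "\<dots> = 2 * \<bar>sin (2 * (a - b) / 2)\<bar>" by (rule dist_exp_i_1)
      also have "\<dots> \<le> 2 * \<bar>2 * (a - b) / 2\<bar>"
        by (intro mult_left_mono abs_sin_x_le_abs_x) simp
      also have "\<dots> < d"
      proof -
        have "2 * (a - b) / 2 = a - b" by simp
        then show ?thesis using c(1,3) e(3) by linarith
      qed
      finally show "dist (u'\<^sup>2) (u\<^sup>2) < d" .
    qed
    ultimately show "T' \<in> small_motions V"
      unfolding small_motions_def using T'(1) ju(1) by blast
  qed
qed (auto simp: small_motions_def)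

text \<open>Continuity of the inverse is obtained as openness: \<open>small_motions V\<close> is
  open in the tiling space and meets the invariant tilings exactly in the image of
  \<open>V\<close>.\<close>

lemma circle_map_homeomorphic: "homeomorphic_map circles (invariant_tiling_space H2) circle_map"
proof -
  have ts: "topspace (invariant_tiling_space H2) = invariant_tilings H2"
    by (auto simp: invariant_tiling_space_def invariant_tilings_def)
  have cs: "topspace circles = {..<6} \<times> sphere 0 1" by auto
  have into: "circle_map x \<in> invariant_tilings H2" if "x \<in> topspace circles" for x
    using that inv_tiling_invariant by (auto simp: circle_map_def)
  have onto: "circle_map ` topspace circles = invariant_tilings H2"
  proof
    show "invariant_tilings H2 \<subseteq> circle_map ` topspace circles"
    proof
      fix T assume "T \<in> invariant_tilings H2"
      then obtain j u where "j < 6" "norm u = 1" "T = inv_tiling j u" unfolding invariant_tilings_eq by blast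
      then show "T \<in> circle_map ` topspace circles"
        using circle_map_square[of j u] by (intro image_eqI[of _ _ "(j, u\<^sup>2)"]) (auto simp: norm_power)
    qed
  qed (use into in blast)
  have cont: "continuous_map circles (invariant_tiling_space H2) circle_map"
    unfolding invariant_tiling_space_def continuous_map_in_subtopology
    using circle_map_continuous into by blast
  have "open_map circles (invariant_tiling_space H2) circle_map"
    unfolding open_map_def
  proof (intro allI impI)
    fix V assume V: "openin circles V"
    have Vs: "V \<subseteq> {..<6} \<times> sphere 0 1" using openin_subset[OF V] cs by simp
    have "openin pinwheel_topology (small_motions V)"
      unfolding openin_pinwheel_topology using V by (intro small_motions_open) (simp add: openin_sum_topology)
    moreover have "circle_map ` V = small_motions V \<inter> invariant_tilings H2"
    proof
      show "small_motions V \<inter> invariant_tilings H2 \<subseteq> circle_map ` V" using small_motions_invariant by blast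
      show "circle_map ` V \<subseteq> small_motions V \<inter> invariant_tilings H2"
      proof
        fix T assume "T \<in> circle_map ` V"
        then obtain j z where jz: "(j, z) \<in> V" "T = circle_map (j, z)" by auto
        then have j: "j < 6" and nz: "norm z = 1" using Vs by auto
        obtain u where u: "norm u = 1" "z = u\<^sup>2" by (rule unit_square[OF nz])
        have T: "T = inv_tiling j u" unfolding jz(2) u(2) by (rule circle_map_square[OF j u(1)])
        have "spin u (base j) \<subseteq> T" unfolding T inv_tiling_def by (rule growth_superset)
        then have "move (\<lambda>z. u * z + 0) (base j) \<subseteq> T" by (simp add: spin_def)
        moreover have inv: "T \<in> invariant_tilings H2" unfolding T by (rule inv_tiling_invariant[OF j u(1)])
        moreover have "T \<in> pinwheel_space" using inv by (simp add: invariant_iff)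
        ultimately show "T \<in> small_motions V \<inter> invariant_tilings H2"
          unfolding small_motions_def using j u jz(1)
          by (intro IntI CollectI conjI exI[of _ j] exI[of _ u] exI[of _ 0]) simp_all
      qed
    qed
    ultimately show "openin (invariant_tiling_space H2) (circle_map ` V)"
      unfolding invariant_tiling_space_def openin_subtopology by blast
  qed
  moreover have "inj_on circle_map (topspace circles)"
  proof (rule inj_onI, clarsimp)
    fix i y j z assume a: "circle_map (i, y) = circle_map (j, z)" "i < 6" "norm y = 1" "j < 6" "norm z = 1"
    then have "i = j \<and> (csqrt y = csqrt z \<or> csqrt y = - csqrt z)"
      by (intro inv_tiling_eqD) (simp_all add: circle_map_def)
    then show "i = j \<and> y = z" by (metis power2_csqrt power2_minus)
  qed
  ultimately show ?thesis
    using cont onto ts by (intro bijective_open_imp_homeomorphic_map) auto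
qed

section \<open>Cech cohomology from a complete additive invariant of cocycles\<close>

text \<open>A family \<open>\<Phi>\<close> of additive maps identifies the limit once it respects
  the transition maps, identifies exactly what the limit identifies, and is jointly onto. The class
  belonging to \<open>h\<close> is the entire fibre \<open>cl h\<close>, so no representative has to
  be chosen.\<close>

lemma direct_limit_iso:
  fixes H :: "('h, 'z) monoid_scheme"
  assumes Phi: "\<And>i x. i \<in> I \<Longrightarrow> x \<in> carrier (G i) \<Longrightarrow> \<Phi> i x \<in> carrier H"
    and mult: "\<And>i x y. i \<in> I \<Longrightarrow> x \<in> carrier (G i) \<Longrightarrow> y \<in> carrier (G i) \<Longrightarrow>
        x \<otimes>\<^bsub>G i\<^esub> y \<in> carrier (G i) \<and> \<Phi> i (x \<otimes>\<^bsub>G i\<^esub> y) = \<Phi> i x \<otimes>\<^bsub>H\<^esub> \<Phi> i y"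
    and rel: "\<And>i j x y. i \<in> I \<Longrightarrow> j \<in> I \<Longrightarrow> x \<in> carrier (G i) \<Longrightarrow> y \<in> carrier (G j) \<Longrightarrow>
        (\<exists>k\<in>I. before i k \<and> before j k \<and> f i k x = f j k y) \<longleftrightarrow> \<Phi> i x = \<Phi> j y"
    and surj: "\<And>h. h \<in> carrier H \<Longrightarrow> \<exists>i\<in>I. \<exists>x\<in>carrier (G i). \<Phi> i x = h"
    and dir: "\<And>i j. i \<in> I \<Longrightarrow> j \<in> I \<Longrightarrow> \<exists>k\<in>I. before i k \<and> before j k"
    and map: "\<And>i k x. i \<in> I \<Longrightarrow> k \<in> I \<Longrightarrow> before i k \<Longrightarrow> x \<in> carrier (G i) \<Longrightarrow>
        f i k x \<in> carrier (G k) \<and> \<Phi> k (f i k x) = \<Phi> i x"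
  shows "H \<cong> direct_limit I before G f"
proof -
  define r where "r = direct_limit_rel I before G f"
  define cl where "cl h = {(i, x). i \<in> I \<and> x \<in> carrier (G i) \<and> \<Phi> i x = h}" for h
  have r: "((i, x), (j, y)) \<in> r \<longleftrightarrow> i \<in> I \<and> j \<in> I \<and> x \<in> carrier (G i) \<and> y \<in> carrier (G j) \<and> \<Phi> i x = \<Phi> j y"
    for i x j y unfolding r_def direct_limit_rel_def using rel by blast
  have rcl: "r `` {(i, x)} = cl (\<Phi> i x)" if "i \<in> I" "x \<in> carrier (G i)" for i x
    unfolding cl_def using that r by auto
  have ne: "\<exists>i x. (i, x) \<in> cl h" if "h \<in> carrier H" for h using surj[OF that] by (auto simp: cl_def)
  have car: "carrier (direct_limit I before G f) = cl ` carrier H"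
  proof -
    have "(SIGMA i:I. carrier (G i)) // r = cl ` carrier H"
    proof
      show "(SIGMA i:I. carrier (G i)) // r \<subseteq> cl ` carrier H"
        using rcl Phi by (auto elim!: quotientE)
      show "cl ` carrier H \<subseteq> (SIGMA i:I. carrier (G i)) // r"
      proof
        fix A assume "A \<in> cl ` carrier H"
        then obtain h where h: "h \<in> carrier H" "A = cl h" by blast
        obtain i x where ix: "i \<in> I" "x \<in> carrier (G i)" "\<Phi> i x = h" using surj[OF h(1)] by blast
        have "r `` {(i, x)} \<in> (SIGMA i:I. carrier (G i)) // r" using ix by (intro quotientI) auto
        then show "A \<in> (SIGMA i:I. carrier (G i)) // r" using rcl[OF ix(1,2)] ix(3) h(2) by simp
      qed
    qed
    then show ?thesis by (simp add: direct_limit_def Let_def r_def)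
  qed
  have hom: "cl (h \<otimes>\<^bsub>H\<^esub> l) = cl h \<otimes>\<^bsub>direct_limit I before G f\<^esub> cl l" if hl: "h \<in> carrier H" "l \<in> carrier H" for h l
  proof -
    let ?S = "{(k, x \<otimes>\<^bsub>G k\<^esub> y) | k x y. (k, x) \<in> cl h \<and> (k, y) \<in> cl l}"
    have val: "i \<in> I \<and> z \<in> carrier (G i) \<and> \<Phi> i z = h \<otimes>\<^bsub>H\<^esub> l" if "(i, z) \<in> ?S" for i z
      using that mult unfolding cl_def by auto
    obtain i x where ix: "i \<in> I" "x \<in> carrier (G i)" "\<Phi> i x = h" using surj[OF hl(1)] by blast
    obtain j y where jy: "j \<in> I" "y \<in> carrier (G j)" "\<Phi> j y = l" using surj[OF hl(2)] by blast
    obtain k where k: "k \<in> I" "before i k" "before j k" using dir[OF ix(1) jy(1)] by blast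
    have "(k, f i k x) \<in> cl h" "(k, f j k y) \<in> cl l"
      using map[OF ix(1) k(1,2) ix(2)] map[OF jy(1) k(1,3) jy(2)] ix(3) jy(3) k(1) by (auto simp: cl_def)
    then have w: "(k, f i k x \<otimes>\<^bsub>G k\<^esub> f j k y) \<in> ?S" by blast
    have "r `` ?S = cl (h \<otimes>\<^bsub>H\<^esub> l)"
    proof
      show "r `` ?S \<subseteq> cl (h \<otimes>\<^bsub>H\<^esub> l)"
      proof
        fix p assume "p \<in> r `` ?S"
        then obtain q where q: "q \<in> ?S" "(q, p) \<in> r" by blast
        obtain i z where iz: "q = (i, z)" by (cases q)
        obtain j y where jy: "p = (j, y)" by (cases p)
        show "p \<in> cl (h \<otimes>\<^bsub>H\<^esub> l)" using q(2) val[OF q(1)[unfolded iz]] unfolding iz jy r cl_def by auto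
      qed
      have "cl (h \<otimes>\<^bsub>H\<^esub> l) = r `` {(k, f i k x \<otimes>\<^bsub>G k\<^esub> f j k y)}"
        using val[OF w] rcl[of k "f i k x \<otimes>\<^bsub>G k\<^esub> f j k y"] by simp
      also have "\<dots> \<subseteq> r `` ?S" by (rule Image_mono[OF order_refl]) (use w in simp)
      finally show "cl (h \<otimes>\<^bsub>H\<^esub> l) \<subseteq> r `` ?S" .
    qed
    then show ?thesis by (simp add: direct_limit_def Let_def r_def)
  qed
  have "inj_on cl (carrier H)"
  proof (rule inj_onI)
    fix h l assume h: "h \<in> carrier H" "l \<in> carrier H" "cl h = cl l"
    obtain i x where "(i, x) \<in> cl h" using ne[OF h(1)] by blast
    moreover from this have "(i, x) \<in> cl l" using h(3) by simp
    ultimately show "h = l" by (simp add: cl_def)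
  qed
  then have "cl \<in> iso H (direct_limit I before G f)"
    unfolding iso_def hom_def bij_betw_def using car hom by auto
  then show ?thesis by (auto simp: is_iso_def)
qed

section \<open>Nerve cochains, cohomology classes and refinement\<close>

lemma nerve_coboundary_add:
  "nerve_coboundary n \<U> (\<lambda>s. c s + d s) = (\<lambda>s. nerve_coboundary n \<U> c s + nerve_coboundary n \<U> d s)"
  by (auto simp: nerve_coboundary_def fun_eq_iff algebra_simps sum.distrib)

lemma nerve_coboundary_uminus:
  "nerve_coboundary n \<U> (\<lambda>s. - c s) = (\<lambda>s. - nerve_coboundary n \<U> c s)"
  by (auto simp: nerve_coboundary_def fun_eq_iff sum_negf)

lemma nerve_cocycles_add: "c \<in> nerve_cocycles n \<U> \<Longrightarrow> d \<in> nerve_cocycles n \<U> \<Longrightarrow> (\<lambda>s. c s + d s) \<in> nerve_cocycles n \<U>"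
  by (simp add: nerve_cocycles_def nerve_cochains_def nerve_coboundary_add)

lemma nerve_cocycles_uminus: "c \<in> nerve_cocycles n \<U> \<Longrightarrow> (\<lambda>s. - c s) \<in> nerve_cocycles n \<U>"
  by (simp add: nerve_cocycles_def nerve_cochains_def nerve_coboundary_uminus)

lemma nerve_coboundary_zero: "nerve_coboundary n \<U> (\<lambda>s. 0) = (\<lambda>s. 0)"
  unfolding nerve_coboundary_def mult_zero_right sum.neutral_const if_cancel ..

lemma nerve_cocycles_zero: "(\<lambda>s. 0) \<in> nerve_cocycles n \<U>"
  by (simp add: nerve_cocycles_def nerve_cochains_def nerve_coboundary_zero)

lemma nerve_coboundaries_add:
  "c \<in> nerve_coboundaries n \<U> \<Longrightarrow> d \<in> nerve_coboundaries n \<U> \<Longrightarrow> (\<lambda>s. c s + d s) \<in> nerve_coboundaries n \<U>"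
proof (cases n)
  case (Suc k)
  assume "c \<in> nerve_coboundaries n \<U>" "d \<in> nerve_coboundaries n \<U>"
  then obtain a b where ab: "a \<in> nerve_cochains k \<U>" "b \<in> nerve_cochains k \<U>"
    "c = nerve_coboundary k \<U> a" "d = nerve_coboundary k \<U> b" by (auto simp: Suc)
  have "(\<lambda>s. a s + b s) \<in> nerve_cochains k \<U>" using ab by (simp add: nerve_cochains_def)
  then show ?thesis unfolding ab Suc nerve_coboundaries.simps nerve_coboundary_add[symmetric] by (rule imageI)
qed simp

lemma nerve_coboundaries_uminus:
  "c \<in> nerve_coboundaries n \<U> \<Longrightarrow> (\<lambda>s. - c s) \<in> nerve_coboundaries n \<U>"
proof (cases n)
  case (Suc k)
  assume "c \<in> nerve_coboundaries n \<U>"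
  then obtain a where ab: "a \<in> nerve_cochains k \<U>" "c = nerve_coboundary k \<U> a" by (auto simp: Suc)
  have "(\<lambda>s. - a s) \<in> nerve_cochains k \<U>" using ab by (simp add: nerve_cochains_def)
  then show ?thesis unfolding ab Suc nerve_coboundaries.simps nerve_coboundary_uminus[symmetric] by (rule imageI)
qed simp

lemma nerve_coboundaries_zero: "(\<lambda>s. 0) \<in> nerve_coboundaries n \<U>"
proof (cases n)
  case (Suc k)
  have "(\<lambda>s. 0) = nerve_coboundary k \<U> (\<lambda>s. 0)" by (simp add: nerve_coboundary_zero)
  moreover have "(\<lambda>s. 0) \<in> nerve_cochains k \<U>" by (simp add: nerve_cochains_def)
  ultimately show ?thesis unfolding Suc nerve_coboundaries.simps by (rule image_eqI)
qed simp

lemma nerve_cocycle_group: "comm_group (nerve_cocycle_group n \<U>)"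
proof (rule comm_groupI)
  fix x assume "x \<in> carrier (nerve_cocycle_group n \<U>)"
  then show "\<exists>y\<in>carrier (nerve_cocycle_group n \<U>). y \<otimes>\<^bsub>nerve_cocycle_group n \<U>\<^esub> x = \<one>\<^bsub>nerve_cocycle_group n \<U>\<^esub>"
    using nerve_cocycles_uminus[of x n \<U>] by (intro bexI[of _ "\<lambda>s. - x s"]) (simp_all add: nerve_cocycle_group_def)
qed (simp_all add: nerve_cocycle_group_def nerve_cocycles_add nerve_cocycles_zero add_ac)

definition cocycle_class :: "nat \<Rightarrow> 'a set set \<Rightarrow> ('a set list \<Rightarrow> int) \<Rightarrow> ('a set list \<Rightarrow> int) set" where
  "cocycle_class n \<U> c = nerve_coboundaries n \<U> #>\<^bsub>nerve_cocycle_group n \<U>\<^esub> c"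

lemma cocycle_class_mem: "d \<in> cocycle_class n \<U> c \<longleftrightarrow> (\<lambda>s. d s - c s) \<in> nerve_coboundaries n \<U>"
proof -
  have "d \<in> cocycle_class n \<U> c \<longleftrightarrow> (\<exists>b\<in>nerve_coboundaries n \<U>. d = (\<lambda>s. b s + c s))"
    by (auto simp: cocycle_class_def r_coset_def nerve_cocycle_group_def)
  also have "\<dots> \<longleftrightarrow> (\<lambda>s. d s - c s) \<in> nerve_coboundaries n \<U>"
  proof
    assume "(\<lambda>s. d s - c s) \<in> nerve_coboundaries n \<U>"
    then show "\<exists>b\<in>nerve_coboundaries n \<U>. d = (\<lambda>s. b s + c s)" by (intro bexI[of _ "\<lambda>s. d s - c s"]) auto
  qed auto
  finally show ?thesis .
qed

lemma cocycle_class_eq: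
  assumes "(\<lambda>s. c s - d s) \<in> nerve_coboundaries n \<U>" shows "cocycle_class n \<U> c = cocycle_class n \<U> d"
proof -
  have "(\<lambda>s. x s - c s) \<in> nerve_coboundaries n \<U> \<longleftrightarrow> (\<lambda>s. x s - d s) \<in> nerve_coboundaries n \<U>" for x
    using nerve_coboundaries_add[OF assms, of "\<lambda>s. x s - c s"]
      nerve_coboundaries_add[OF nerve_coboundaries_uminus[OF assms], of "\<lambda>s. x s - d s"] by auto
  then show ?thesis by (auto simp: cocycle_class_mem)
qed

lemma nerve_cohomology_carrier:
  "carrier (nerve_cohomology n \<U>) = cocycle_class n \<U> ` nerve_cocycles n \<U>"
  by (auto simp: nerve_cohomology_def FactGroup_def RCOSETS_def cocycle_class_def nerve_cocycle_group_def)

lemma cocycle_class_mult: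
  assumes sub: "nerve_coboundaries n \<U> \<subseteq> nerve_cocycles n \<U>"
    and "c \<in> nerve_cocycles n \<U>" "d \<in> nerve_cocycles n \<U>"
  shows "cocycle_class n \<U> c \<otimes>\<^bsub>nerve_cohomology n \<U>\<^esub> cocycle_class n \<U> d = cocycle_class n \<U> (\<lambda>s. c s + d s)"
proof -
  let ?Z = "nerve_cocycle_group n \<U>"
  interpret comm_group ?Z by (rule nerve_cocycle_group)
  have "subgroup (nerve_coboundaries n \<U>) ?Z"
  proof (rule subgroupI)
    show "nerve_coboundaries n \<U> \<subseteq> carrier ?Z" using sub by (simp add: nerve_cocycle_group_def)
    show "nerve_coboundaries n \<U> \<noteq> {}" using nerve_coboundaries_zero by blast
    fix a assume a: "a \<in> nerve_coboundaries n \<U>"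
    have "inv\<^bsub>?Z\<^esub> a = (\<lambda>s. - a s)"
      using a sub nerve_cocycles_uminus[of a n \<U>] by (intro inv_equality) (auto simp: nerve_cocycle_group_def)
    then show "inv\<^bsub>?Z\<^esub> a \<in> nerve_coboundaries n \<U>" using nerve_coboundaries_uminus[OF a] by simp
    fix b assume "b \<in> nerve_coboundaries n \<U>"
    then show "a \<otimes>\<^bsub>?Z\<^esub> b \<in> nerve_coboundaries n \<U>"
      using nerve_coboundaries_add[OF a] by (simp add: nerve_cocycle_group_def)
  qed
  then have "normal (nerve_coboundaries n \<U>) ?Z" by (rule normal_iff_subgroup[THEN iffD2])
  from normal.rcos_sum[OF this, of c d] show ?thesis
    using assms by (simp add: nerve_cohomology_def FactGroup_def cocycle_class_def nerve_cocycle_group_def)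
qed

lemma nerve_pullback_diff:
  "nerve_pullback n \<V> p (\<lambda>s. c s - d s) = (\<lambda>s. nerve_pullback n \<V> p c s - nerve_pullback n \<V> p d s)"
  by (auto simp: nerve_pullback_def)

lemma map_projection_simplex:
  assumes "p \<in> refinement_projections \<U> \<V>" "s \<in> nerve_simplices n \<V>" shows "map p s \<in> nerve_simplices n \<U>"
proof -
  have s: "length s = Suc n" "set s \<subseteq> \<V>" "\<Inter>(set s) \<noteq> {}" using assms(2) by (auto simp: nerve_simplices_def)
  have "p V \<in> \<U> \<and> V \<subseteq> p V" if "V \<in> set s" for V
    using assms(1) s(2) that by (auto simp: refinement_projections_def)
  then have "set (map p s) \<subseteq> \<U>" "\<Inter>(set s) \<subseteq> \<Inter>(set (map p s))" by auto
  then show ?thesis using s by (auto simp: nerve_simplices_def)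
qed

lemma nerve_pullback_comp:
  assumes "r \<in> refinement_projections \<V> \<W>"
  shows "nerve_pullback n \<W> r (nerve_pullback n \<V> p c) = nerve_pullback n \<W> (p \<circ> r) c"
  using map_projection_simplex[OF assms] by (auto simp: nerve_pullback_def fun_eq_iff)

lemma refinement_projections_comp:
  "p \<in> refinement_projections \<U> \<V> \<Longrightarrow> r \<in> refinement_projections \<V> \<W> \<Longrightarrow> p \<circ> r \<in> refinement_projections \<U> \<W>"
  by (force simp: refinement_projections_def)

lemma refined_by_iff: "refined_by \<U> \<V> \<longleftrightarrow> refinement_projections \<U> \<V> \<noteq> {}"
proof
  assume "refined_by \<U> \<V>"
  then have "\<forall>V\<in>\<V>. \<exists>U. U \<in> \<U> \<and> V \<subseteq> U" unfolding refined_by_def by blast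
  then obtain p where "\<forall>V\<in>\<V>. p V \<in> \<U> \<and> V \<subseteq> p V" by metis
  then show "refinement_projections \<U> \<V> \<noteq> {}" unfolding refinement_projections_def by blast
qed (auto simp: refinement_projections_def refined_by_def)

lemma common_refinement:
  assumes "\<U> \<in> open_covers X" "\<V> \<in> open_covers X"
  shows "\<exists>\<W>\<in>open_covers X. refined_by \<U> \<W> \<and> refined_by \<V> \<W>"
proof
  let ?W = "{U \<inter> V | U V. U \<in> \<U> \<and> V \<in> \<V>}"
  show "?W \<in> open_covers X"
  proof -
    have "\<Union>?W = \<Union>\<U> \<inter> \<Union>\<V>" by blast
    then show ?thesis using assms unfolding open_covers_def by auto
  qed
  show "refined_by \<U> ?W \<and> refined_by \<V> ?W" unfolding refined_by_def by blast
qed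

text \<open>Here \<open>v\<close> attaches integers to cocycles rather than classes, which keeps
  quotients out of its applications. \<open>inj\<close> asks that a cocycle of value zero become
  trivial on some finer cover, which is what vanishing in the limit means.\<close>

theorem cech_iso:
  fixes v :: "'a set set \<Rightarrow> ('a set list \<Rightarrow> int) \<Rightarrow> nat \<Rightarrow> int"
  assumes sub: "\<And>\<U>. \<U> \<in> open_covers X \<Longrightarrow> nerve_coboundaries n \<U> \<subseteq> nerve_cocycles n \<U>"
    and pull: "\<And>\<U> \<V> p c. \<U> \<in> open_covers X \<Longrightarrow> \<V> \<in> open_covers X \<Longrightarrow> p \<in> refinement_projections \<U> \<V> \<Longrightarrow>
      c \<in> nerve_cocycles n \<U> \<Longrightarrow> nerve_pullback n \<V> p c \<in> nerve_cocycles n \<V> \<and>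
        (\<forall>j<m. v \<V> (nerve_pullback n \<V> p c) j = v \<U> c j)"
    and bnd: "\<And>\<U> \<V> p c. \<U> \<in> open_covers X \<Longrightarrow> \<V> \<in> open_covers X \<Longrightarrow> p \<in> refinement_projections \<U> \<V> \<Longrightarrow>
      c \<in> nerve_coboundaries n \<U> \<Longrightarrow> nerve_pullback n \<V> p c \<in> nerve_coboundaries n \<V>"
    and diff: "\<And>\<U> \<V> p q c. \<U> \<in> open_covers X \<Longrightarrow> \<V> \<in> open_covers X \<Longrightarrow> p \<in> refinement_projections \<U> \<V> \<Longrightarrow>
      q \<in> refinement_projections \<U> \<V> \<Longrightarrow> c \<in> nerve_cocycles n \<U> \<Longrightarrow>
      (\<lambda>s. nerve_pullback n \<V> p c s - nerve_pullback n \<V> q c s) \<in> nerve_coboundaries n \<V>"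
    and add: "\<And>\<U> c d j. \<U> \<in> open_covers X \<Longrightarrow> c \<in> nerve_cocycles n \<U> \<Longrightarrow> d \<in> nerve_cocycles n \<U> \<Longrightarrow> j < m \<Longrightarrow>
      v \<U> (\<lambda>s. c s + d s) j = v \<U> c j + v \<U> d j"
    and zero: "\<And>\<U> c j. \<U> \<in> open_covers X \<Longrightarrow> c \<in> nerve_coboundaries n \<U> \<Longrightarrow> j < m \<Longrightarrow> v \<U> c j = 0"
    and inj: "\<And>\<U> c. \<U> \<in> open_covers X \<Longrightarrow> c \<in> nerve_cocycles n \<U> \<Longrightarrow> \<forall>j<m. v \<U> c j = 0 \<Longrightarrow>
      \<exists>\<V>\<in>open_covers X. \<exists>p\<in>refinement_projections \<U> \<V>. nerve_pullback n \<V> p c \<in> nerve_coboundaries n \<V>"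
    and surj: "\<And>k. \<exists>\<U>\<in>open_covers X. \<exists>c\<in>nerve_cocycles n \<U>. \<forall>j<m. v \<U> c j = k j"
  shows "product_group {..<m} (\<lambda>_. integer_group) \<cong> cech_cohomology n X"
proof -
  \<comment> \<open>The chosen representative is harmless: the fact \<open>\<Phi>\<close> below
    evaluates the class of any cocycle \<open>c\<close> by the values of \<open>c\<close>.\<close>
  define \<Phi> where "\<Phi> \<U> A = (\<lambda>j\<in>{..<m}. v \<U> (SOME c. c \<in> A) j)" for \<U> and A :: "('a set list \<Rightarrow> int) set"
  have self: "c \<in> cocycle_class n \<U> c" for \<U> :: "'a set set" and c
    using nerve_coboundaries_zero by (simp add: cocycle_class_mem)
  have \<Phi>: "\<Phi> \<U> (cocycle_class n \<U> c) = (\<lambda>j\<in>{..<m}. v \<U> c j)" if U: "\<U> \<in> open_covers X" and c: "c \<in> nerve_cocycles n \<U>" for \<U> c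
  proof -
    define d where "d = (SOME c'. c' \<in> cocycle_class n \<U> c)"
    have "d \<in> cocycle_class n \<U> c" unfolding d_def by (rule someI[where x = c]) (rule self)
    then have b: "(\<lambda>s. d s - c s) \<in> nerve_coboundaries n \<U>" by (simp add: cocycle_class_mem)
    have "v \<U> d j = v \<U> c j" if "j < m" for j
      using add[OF U subsetD[OF sub[OF U] b] c that] zero[OF U b that] by simp
    then show ?thesis by (auto simp: \<Phi>_def d_def)
  qed
  have map: "refinement_map n \<U> \<V> (cocycle_class n \<U> c) = cocycle_class n \<V> (nerve_pullback n \<V> p c)"
    if U: "\<U> \<in> open_covers X" and V: "\<V> \<in> open_covers X" and p: "p \<in> refinement_projections \<U> \<V>"
      and c: "c \<in> nerve_cocycles n \<U>" for \<U> \<V> p c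
  proof -
    have "cocycle_class n \<V> (nerve_pullback n \<V> q d) = cocycle_class n \<V> (nerve_pullback n \<V> p c)"
      if q: "q \<in> refinement_projections \<U> \<V>" and d: "d \<in> cocycle_class n \<U> c" for q d
    proof -
      have "cocycle_class n \<V> (nerve_pullback n \<V> q d) = cocycle_class n \<V> (nerve_pullback n \<V> q c)"
        using bnd[OF U V q d[unfolded cocycle_class_mem]]
        by (intro cocycle_class_eq) (simp add: nerve_pullback_diff)
      also have "\<dots> = cocycle_class n \<V> (nerve_pullback n \<V> p c)"
        by (rule cocycle_class_eq[OF diff[OF U V q p c]])
      finally show ?thesis .
    qed
    note const = this
    have "cocycle_class n \<U> c \<noteq> {}" using self by blast
    then have "(\<Union>d\<in>cocycle_class n \<U> c. cocycle_class n \<V> (nerve_pullback n \<V> q d)) =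
      cocycle_class n \<V> (nerve_pullback n \<V> p c)" if "q \<in> refinement_projections \<U> \<V>" for q
      by (rule SUP_eq_const) (rule const[OF that])
    moreover have "refinement_projections \<U> \<V> \<noteq> {}" using p by blast
    ultimately show ?thesis
      unfolding refinement_map_def cocycle_class_def[symmetric] by (rule SUP_eq_const[rotated])
  qed
  show ?thesis
    unfolding cech_cohomology_def
  proof (rule direct_limit_iso[where \<Phi> = \<Phi>])
    fix \<U> A assume "\<U> \<in> open_covers X" "A \<in> carrier (nerve_cohomology n \<U>)"
    then show "\<Phi> \<U> A \<in> carrier (product_group {..<m} (\<lambda>_. integer_group))"
      by (simp add: \<Phi>_def)
  next
    fix \<U> A B assume U: "\<U> \<in> open_covers X" and AB: "A \<in> carrier (nerve_cohomology n \<U>)" "B \<in> carrier (nerve_cohomology n \<U>)"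
    obtain c d where c: "c \<in> nerve_cocycles n \<U>" "A = cocycle_class n \<U> c"
      and d: "d \<in> nerve_cocycles n \<U>" "B = cocycle_class n \<U> d" using AB by (auto simp: nerve_cohomology_carrier)
    show "A \<otimes>\<^bsub>nerve_cohomology n \<U>\<^esub> B \<in> carrier (nerve_cohomology n \<U>) \<and>
      \<Phi> \<U> (A \<otimes>\<^bsub>nerve_cohomology n \<U>\<^esub> B) = \<Phi> \<U> A \<otimes>\<^bsub>product_group {..<m} (\<lambda>_. integer_group)\<^esub> \<Phi> \<U> B"
      unfolding c(2) d(2) cocycle_class_mult[OF sub[OF U] c(1) d(1)] nerve_cohomology_carrier
      using nerve_cocycles_add[OF c(1) d(1)] add[OF U c(1) d(1)]
      by (auto simp: \<Phi>[OF U] c d)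
  next
    fix \<U> \<V> A B assume U: "\<U> \<in> open_covers X" and V: "\<V> \<in> open_covers X"
      and A: "A \<in> carrier (nerve_cohomology n \<U>)" and B: "B \<in> carrier (nerve_cohomology n \<V>)"
    obtain c where c: "c \<in> nerve_cocycles n \<U>" "A = cocycle_class n \<U> c" using A by (auto simp: nerve_cohomology_carrier)
    obtain d where d: "d \<in> nerve_cocycles n \<V>" "B = cocycle_class n \<V> d" using B by (auto simp: nerve_cohomology_carrier)
    show "(\<exists>\<W>\<in>open_covers X. refined_by \<U> \<W> \<and> refined_by \<V> \<W> \<and> refinement_map n \<U> \<W> A = refinement_map n \<V> \<W> B)
      \<longleftrightarrow> \<Phi> \<U> A = \<Phi> \<V> B"
    proof
      assume "\<exists>\<W>\<in>open_covers X. refined_by \<U> \<W> \<and> refined_by \<V> \<W> \<and> refinement_map n \<U> \<W> A = refinement_map n \<V> \<W> B"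
      then obtain \<W> p q where W: "\<W> \<in> open_covers X" "p \<in> refinement_projections \<U> \<W>" "q \<in> refinement_projections \<V> \<W>"
        "refinement_map n \<U> \<W> A = refinement_map n \<V> \<W> B" unfolding refined_by_iff by blast
      have eq: "cocycle_class n \<W> (nerve_pullback n \<W> p c) = cocycle_class n \<W> (nerve_pullback n \<W> q d)"
        using W(4) unfolding c(2) d(2) map[OF U W(1,2) c(1)] map[OF V W(1,3) d(1)] .
      have "\<Phi> \<W> (cocycle_class n \<W> (nerve_pullback n \<W> p c)) = \<Phi> \<U> A"
        using pull[OF U W(1,2) c(1)] by (auto simp: \<Phi>[OF W(1)] \<Phi>[OF U c(1)] c(2))
      moreover have "\<Phi> \<W> (cocycle_class n \<W> (nerve_pullback n \<W> q d)) = \<Phi> \<V> B"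
        using pull[OF V W(1,3) d(1)] by (auto simp: \<Phi>[OF W(1)] \<Phi>[OF V d(1)] d(2))
      ultimately show "\<Phi> \<U> A = \<Phi> \<V> B" using eq by simp
    next
      assume "\<Phi> \<U> A = \<Phi> \<V> B"
      then have "(\<lambda>j\<in>{..<m}. v \<U> c j) = (\<lambda>j\<in>{..<m}. v \<V> d j)" by (simp add: c(2) d(2) \<Phi>[OF U c(1)] \<Phi>[OF V d(1)])
      then have veq: "v \<U> c j = v \<V> d j" if "j < m" for j using that by (metis lessThan_iff restrict_apply')
      obtain \<W> where W: "\<W> \<in> open_covers X" "refined_by \<U> \<W>" "refined_by \<V> \<W>" using common_refinement[OF U V] by blast
      obtain p q where p: "p \<in> refinement_projections \<U> \<W>" and q: "q \<in> refinement_projections \<V> \<W>"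
        using W(2,3) unfolding refined_by_iff by blast
      let ?c = "nerve_pullback n \<W> p c" and ?d = "nerve_pullback n \<W> q d"
      note pc = pull[OF U W(1) p c(1)] and qd = pull[OF V W(1) q d(1)]
      \<comment> \<open>On a common refinement the difference of the two cocycles has value zero, so
        it becomes a coboundary on a finer cover \<open>\<Y>\<close>, where the two classes
        agree.\<close>
      define e where "e = (\<lambda>s. ?c s + - ?d s)"
      have md: "(\<lambda>s. - ?d s) \<in> nerve_cocycles n \<W>" using qd nerve_cocycles_uminus by blast
      have e: "e \<in> nerve_cocycles n \<W>" unfolding e_def using pc md nerve_cocycles_add by blast
      have "v \<W> e j = 0" if j: "j < m" for j
      proof -
        have "v \<W> e j + v \<W> ?d j = v \<W> (\<lambda>s. e s + ?d s) j" using add[OF W(1) e _ j] qd by simp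
        also have "(\<lambda>s. e s + ?d s) = ?c" by (simp add: e_def)
        finally show ?thesis using pc qd veq[OF j] j by simp
      qed
      then obtain \<Y> r where Y: "\<Y> \<in> open_covers X" "r \<in> refinement_projections \<W> \<Y>"
        "nerve_pullback n \<Y> r e \<in> nerve_coboundaries n \<Y>" using inj[OF W(1) e] by blast
      have pr: "p \<circ> r \<in> refinement_projections \<U> \<Y>" "q \<circ> r \<in> refinement_projections \<V> \<Y>"
        using refinement_projections_comp Y(2) p q by blast+
      have "nerve_pullback n \<Y> r e = (\<lambda>s. nerve_pullback n \<Y> (p \<circ> r) c s - nerve_pullback n \<Y> (q \<circ> r) d s)"
        unfolding nerve_pullback_comp[OF Y(2), symmetric] e_def by (auto simp: nerve_pullback_def)
      then have "cocycle_class n \<Y> (nerve_pullback n \<Y> (p \<circ> r) c) = cocycle_class n \<Y> (nerve_pullback n \<Y> (q \<circ> r) d)"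
        using Y(3) by (intro cocycle_class_eq) simp
      then have "refinement_map n \<U> \<Y> A = refinement_map n \<V> \<Y> B"
        unfolding c(2) d(2) map[OF U Y(1) pr(1) c(1)] map[OF V Y(1) pr(2) d(1)] .
      then show "\<exists>\<W>\<in>open_covers X. refined_by \<U> \<W> \<and> refined_by \<V> \<W> \<and> refinement_map n \<U> \<W> A = refinement_map n \<V> \<W> B"
        using Y(1) pr unfolding refined_by_iff by blast
    qed
  next
    fix h assume h: "h \<in> carrier (product_group {..<m} (\<lambda>_. integer_group))"
    obtain \<U> c where U: "\<U> \<in> open_covers X" "c \<in> nerve_cocycles n \<U>" "\<forall>j<m. v \<U> c j = h j" using surj[of h] by blast
    have "\<Phi> \<U> (cocycle_class n \<U> c) = h"
      unfolding \<Phi>[OF U(1,2)]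
    proof
      fix j
      have "h \<in> {..<m} \<rightarrow>\<^sub>E UNIV" using h by simp
      then show "(\<lambda>j\<in>{..<m}. v \<U> c j) j = h j" using U(3) PiE_arb[of h "{..<m}" _ j] by (cases "j < m") auto
    qed
    then show "\<exists>\<U>\<in>open_covers X. \<exists>A\<in>carrier (nerve_cohomology n \<U>). \<Phi> \<U> A = h"
      using U(2) unfolding nerve_cohomology_carrier by (intro bexI[OF _ U(1)] bexI) auto
  next
    fix \<U> \<V> assume "\<U> \<in> open_covers X" "\<V> \<in> open_covers X"
    then show "\<exists>\<W>\<in>open_covers X. refined_by \<U> \<W> \<and> refined_by \<V> \<W>" by (rule common_refinement)
  next
    fix \<U> \<V> A assume U: "\<U> \<in> open_covers X" and V: "\<V> \<in> open_covers X" and r: "refined_by \<U> \<V>"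
      and A: "A \<in> carrier (nerve_cohomology n \<U>)"
    obtain c where c: "c \<in> nerve_cocycles n \<U>" "A = cocycle_class n \<U> c" using A by (auto simp: nerve_cohomology_carrier)
    obtain p where p: "p \<in> refinement_projections \<U> \<V>" using r unfolding refined_by_iff by blast
    note pc = pull[OF U V p c(1)]
    show "refinement_map n \<U> \<V> A \<in> carrier (nerve_cohomology n \<V>) \<and> \<Phi> \<V> (refinement_map n \<U> \<V> A) = \<Phi> \<U> A"
      unfolding c(2) map[OF U V p c(1)] nerve_cohomology_carrier using pc
      by (auto simp: \<Phi>[OF V] \<Phi>[OF U c(1)])
  qed
qed

section \<open>Cocycles in degrees zero and one\<close>

lemma simplices_0: "s \<in> nerve_simplices 0 \<U> \<longleftrightarrow> (\<exists>U\<in>\<U>. s = [U] \<and> U \<noteq> {})"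
  by (auto simp: nerve_simplices_def length_Suc_conv)

lemma simplices_1: "s \<in> nerve_simplices 1 \<U> \<longleftrightarrow> (\<exists>U\<in>\<U>. \<exists>V\<in>\<U>. s = [U, V] \<and> U \<inter> V \<noteq> {})"
  by (auto simp: nerve_simplices_def length_Suc_conv)

lemma simplices_2: "s \<in> nerve_simplices 2 \<U> \<longleftrightarrow> (\<exists>U\<in>\<U>. \<exists>V\<in>\<U>. \<exists>W\<in>\<U>. s = [U, V, W] \<and> U \<inter> V \<inter> W \<noteq> {})"
  by (auto simp: nerve_simplices_def length_Suc_conv numeral_2_eq_2 Int_assoc)

lemma coboundary_0: "U \<in> \<U> \<Longrightarrow> V \<in> \<U> \<Longrightarrow> x \<in> U \<Longrightarrow> x \<in> V \<Longrightarrow> nerve_coboundary 0 \<U> c [U, V] = c [V] - c [U]"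
  by (auto simp: nerve_coboundary_def omit_def nerve_simplices_def)

lemma coboundary_1:
  "U \<in> \<U> \<Longrightarrow> V \<in> \<U> \<Longrightarrow> W \<in> \<U> \<Longrightarrow> x \<in> U \<Longrightarrow> x \<in> V \<Longrightarrow> x \<in> W \<Longrightarrow>
    nerve_coboundary 1 \<U> c [U, V, W] = c [V, W] - c [U, W] + c [U, V]"
  by (auto simp: nerve_coboundary_def omit_def nerve_simplices_def)

lemma cocycle_0D: "c \<in> nerve_cocycles 0 \<U> \<Longrightarrow> U \<in> \<U> \<Longrightarrow> V \<in> \<U> \<Longrightarrow> x \<in> U \<Longrightarrow> x \<in> V \<Longrightarrow> c [U] = c [V]"
  using coboundary_0[of U \<U> V x c] by (simp add: nerve_cocycles_def)

lemma cocycle_1D: "c \<in> nerve_cocycles 1 \<U> \<Longrightarrow> U \<in> \<U> \<Longrightarrow> V \<in> \<U> \<Longrightarrow> W \<in> \<U> \<Longrightarrow> x \<in> U \<Longrightarrow> x \<in> V \<Longrightarrow> x \<in> W \<Longrightarrow>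
    c [V, W] - c [U, W] + c [U, V] = 0"
  using coboundary_1[of U \<U> V W x c] by (simp add: nerve_cocycles_def)

lemma nerve_coboundary_cochain: "nerve_coboundary n \<U> a \<in> nerve_cochains (Suc n) \<U>"
  by (simp add: nerve_coboundary_def nerve_cochains_def)

lemma coboundaries_1_subset: "nerve_coboundaries 1 \<U> \<subseteq> nerve_cocycles 1 \<U>"
proof
  fix c assume "c \<in> nerve_coboundaries 1 \<U>"
  then obtain a where a: "c = nerve_coboundary 0 \<U> a" by auto
  have "nerve_coboundary 1 \<U> c s = 0" for s
  proof (cases "s \<in> nerve_simplices 2 \<U>")
    case True
    then obtain U V W x where s: "s = [U, V, W]" "U \<in> \<U>" "V \<in> \<U>" "W \<in> \<U>" "x \<in> U" "x \<in> V" "x \<in> W"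
      unfolding simplices_2 by blast
    show ?thesis unfolding s(1) coboundary_1[OF s(2-)] unfolding a coboundary_0[OF s(3,4,6,7)] coboundary_0[OF s(2,4,5,7)] coboundary_0[OF s(2,3,5,6)] by simp
  qed (simp add: nerve_coboundary_def numeral_2_eq_2)
  then show "c \<in> nerve_cocycles 1 \<U>"
    using nerve_coboundary_cochain[of 0 \<U> a] by (auto simp: nerve_cocycles_def a)
qed

lemma omit_simplex: "s \<in> nerve_simplices (Suc n) \<U> \<Longrightarrow> i \<le> Suc n \<Longrightarrow> omit i s \<in> nerve_simplices n \<U>"
proof -
  assume s: "s \<in> nerve_simplices (Suc n) \<U>" and i: "i \<le> Suc n"
  have sub: "set (omit i s) \<subseteq> set s" by (auto simp: omit_def dest: in_set_takeD in_set_dropD)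
  moreover have "length (omit i s) = Suc n" using s i by (auto simp: omit_def nerve_simplices_def)
  ultimately show ?thesis using s Inter_anti_mono[OF sub] by (auto simp: nerve_simplices_def)
qed

lemma nerve_coboundary_pullback:
  assumes "p \<in> refinement_projections \<U> \<V>"
  shows "nerve_coboundary n \<V> (nerve_pullback n \<V> p a) = nerve_pullback (Suc n) \<V> p (nerve_coboundary n \<U> a)"
proof
  fix s
  show "nerve_coboundary n \<V> (nerve_pullback n \<V> p a) s = nerve_pullback (Suc n) \<V> p (nerve_coboundary n \<U> a) s"
  proof (cases "s \<in> nerve_simplices (Suc n) \<V>")
    case True
    have "nerve_pullback n \<V> p a (omit i s) = a (omit i (map p s))" if "i \<in> {..Suc n}" for i
      using omit_simplex[OF True] that by (simp add: nerve_pullback_def omit_def take_map drop_map)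
    then show ?thesis
      using True map_projection_simplex[OF assms True] by (simp add: nerve_coboundary_def nerve_pullback_def)
  qed (simp add: nerve_coboundary_def nerve_pullback_def)
qed

lemma nerve_pullback_cochain: "nerve_pullback n \<V> p c \<in> nerve_cochains n \<V>"
  by (simp add: nerve_cochains_def nerve_pullback_def)

lemma nerve_pullback_cocycle:
  assumes "p \<in> refinement_projections \<U> \<V>" "c \<in> nerve_cocycles n \<U>"
  shows "nerve_pullback n \<V> p c \<in> nerve_cocycles n \<V>"
proof -
  have "nerve_coboundary n \<V> (nerve_pullback n \<V> p c) = (\<lambda>s. 0)"
    unfolding nerve_coboundary_pullback[OF assms(1)] using assms(2)
    by (simp add: nerve_cocycles_def nerve_pullback_def)
  then show ?thesis using nerve_pullback_cochain by (simp add: nerve_cocycles_def)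
qed

lemma nerve_pullback_coboundary:
  assumes "p \<in> refinement_projections \<U> \<V>" "c \<in> nerve_coboundaries n \<U>"
  shows "nerve_pullback n \<V> p c \<in> nerve_coboundaries n \<V>"
proof (cases n)
  case 0
  then show ?thesis using assms(2) by (auto simp: nerve_pullback_def)
next
  case (Suc k)
  obtain a where a: "c = nerve_coboundary k \<U> a" using assms(2) by (auto simp: Suc)
  show ?thesis unfolding a Suc nerve_coboundaries.simps nerve_coboundary_pullback[OF assms(1), symmetric]
    by (rule imageI) (rule nerve_pullback_cochain)
qed

text \<open>The chain homotopy between two projections, in degree one: the cochain
  \<open>a [V] = c [q V, p V]\<close> bounds the difference, by two cocycle relations at a common
  point.\<close>

lemma nerve_pullback_projections_1:
  assumes p: "p \<in> refinement_projections \<U> \<V>" and q: "q \<in> refinement_projections \<U> \<V>" and c: "c \<in> nerve_cocycles 1 \<U>"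
  shows "(\<lambda>s. nerve_pullback 1 \<V> p c s - nerve_pullback 1 \<V> q c s) \<in> nerve_coboundaries 1 \<V>"
proof -
  define a where "a s = (if s \<in> nerve_simplices 0 \<V> then c [q (hd s), p (hd s)] else 0)" for s
  have pq: "p V \<in> \<U>" "V \<subseteq> p V" "q V \<in> \<U>" "V \<subseteq> q V" if "V \<in> \<V>" for V
    using that p q by (auto simp: refinement_projections_def)
  have "(\<lambda>s. nerve_pullback 1 \<V> p c s - nerve_pullback 1 \<V> q c s) = nerve_coboundary 0 \<V> a"
  proof
    fix s
    show "nerve_pullback 1 \<V> p c s - nerve_pullback 1 \<V> q c s = nerve_coboundary 0 \<V> a s"
    proof (cases "s \<in> nerve_simplices 1 \<V>")
      case True
      then obtain V W x where s: "s = [V, W]" "V \<in> \<V>" "W \<in> \<V>" "x \<in> V" "x \<in> W" unfolding simplices_1 by blast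
      have x: "x \<in> p V" "x \<in> q V" "x \<in> p W" "x \<in> q W" using pq s by blast+
      have "a [V] = c [q V, p V]" "a [W] = c [q W, p W]" using s by (auto simp: a_def simplices_0)
      then have "nerve_coboundary 0 \<V> a s = c [q W, p W] - c [q V, p V]"
        unfolding s(1) coboundary_0[OF s(2-)] by simp
      moreover have "c [p V, p W] - c [q V, p W] + c [q V, p V] = 0" "c [q W, p W] - c [q V, p W] + c [q V, q W] = 0"
        using cocycle_1D[OF c] pq s x by blast+
      ultimately show ?thesis using True by (simp add: nerve_pullback_def s(1))
    qed (simp add: nerve_pullback_def nerve_coboundary_def)
  qed
  moreover have "a \<in> nerve_cochains 0 \<V>" by (simp add: a_def nerve_cochains_def)
  ultimately show ?thesis by simp
qed

text \<open>Connectedness of the interval, in the form that a continuous function with discrete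
  range is constant.\<close>

lemma locally_constant_int:
  fixes f :: "real \<Rightarrow> int"
  assumes "\<And>t. t \<in> {0..r} \<Longrightarrow> \<exists>d>0. \<forall>s\<in>{0..r}. \<bar>s - t\<bar> < d \<longrightarrow> f s = f t" "t \<in> {0..r}" "t' \<in> {0..r}"
  shows "f t = f t'"
proof -
  have "continuous_on {0..r} (\<lambda>x. of_int (f x) :: real)"
    unfolding continuous_on_iff
  proof (intro ballI allI impI)
    fix x e :: real assume x: "x \<in> {0..r}" "e > 0"
    obtain d where "d > 0" "\<forall>s\<in>{0..r}. \<bar>s - x\<bar> < d \<longrightarrow> f s = f x" using assms(1)[OF x(1)] by blast
    then show "\<exists>d>0. \<forall>x'\<in>{0..r}. dist x' x < d \<longrightarrow> dist (real_of_int (f x')) (real_of_int (f x)) < e"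
      using x(2) by (intro exI[of _ d]) (auto simp: dist_real_def)
  qed
  moreover have "\<exists>e>0. \<forall>y. y \<in> {0..r} \<and> real_of_int (f y) \<noteq> real_of_int (f x) \<longrightarrow> e \<le> norm (real_of_int (f y) - real_of_int (f x))" for x
    by (intro exI[of _ 1]) (auto simp flip: of_int_diff of_int_abs)
  ultimately have "(\<lambda>x. of_int (f x) :: real) constant_on {0..r}"
    by (intro continuous_discrete_range_constant) auto
  then show ?thesis using assms(2,3) unfolding constant_on_def by (metis of_int_eq_iff)
qed

text \<open>Disjoint circles given by their coverings by the line: \<open>\<gamma> j\<close> is
  continuous, open and injective modulo integers. A cocycle can then be trivialized on
  \<open>[0, 1]\<close>, and the comparison of the two ends remains as the only obstruction.\<close>

locale circle_family =
  fixes X :: "'a topology" and m :: nat and \<gamma> :: "nat \<Rightarrow> real \<Rightarrow> 'a"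
  assumes top: "j < m \<Longrightarrow> \<gamma> j t \<in> topspace X"
    and cover: "x \<in> topspace X \<Longrightarrow> \<exists>j<m. \<exists>t. x = \<gamma> j t"
    and eq: "i < m \<Longrightarrow> j < m \<Longrightarrow> \<gamma> i s = \<gamma> j t \<longleftrightarrow> i = j \<and> s - t \<in> \<int>"
    and cont: "openin X U \<Longrightarrow> j < m \<Longrightarrow> open {t. \<gamma> j t \<in> U}"
    and opn: "j < m \<Longrightarrow> open S \<Longrightarrow> openin X (\<gamma> j ` S)"
begin

lemma period: "j < m \<Longrightarrow> \<gamma> j (t + 1) = \<gamma> j t" "j < m \<Longrightarrow> \<gamma> j 1 = \<gamma> j 0"
  using eq[of j j "t + 1" t] eq[of j j 1 0] by auto

lemma param: assumes "x \<in> topspace X" shows "\<exists>j<m. \<exists>t. 0 \<le> t \<and> t < 1 \<and> x = \<gamma> j t"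
proof -
  obtain j t where j: "j < m" "x = \<gamma> j t" using cover[OF assms] by blast
  have "t - frac t \<in> \<int>" by (simp add: frac_def)
  then have "x = \<gamma> j (frac t)" using eq[of j j t "frac t"] j by simp
  then show ?thesis using j(1) frac_ge_0[of t] frac_lt_1[of t] by blast
qed

lemma member_near:
  assumes "\<U> \<in> open_covers X" "U \<in> \<U>" "j < m" "\<gamma> j t \<in> U"
  shows "\<exists>d>0. \<forall>s. \<bar>s - t\<bar> < d \<longrightarrow> \<gamma> j s \<in> U"
proof -
  have "open {t. \<gamma> j t \<in> U}" using cont assms by (auto simp: open_covers_def)
  then show ?thesis using assms(4) unfolding open_dist dist_real_def by blast
qed

lemma cover_member: "\<U> \<in> open_covers X \<Longrightarrow> x \<in> topspace X \<Longrightarrow> \<exists>U\<in>\<U>. x \<in> U"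
  by (auto simp: open_covers_def)

lemma cover_subset: "\<U> \<in> open_covers X \<Longrightarrow> U \<in> \<U> \<Longrightarrow> U \<subseteq> topspace X"
  by (auto simp: open_covers_def)

subsection \<open>Degree zero\<close>

definition val0 :: "'a set set \<Rightarrow> ('a set list \<Rightarrow> int) \<Rightarrow> nat \<Rightarrow> int" where
  "val0 \<U> c j = c [SOME U. U \<in> \<U> \<and> \<gamma> j 0 \<in> U]"

text \<open>A 0-cocycle agrees on members with a common point, so its value along the circle is
  locally constant and hence constant on \<open>[0, 1]\<close>.\<close>

lemma val0:
  assumes U: "\<U> \<in> open_covers X" and c: "c \<in> nerve_cocycles 0 \<U>" and j: "j < m"
    and t: "0 \<le> t" "t \<le> 1" "V \<in> \<U>" "\<gamma> j t \<in> V"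
  shows "c [V] = val0 \<U> c j"
proof -
  define W where "W t = (SOME U. U \<in> \<U> \<and> \<gamma> j t \<in> U)" for t
  have W: "W t \<in> \<U> \<and> \<gamma> j t \<in> W t" for t
    unfolding W_def by (rule someI_ex) (use cover_member[OF U top[OF j]] in blast)
  have "c [W t] = c [W 0]"
  proof (rule locally_constant_int[where r = 1])
    fix t :: real
    obtain d where "d > 0" "\<forall>s. \<bar>s - t\<bar> < d \<longrightarrow> \<gamma> j s \<in> W t" using member_near[OF U _ j, of "W t" t] W by blast
    then show "\<exists>d>0. \<forall>s\<in>{0..1}. \<bar>s - t\<bar> < d \<longrightarrow> c [W s] = c [W t]"
      using cocycle_0D[OF c] W by blast
  qed (use t in auto)
  moreover have "c [V] = c [W t]" using cocycle_0D[OF c t(3) _ t(4)] W by blast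
  ultimately show ?thesis by (simp add: val0_def W_def)
qed

lemma cech_0: "product_group {..<m} (\<lambda>_. integer_group) \<cong> cech_cohomology 0 X"
proof (rule cech_iso[where v = val0])
  fix \<U> :: "'a set set" and c d j
  show "nerve_coboundaries 0 \<U> \<subseteq> nerve_cocycles 0 \<U>" using nerve_cocycles_zero by auto
  show "val0 \<U> (\<lambda>s. c s + d s) j = val0 \<U> c j + val0 \<U> d j" by (simp add: val0_def)
  show "c \<in> nerve_coboundaries 0 \<U> \<Longrightarrow> val0 \<U> c j = 0" by (simp add: val0_def)
next
  fix \<U> \<V> p c
  assume U: "\<U> \<in> open_covers X" and V: "\<V> \<in> open_covers X" and p: "p \<in> refinement_projections \<U> \<V>"
    and c: "c \<in> nerve_cocycles 0 \<U>"
  note pc = nerve_pullback_cocycle[OF p c]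
  have "val0 \<V> (nerve_pullback 0 \<V> p c) j = val0 \<U> c j" if j: "j < m" for j
  proof -
    obtain W where W: "W \<in> \<V>" "\<gamma> j 0 \<in> W" using cover_member[OF V top[OF j]] by blast
    then have "p W \<in> \<U>" "\<gamma> j 0 \<in> p W" using p by (auto simp: refinement_projections_def)
    then have "c [p W] = val0 \<U> c j" using val0[OF U c j, of 0] by simp
    moreover have "nerve_pullback 0 \<V> p c [W] = val0 \<V> (nerve_pullback 0 \<V> p c) j" using val0[OF V pc j, of 0] W by simp
    moreover have "nerve_pullback 0 \<V> p c [W] = c [p W]" using W by (auto simp: nerve_pullback_def simplices_0)
    ultimately show ?thesis by simp
  qed
  then show "nerve_pullback 0 \<V> p c \<in> nerve_cocycles 0 \<V> \<and> (\<forall>j<m. val0 \<V> (nerve_pullback 0 \<V> p c) j = val0 \<U> c j)"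
    using pc by blast
next
  fix \<U> \<V> p c assume "p \<in> refinement_projections \<U> \<V>" "c \<in> nerve_coboundaries 0 \<U>"
  then show "nerve_pullback 0 \<V> p c \<in> nerve_coboundaries 0 \<V>" by (rule nerve_pullback_coboundary)
next
  fix \<U> \<V> p q c
  assume p: "p \<in> refinement_projections \<U> \<V>" and q: "q \<in> refinement_projections \<U> \<V>" and c: "c \<in> nerve_cocycles 0 \<U>"
  have "nerve_pullback 0 \<V> p c s - nerve_pullback 0 \<V> q c s = 0" for s
  proof (cases "s \<in> nerve_simplices 0 \<V>")
    case True
    then obtain V x where V: "s = [V]" "V \<in> \<V>" "x \<in> V" unfolding simplices_0 by blast
    have "c [p V] = c [q V]" by (rule cocycle_0D[OF c, of _ _ x]) (use p q V in \<open>auto simp: refinement_projections_def\<close>)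
    then show ?thesis using True by (simp add: nerve_pullback_def V(1))
  qed (simp add: nerve_pullback_def)
  then show "(\<lambda>s. nerve_pullback 0 \<V> p c s - nerve_pullback 0 \<V> q c s) \<in> nerve_coboundaries 0 \<V>" by simp
next
  fix \<U> c assume U: "\<U> \<in> open_covers X" and c: "c \<in> nerve_cocycles 0 \<U>" and z: "\<forall>j<m. val0 \<U> c j = 0"
  have "c s = 0" for s
  proof (cases "s \<in> nerve_simplices 0 \<U>")
    case True
    then obtain V x where V: "s = [V]" "V \<in> \<U>" "x \<in> V" unfolding simplices_0 by blast
    then have "x \<in> topspace X" using cover_subset[OF U] by blast
    then obtain j t where j: "j < m" "0 \<le> t" "t < 1" "x = \<gamma> j t" using param by blast
    then show ?thesis using val0[OF U c j(1,2), of V] V z by simp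
  next
    case False
    then show ?thesis using c by (simp add: nerve_cocycles_def nerve_cochains_def)
  qed
  then have "nerve_pullback 0 \<U> (\<lambda>V. V) c \<in> nerve_coboundaries 0 \<U>"
    by (auto simp: nerve_pullback_def fun_eq_iff)
  moreover have "(\<lambda>V. V) \<in> refinement_projections \<U> \<U>" by (simp add: refinement_projections_def)
  ultimately show "\<exists>\<V>\<in>open_covers X. \<exists>p\<in>refinement_projections \<U> \<V>. nerve_pullback 0 \<V> p c \<in> nerve_coboundaries 0 \<V>"
    using U by blast
next
  fix k :: "nat \<Rightarrow> int"
  \<comment> \<open>Distinct members of this cover are disjoint, so every assignment of integers to
    the circles is a cocycle.\<close>
  let ?U = "(\<lambda>j. range (\<gamma> j)) ` {..<m}"
  define idx where "idx U = (SOME j. j < m \<and> U = range (\<gamma> j))" for U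
  have disj: "i = j" if "i < m" "j < m" "x \<in> range (\<gamma> i)" "x \<in> range (\<gamma> j)" for i j x
    using that eq by (metis imageE)
  have idx: "idx (range (\<gamma> j)) = j" if "j < m" for j
  proof -
    have "idx (range (\<gamma> j)) < m \<and> range (\<gamma> j) = range (\<gamma> (idx (range (\<gamma> j))))"
      unfolding idx_def by (rule someI[of _ j]) (use that in simp)
    then show ?thesis using disj[OF _ that, of "idx (range (\<gamma> j))" "\<gamma> j 0"] by blast
  qed
  define c where "c s = (if s \<in> nerve_simplices 0 ?U then k (idx (hd s)) else 0)" for s
  have U: "?U \<in> open_covers X"
    unfolding open_covers_def using opn[OF _ open_UNIV] top cover by fastforce
  have "nerve_coboundary 0 ?U c s = 0" for s
  proof (cases "s \<in> nerve_simplices 1 ?U")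
    case True
    then obtain V W x where s: "s = [V, W]" "V \<in> ?U" "W \<in> ?U" "x \<in> V" "x \<in> W" unfolding simplices_1 by blast
    then have "V = W" using disj by blast
    then show ?thesis unfolding s(1) coboundary_0[OF s(2-)] by simp
  qed (simp add: nerve_coboundary_def)
  then have c: "c \<in> nerve_cocycles 0 ?U" by (auto simp: nerve_cocycles_def nerve_cochains_def c_def)
  have "val0 ?U c j = k j" if j: "j < m" for j
  proof -
    have "c [range (\<gamma> j)] = val0 ?U c j" using val0[OF U c j, of 0 "range (\<gamma> j)"] j by auto
    moreover have "c [range (\<gamma> j)] = k j" using j idx[OF j] by (auto simp: c_def simplices_0)
    ultimately show ?thesis by simp
  qed
  then show "\<exists>\<U>\<in>open_covers X. \<exists>c\<in>nerve_cocycles 0 \<U>. \<forall>j<m. val0 \<U> c j = k j" using U c by blast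
qed

end

context circle_family
begin

subsection \<open>Degree one\<close>

text \<open>A trivialization of the pullback of a 1-cocycle to the interval \<open>[0, r]\<close> along the
  \<open>j\<close>-th circle; its increment over a full turn is the holonomy of the cocycle.\<close>

definition triv :: "real \<Rightarrow> nat \<Rightarrow> 'a set set \<Rightarrow> ('a set list \<Rightarrow> int) \<Rightarrow> (real \<Rightarrow> 'a set \<Rightarrow> int) \<Rightarrow> bool" where
  "triv r j \<U> c b \<longleftrightarrow>
     (\<forall>t\<in>{0..r}. \<forall>U\<in>\<U>. \<forall>V\<in>\<U>. \<gamma> j t \<in> U \<longrightarrow> \<gamma> j t \<in> V \<longrightarrow> b t V - b t U = c [U, V]) \<and>
     (\<forall>t\<in>{0..r}. \<forall>U\<in>\<U>. \<gamma> j t \<in> U \<longrightarrow>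
        (\<exists>d>0. \<forall>s\<in>{0..r}. \<bar>s - t\<bar> < d \<longrightarrow> \<gamma> j s \<in> U \<and> b s U = b t U))"

lemma trivD:
  assumes "triv r j \<U> c b" "0 \<le> t" "t \<le> r"
  shows "U \<in> \<U> \<Longrightarrow> V \<in> \<U> \<Longrightarrow> \<gamma> j t \<in> U \<Longrightarrow> \<gamma> j t \<in> V \<Longrightarrow> b t V - b t U = c [U, V]"
    "U \<in> \<U> \<Longrightarrow> \<gamma> j t \<in> U \<Longrightarrow> \<exists>d>0. \<forall>s\<in>{0..r}. \<bar>s - t\<bar> < d \<longrightarrow> \<gamma> j s \<in> U \<and> b s U = b t U"
proof -
  have t: "t \<in> {0..r}" using assms by simp
  show "U \<in> \<U> \<Longrightarrow> V \<in> \<U> \<Longrightarrow> \<gamma> j t \<in> U \<Longrightarrow> \<gamma> j t \<in> V \<Longrightarrow> b t V - b t U = c [U, V]"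
    using assms(1) t unfolding triv_def by blast
  show "U \<in> \<U> \<Longrightarrow> \<gamma> j t \<in> U \<Longrightarrow> \<exists>d>0. \<forall>s\<in>{0..r}. \<bar>s - t\<bar> < d \<longrightarrow> \<gamma> j s \<in> U \<and> b s U = b t U"
    using assms(1) t unfolding triv_def by blast
qed

text \<open>Beyond \<open>r\<close> the value is transported inside the single member
  \<open>W\<close> and corrected by \<open>c [W, V]\<close>. The cocycle relation gives the required
  differences, and at \<open>r\<close> the two formulas agree.\<close>

lemma triv_extend:
  assumes U: "\<U> \<in> open_covers X" and c: "c \<in> nerve_cocycles 1 \<U>" and j: "j < m"
    and b: "triv r j \<U> c b" and r: "0 \<le> r" "r \<le> r'"
    and W: "W \<in> \<U>" "\<And>s. r \<le> s \<Longrightarrow> s \<le> r' \<Longrightarrow> \<gamma> j s \<in> W"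
  shows "triv r' j \<U> c (\<lambda>t V. if t \<le> r then b t V else b r W + c [W, V])"
    (is "triv r' j \<U> c ?b")
  unfolding triv_def
proof (intro conjI ballI impI)
  fix t V V' assume t: "t \<in> {0..r'}" and V: "V \<in> \<U>" "V' \<in> \<U>" "\<gamma> j t \<in> V" "\<gamma> j t \<in> V'"
  show "?b t V' - ?b t V = c [V, V']"
  proof (cases "t \<le> r")
    case True
    then show ?thesis using trivD(1)[OF b _ True V] t by simp
  next
    case False
    then have "\<gamma> j t \<in> W" using W(2) t by simp
    from cocycle_1D[OF c W(1) V(1,2) this V(3,4)] show ?thesis using False by simp
  qed
next
  fix t V assume t: "t \<in> {0..r'}" and V: "V \<in> \<U>" "\<gamma> j t \<in> V"
  obtain e where e: "e > 0" "\<forall>s. \<bar>s - t\<bar> < e \<longrightarrow> \<gamma> j s \<in> V" using member_near[OF U V(1) j V(2)] by blast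
  show "\<exists>d>0. \<forall>s\<in>{0..r'}. \<bar>s - t\<bar> < d \<longrightarrow> \<gamma> j s \<in> V \<and> ?b s V = ?b t V"
  proof (cases "t \<le> r")
    case True
    obtain d where d: "d > 0" "\<forall>s\<in>{0..r}. \<bar>s - t\<bar> < d \<longrightarrow> \<gamma> j s \<in> V \<and> b s V = b t V"
      using trivD(2)[OF b _ True V] t by auto
    show ?thesis
    proof (cases "t = r")
      case True
      have "b r V - b r W = c [W, V]" using trivD(1)[OF b r(1) order_refl W(1) V(1)] W(2)[of r] r V(2) True by simp
      then have bt: "b r W + c [W, V] = ?b t V" using True by simp
      have "\<gamma> j s \<in> V \<and> ?b s V = ?b t V" if s: "s \<in> {0..r'}" "\<bar>s - t\<bar> < min d e" for s
      proof (cases "s \<le> r")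
        case sr: True
        then have "s \<in> {0..r}" "\<bar>s - t\<bar> < d" using s by auto
        then have "\<gamma> j s \<in> V" "b s V = b t V" using d(2) by blast+
        then show ?thesis using sr \<open>t \<le> r\<close> by simp
      next
        case False
        have "\<gamma> j s \<in> V" using e(2) s(2) by simp
        then show ?thesis using False bt by simp
      qed
      then show ?thesis using d(1) e(1) by (intro exI[of _ "min d e"]) simp
    next
      case False
      have "\<gamma> j s \<in> V \<and> ?b s V = ?b t V" if s: "s \<in> {0..r'}" "\<bar>s - t\<bar> < min d (r - t)" for s
      proof -
        have sr: "s \<in> {0..r}" "\<bar>s - t\<bar> < d" using s by auto
        then have "\<gamma> j s \<in> V" "b s V = b t V" using d(2) by blast+
        then show ?thesis using sr(1) \<open>t \<le> r\<close> by simp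
      qed
      then show ?thesis using d(1) False \<open>t \<le> r\<close> by (intro exI[of _ "min d (r - t)"]) simp
    qed
  next
    case False
    have "\<gamma> j s \<in> V \<and> ?b s V = ?b t V" if s: "s \<in> {0..r'}" "\<bar>s - t\<bar> < min e (t - r)" for s
    proof -
      have "\<gamma> j s \<in> V" using e(2) s(2) by simp
      moreover have "\<not> s \<le> r" using s(2) by linarith
      ultimately show ?thesis using False by simp
    qed
    then show ?thesis using e(1) False by (intro exI[of _ "min e (t - r)"]) simp
  qed
qed

text \<open>A Lebesgue number \<open>e\<close> of the cover along \<open>[0, 1]\<close> permits
  extension in steps of \<open>e / 2\<close>, each staying inside one member.\<close>

lemma triv_exists:
  assumes U: "\<U> \<in> open_covers X" and c: "c \<in> nerve_cocycles 1 \<U>" and j: "j < m"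
  shows "\<exists>b. triv 1 j \<U> c b"
proof -
  let ?G = "(\<lambda>U. {t. \<gamma> j t \<in> U}) ` \<U>"
  have G: "{0..1} \<subseteq> \<Union>?G" "\<And>G. G \<in> ?G \<Longrightarrow> open G"
    using cover_member[OF U top[OF j]] cont[OF _ j] U by (auto simp: open_covers_def)
  have "\<exists>e>0. \<forall>x\<in>{0..1}. \<exists>W\<in>\<U>. ball x e \<subseteq> {t. \<gamma> j t \<in> W}"
  proof (rule Heine_Borel_lemma[OF compact_Icc G])
    fix e :: real
    assume e: "0 < e" and *: "\<And>x. x \<in> {0..1} \<Longrightarrow> \<exists>G\<in>?G. ball x e \<subseteq> G"
    have "\<exists>W\<in>\<U>. ball x e \<subseteq> {t. \<gamma> j t \<in> W}" if "x \<in> {0..1}" for x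
      using *[OF that] by blast
    then show ?thesis using e by blast
  qed
  then obtain e where e: "e > 0" "\<And>x. x \<in> {0..1} \<Longrightarrow> \<exists>W\<in>\<U>. ball x e \<subseteq> {t. \<gamma> j t \<in> W}" by blast
  have "\<exists>b. triv (min 1 (real n * (e / 2))) j \<U> c b" for n
  proof (induction n)
    case 0
    obtain W where W: "W \<in> \<U>" "\<gamma> j 0 \<in> W" using cover_member[OF U top[OF j]] by blast
    have "triv 0 j \<U> c (\<lambda>t V. c [W, V])"
      unfolding triv_def
    proof (intro conjI ballI impI)
      fix t V V' assume "t \<in> {0..0::real}" and V: "V \<in> \<U>" "V' \<in> \<U>" "\<gamma> j t \<in> V" "\<gamma> j t \<in> V'"
      then have "\<gamma> j t \<in> W" using W(2) by simp
      from cocycle_1D[OF c W(1) V(1,2) this V(3,4)] show "c [W, V'] - c [W, V] = c [V, V']" by simp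
    qed (auto intro: exI[of _ 1])
    then show ?case by auto
  next
    case (Suc n)
    let ?r = "min 1 (real n * (e / 2))" and ?r' = "min 1 (real (Suc n) * (e / 2))"
    obtain b where b: "triv ?r j \<U> c b" using Suc by blast
    have r: "0 \<le> ?r" "?r \<le> ?r'" "?r' < ?r + e" using e(1) by (auto simp: min_def algebra_simps)
    obtain W where W: "W \<in> \<U>" "ball ?r e \<subseteq> {t. \<gamma> j t \<in> W}" using e(2)[of ?r] r(1) by auto
    have "\<gamma> j s \<in> W" if "?r \<le> s" "s \<le> ?r'" for s
    proof -
      have "\<bar>?r - s\<bar> < e" using that r(3) by linarith
      then have "s \<in> ball ?r e" by (simp only: mem_ball dist_real_def)
      then show ?thesis using W(2) by blast
    qed
    from triv_extend[OF U c j b r(1,2) W(1) this] show ?case by blast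
  qed
  moreover obtain n where "2 / e < real n" using reals_Archimedean2 by blast
  then have "min 1 (real n * (e / 2)) = 1" using e(1) by (simp add: field_simps min_def)
  ultimately show ?thesis by metis
qed

definition hol :: "'a set set \<Rightarrow> ('a set list \<Rightarrow> int) \<Rightarrow> nat \<Rightarrow> int" where
  "hol \<U> c j = (let b = SOME b. triv 1 j \<U> c b; W = SOME W. W \<in> \<U> \<and> \<gamma> j 0 \<in> W in b 1 W - b 0 W)"

text \<open>Two trivializations differ by a locally constant integer function, which drops out of
  the increment. Changing the member alters both ends by the same cocycle value, since
  \<open>\<gamma> j 1 = \<gamma> j 0\<close>.\<close>

lemma hol_eq:
  assumes U: "\<U> \<in> open_covers X" and j: "j < m" and b: "triv 1 j \<U> c b" and W: "W \<in> \<U>" "\<gamma> j 0 \<in> W"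
  shows "hol \<U> c j = b 1 W - b 0 W"
proof -
  define b' where "b' = (SOME b. triv 1 j \<U> c b)"
  have b': "triv 1 j \<U> c b'" unfolding b'_def by (rule someI[of _ b]) (rule b)
  define W' where "W' = (SOME W. W \<in> \<U> \<and> \<gamma> j 0 \<in> W)"
  have W': "W' \<in> \<U>" "\<gamma> j 0 \<in> W'" unfolding W'_def by (rule someI2[of _ W]; use W in simp)+
  define C where "C t = (SOME U. U \<in> \<U> \<and> \<gamma> j t \<in> U)" for t
  have C: "C t \<in> \<U> \<and> \<gamma> j t \<in> C t" for t
    unfolding C_def by (rule someI_ex) (use cover_member[OF U top[OF j]] in blast)
  define f where "f t = b t (C t) - b' t (C t)" for t
  have f: "b t V - b' t V = f t" if "0 \<le> t" "t \<le> 1" "V \<in> \<U>" "\<gamma> j t \<in> V" for t V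
    using trivD(1)[OF b that(1,2), of "C t" V] trivD(1)[OF b' that(1,2), of "C t" V] C[of t] that(3,4)
    by (simp add: f_def)
  have "f 1 = f 0"
  proof (rule locally_constant_int[where r = 1])
    fix t :: real assume t: "t \<in> {0..1}"
    then have t': "0 \<le> t" "t \<le> 1" by auto
    obtain d where d: "d > 0" "\<forall>s\<in>{0..1}. \<bar>s - t\<bar> < d \<longrightarrow> \<gamma> j s \<in> C t \<and> b s (C t) = b t (C t)"
      using trivD(2)[OF b t'] C[of t] by blast
    obtain d' where d': "d' > 0" "\<forall>s\<in>{0..1}. \<bar>s - t\<bar> < d' \<longrightarrow> \<gamma> j s \<in> C t \<and> b' s (C t) = b' t (C t)"
      using trivD(2)[OF b' t'] C[of t] by blast
    have "f s = f t" if s: "s \<in> {0..1}" "\<bar>s - t\<bar> < min d d'" for s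
    proof -
      have "\<gamma> j s \<in> C t" "b s (C t) = b t (C t)" "b' s (C t) = b' t (C t)" using d d' s by auto
      then show ?thesis using f[of s "C t"] s(1) C[of t] by (simp add: f_def)
    qed
    then show "\<exists>d>0. \<forall>s\<in>{0..1}. \<bar>s - t\<bar> < d \<longrightarrow> f s = f t"
      using d(1) d'(1) by (intro exI[of _ "min d d'"]) simp
  qed auto
  then have "b 1 W' - b' 1 W' = b 0 W' - b' 0 W'"
    using f[of 1 W'] f[of 0 W'] W' period(2)[OF j] by simp
  moreover have "b 1 W' - b 1 W = b 0 W' - b 0 W"
    using trivD(1)[OF b, of 1 W W'] trivD(1)[OF b, of 0 W W'] W W' period(2)[OF j] by simp
  moreover have "hol \<U> c j = b' 1 W' - b' 0 W'" unfolding hol_def b'_def W'_def Let_def ..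
  ultimately show ?thesis by simp
qed

lemma nbhd_image:
  assumes "j < m" "d > 0" and near: "\<And>s. s \<in> ball t d \<Longrightarrow> \<gamma> j s \<in> V \<and> P (\<gamma> j s)"
  shows "\<exists>N. openin X N \<and> \<gamma> j t \<in> N \<and> N \<subseteq> V \<and> (\<forall>y\<in>N. P y)"
proof (intro exI conjI)
  show "openin X (\<gamma> j ` ball t d)" by (rule opn[OF assms(1) open_ball])
  show "\<gamma> j t \<in> \<gamma> j ` ball t d" by (rule imageI) (simp add: assms(2))
  show "\<gamma> j ` ball t d \<subseteq> V" by (rule image_subsetI) (simp add: near)
  show "\<forall>y\<in>\<gamma> j ` ball t d. P y" by (rule ballI, elim imageE) (simp add: near)
qed

text \<open>Without holonomy the trivialization takes equal values at both ends of
  \<open>[0, 1]\<close> and descends to the circle. \<open>B\<close> is the descended function,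
  locally constant in the point for each member.\<close>

lemma hol_zero_primitive:
  assumes U: "\<U> \<in> open_covers X" and c: "c \<in> nerve_cocycles 1 \<U>" and z: "\<forall>j<m. hol \<U> c j = 0"
  shows "\<exists>B :: 'a \<Rightarrow> 'a set \<Rightarrow> int. (\<forall>U\<in>\<U>. \<forall>V\<in>\<U>. \<forall>x\<in>U \<inter> V. B x V - B x U = c [U, V]) \<and>
    (\<forall>V\<in>\<U>. \<forall>x\<in>V. \<exists>N. openin X N \<and> x \<in> N \<and> N \<subseteq> V \<and> (\<forall>y\<in>N. B y V = B x V))"
proof -
  have "\<forall>j. \<exists>b. j < m \<longrightarrow> triv 1 j \<U> c b" using triv_exists[OF U c] by blast
  then obtain b where b: "\<And>j. j < m \<Longrightarrow> triv 1 j \<U> c (b j)" by metis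
  have b01: "b j 1 V = b j 0 V" if "j < m" "V \<in> \<U>" "\<gamma> j 0 \<in> V" for j V
    using hol_eq[OF U that(1) b[OF that(1)] that(2,3)] z that(1) by simp
  define pr where "pr x = (SOME jt. fst jt < m \<and> 0 \<le> snd jt \<and> snd jt < 1 \<and> x = \<gamma> (fst jt) (snd jt))" for x
  have pr: "fst (pr x) < m \<and> 0 \<le> snd (pr x) \<and> snd (pr x) < 1 \<and> x = \<gamma> (fst (pr x)) (snd (pr x))"
    if "x \<in> topspace X" for x
    unfolding pr_def by (rule someI_ex) (use param[OF that] in auto)
  define B where "B x V = b (fst (pr x)) (snd (pr x)) V" for x V
  have pr_eq: "pr (\<gamma> j t) = (j, t)" if "j < m" "0 \<le> t" "t < 1" for j t
  proof -
    have p: "fst (pr (\<gamma> j t)) < m" "0 \<le> snd (pr (\<gamma> j t))" "snd (pr (\<gamma> j t)) < 1"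
      "\<gamma> j t = \<gamma> (fst (pr (\<gamma> j t))) (snd (pr (\<gamma> j t)))" using pr[OF top[OF that(1)]] by blast+
    then have e: "j = fst (pr (\<gamma> j t))" "t - snd (pr (\<gamma> j t)) \<in> \<int>" using eq[OF that(1) p(1)] by blast+
    obtain i :: int where i: "t - snd (pr (\<gamma> j t)) = of_int i" using e(2) by (auto elim: Ints_cases)
    have "- 1 < real_of_int i" "real_of_int i < 1" using i p(2,3) that(2,3) by linarith+
    then have "i = 0" by linarith
    then show ?thesis using e(1) i by (simp add: prod_eq_iff)
  qed
  have B: "B (\<gamma> j t) V = b j t V" if "j < m" "0 \<le> t" "t \<le> 1" "V \<in> \<U>" "\<gamma> j t \<in> V" for j t V
  proof (cases "t < 1")
    case True
    then show ?thesis using pr_eq[OF that(1,2)] by (simp add: B_def)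
  next
    case False
    then have "t = 1" using that(3) by simp
    then show ?thesis
      using pr_eq[OF that(1), of 0] period(2)[OF that(1)] b01[OF that(1,4)] that(5) by (simp add: B_def)
  qed
  show ?thesis
  proof (intro exI[of _ B] conjI ballI)
    fix x U' V assume "U' \<in> \<U>" "V \<in> \<U>" "x \<in> U' \<inter> V"
    then have UV: "U' \<in> \<U>" "V \<in> \<U>" "x \<in> U'" "x \<in> V" by auto
    then have "x \<in> topspace X" using cover_subset[OF U] by blast
    note p = pr[OF this]
    then show "B x V - B x U' = c [U', V]"
      using trivD(1)[OF b, of "fst (pr x)" "snd (pr x)" U' V] UV by (simp add: B_def)
  next
    fix x V assume V: "V \<in> \<U>" "x \<in> V"
    then have "x \<in> topspace X" using cover_subset[OF U] by blast
    then obtain j t where j: "j < m" "0 \<le> t" "t < 1" "x = \<gamma> j t" using param by blast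
    obtain d where d: "d > 0" "\<forall>s\<in>{0..1}. \<bar>s - t\<bar> < d \<longrightarrow> \<gamma> j s \<in> V \<and> b j s V = b j t V"
      using trivD(2)[OF b[OF j(1)], of t V] j V by auto
    have x: "B x V = b j t V" using B[OF j(1,2), of V] j V by simp
    show "\<exists>N. openin X N \<and> x \<in> N \<and> N \<subseteq> V \<and> (\<forall>y\<in>N. B y V = B x V)"
    proof (cases "t = 0")
      case False
      let ?d = "min d (min t (1 - t))"
      have d0: "?d > 0" using d(1) j False by simp
      have "\<gamma> j s \<in> V \<and> B (\<gamma> j s) V = B x V" if "s \<in> ball t ?d" for s
      proof -
        have s: "0 \<le> s" "s \<le> 1" "\<bar>s - t\<bar> < d" using that by (auto simp: dist_real_def)
        then have "\<gamma> j s \<in> V" "b j s V = b j t V" using d(2) by auto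
        then show ?thesis using B[OF j(1) s(1,2) V(1)] x by simp
      qed
      then have "\<exists>N. openin X N \<and> \<gamma> j t \<in> N \<and> N \<subseteq> V \<and> (\<forall>y\<in>N. B y V = B x V)"
        by (intro nbhd_image[OF j(1) d0])
      then show ?thesis by (simp only: j(4))
    next
      \<comment> \<open>The base point has neighbours on both sides. Those with \<open>s < 0\<close>
        are read at \<open>s + 1\<close>, near the right end of the interval, where the value equals
        the one at the left end by \<open>b01\<close>.\<close>
      case True
      have g: "\<gamma> j 1 \<in> V" using V(2) j(4) True period(2)[OF j(1)] by simp
      obtain d' where d': "d' > 0" "\<forall>s\<in>{0..1}. \<bar>s - 1\<bar> < d' \<longrightarrow> \<gamma> j s \<in> V \<and> b j s V = b j 1 V"
        using trivD(2)[OF b[OF j(1)], of 1 V] V g by auto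
      let ?d = "min 1 (min d d')"
      have d0: "?d > 0" using d(1) d'(1) by simp
      have "\<gamma> j s \<in> V \<and> B (\<gamma> j s) V = B x V" if s: "s \<in> ball 0 ?d" for s
      proof (cases "s \<ge> 0")
        case s0: True
        have s1: "s \<le> 1" "\<bar>s - t\<bar> < d" using s s0 True by (auto simp: dist_real_def)
        then have "\<gamma> j s \<in> V" "b j s V = b j t V" using d(2) s0 by auto
        then show ?thesis using B[OF j(1) s0 s1(1) V(1)] x by simp
      next
        case False
        have s1: "0 \<le> s + 1" "s + 1 \<le> 1" "\<bar>s + 1 - 1\<bar> < d'" using s False by (auto simp: dist_real_def)
        then have "\<gamma> j (s + 1) \<in> V \<and> b j (s + 1) V = b j 1 V"
          using d'(2)[rule_format, of "s + 1"] by (simp only: atLeastAtMost_iff)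
        then have "\<gamma> j (s + 1) \<in> V" "b j (s + 1) V = b j 1 V" by blast+
        moreover have "b j 1 V = b j t V" using b01[OF j(1) V(1)] V(2) j(4) True by simp
        ultimately show ?thesis using B[OF j(1) s1(1,2) V(1)] x period(1)[OF j(1)] by simp
      qed
      then have "\<exists>N. openin X N \<and> \<gamma> j 0 \<in> N \<and> N \<subseteq> V \<and> (\<forall>y\<in>N. B y V = B x V)"
        by (intro nbhd_image[OF j(1) d0])
      then show ?thesis by (simp only: j(4) True)
    qed
  qed
qed

text \<open>\<open>B\<close> depends on the point, whereas a cochain has one value per member. On
  the refinement \<open>K\<close> by open sets on which \<open>B\<close> is constant for a chosen
  member, it becomes a 0-cochain bounding the pulled-back cocycle.\<close>

lemma hol_zero_trivial:
  assumes U: "\<U> \<in> open_covers X" and c: "c \<in> nerve_cocycles 1 \<U>" and z: "\<forall>j<m. hol \<U> c j = 0"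
  shows "\<exists>\<V>\<in>open_covers X. \<exists>p\<in>refinement_projections \<U> \<V>. nerve_pullback 1 \<V> p c \<in> nerve_coboundaries 1 \<V>"
proof -
  obtain B :: "'a \<Rightarrow> 'a set \<Rightarrow> int" where
    prim: "\<forall>U\<in>\<U>. \<forall>V\<in>\<U>. \<forall>x\<in>U \<inter> V. B x V - B x U = c [U, V]" and
    loc: "\<forall>V\<in>\<U>. \<forall>x\<in>V. \<exists>N. openin X N \<and> x \<in> N \<and> N \<subseteq> V \<and> (\<forall>y\<in>N. B y V = B x V)"
    using hol_zero_primitive[OF assms] by (elim exE conjE) (rule that)
  define K where "K = {N. openin X N \<and> (\<exists>V\<in>\<U>. N \<subseteq> V \<and> (\<forall>x\<in>N. \<forall>y\<in>N. B x V = B y V))}"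
  have "\<forall>N\<in>K. \<exists>V. V \<in> \<U> \<and> N \<subseteq> V \<and> (\<forall>x\<in>N. \<forall>y\<in>N. B x V = B y V)" unfolding K_def by blast
  then obtain p where p: "\<And>N. N \<in> K \<Longrightarrow> p N \<in> \<U> \<and> N \<subseteq> p N \<and> (\<forall>x\<in>N. \<forall>y\<in>N. B x (p N) = B y (p N))" by metis
  have K: "K \<in> open_covers X"
  proof -
    have "x \<in> \<Union>K" if x: "x \<in> topspace X" for x
    proof -
      obtain V where V: "V \<in> \<U>" "x \<in> V" using cover_member[OF U x] by blast
      obtain N where N: "openin X N" "x \<in> N" "N \<subseteq> V" "\<forall>y\<in>N. B y V = B x V"
        using bspec[OF bspec[OF loc V(1)] V(2)] by (elim exE conjE) (rule that)
      have "B y V = B z V" if "y \<in> N" "z \<in> N" for y z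
        by (rule trans[OF bspec[OF N(4) that(1)] sym[OF bspec[OF N(4) that(2)]]])
      then have "N \<in> K" unfolding K_def
        by (intro CollectI conjI bexI[of _ V] ballI N(1,3) V(1))
      then show ?thesis using N(2) by blast
    qed
    moreover have "\<Union>K \<subseteq> topspace X" using openin_subset by (auto simp: K_def)
    ultimately show ?thesis by (auto simp: open_covers_def K_def)
  qed
  have pK: "p \<in> refinement_projections \<U> K" using p by (auto simp: refinement_projections_def)
  define a where "a s = (if s \<in> nerve_simplices 0 K then B (SOME x. x \<in> hd s) (p (hd s)) else 0)" for s
  have pm: "p N \<in> \<U>" "N \<subseteq> p N" if "N \<in> K" for N using p[OF that] by blast+
  have a: "a [V] = B x (p V)" if "V \<in> K" "x \<in> V" for V x
  proof -
    have s: "(SOME x. x \<in> V) \<in> V" using that(2) by (rule someI)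
    have "[V] \<in> nerve_simplices 0 K" using that by (auto simp: simplices_0)
    then have "a [V] = B (SOME x. x \<in> V) (p V)" by (simp add: a_def)
    also have "\<dots> = B x (p V)"
      by (rule bspec[OF bspec[OF conjunct2[OF conjunct2[OF p[OF that(1)]]] s] that(2)])
    finally show ?thesis .
  qed
  have "nerve_pullback 1 K p c = nerve_coboundary 0 K a"
  proof
    fix s
    show "nerve_pullback 1 K p c s = nerve_coboundary 0 K a s"
    proof (cases "s \<in> nerve_simplices 1 K")
      case True
      then obtain V W x where s: "s = [V, W]" "V \<in> K" "W \<in> K" "x \<in> V" "x \<in> W" unfolding simplices_1 by blast
      have "c [p V, p W] = B x (p W) - B x (p V)"
        by (rule prim[rule_format, symmetric]) (use pm[OF s(2)] pm[OF s(3)] s(4,5) in auto)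
      then have "nerve_pullback 1 K p c s = a [W] - a [V]"
        using True a[OF s(2,4)] a[OF s(3,5)] by (simp add: nerve_pullback_def s(1))
      then show ?thesis unfolding s(1) coboundary_0[OF s(2-)] .
    qed (simp add: nerve_pullback_def nerve_coboundary_def)
  qed
  moreover have "a \<in> nerve_cochains 0 K" by (simp add: a_def nerve_cochains_def)
  ultimately have "nerve_pullback 1 K p c \<in> nerve_coboundaries 1 K" by simp
  then show ?thesis using K pK by blast
qed

text \<open>On short arcs the circle coordinate lifts to the line. Two lifts differ by integers
  \<open>D\<close>, which form the winding cocycle of holonomy 1; the factor \<open>k\<close> of the
  circle scales it.\<close>

lemma hol_surj: "\<exists>\<U>\<in>open_covers X. \<exists>c\<in>nerve_cocycles 1 \<U>. \<forall>j<m. hol \<U> c j = k j"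
proof -
  \<comment> \<open>Arcs of length 1/2: over an intersection each lift varies by less than 1/2, so
    the integral difference of two lifts cannot change.\<close>
  define \<U> where "\<U> = {N. openin X N \<and> (\<exists>j<m. \<exists>t. N \<subseteq> \<gamma> j ` {t - 1/4<..<t + 1/4})}"
  have "\<forall>N\<in>\<U>. \<exists>jt. fst jt < m \<and> N \<subseteq> \<gamma> (fst jt) ` {snd jt - 1/4<..<snd jt + 1/4}"
    unfolding \<U>_def by auto
  then obtain jt where jt: "\<And>N. N \<in> \<U> \<Longrightarrow> fst (jt N) < m \<and> N \<subseteq> \<gamma> (fst (jt N)) ` {snd (jt N) - 1/4<..<snd (jt N) + 1/4}"
    by metis
  define J where "J N = fst (jt N)" for N
  define C where "C N = snd (jt N)" for N
  have JC: "J N < m" "N \<subseteq> \<gamma> (J N) ` {C N - 1/4<..<C N + 1/4}" if "N \<in> \<U>" for N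
    using jt[OF that] by (simp_all add: J_def C_def)
  define l where "l N x = (SOME s. C N - 1/4 < s \<and> s < C N + 1/4 \<and> \<gamma> (J N) s = x)" for N x
  have l: "C N - 1/4 < l N x \<and> l N x < C N + 1/4 \<and> \<gamma> (J N) (l N x) = x" if "N \<in> \<U>" "x \<in> N" for N x
  proof -
    have "x \<in> \<gamma> (J N) ` {C N - 1/4<..<C N + 1/4}" using JC(2)[OF that(1)] that(2) by (rule subsetD)
    then have "\<exists>s. C N - 1/4 < s \<and> s < C N + 1/4 \<and> \<gamma> (J N) s = x" by auto
    then show ?thesis unfolding l_def by (rule someI_ex)
  qed
  have small: "i = 0" if "\<bar>real_of_int i\<bar> < 1" for i :: int using that by linarith
  have J: "J N = j" if "N \<in> \<U>" "\<gamma> j t \<in> N" "j < m" for N j t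
    using l[OF that(1,2)] JC(1)[OF that(1)] that(3) eq by metis
  have lint: "t - l N (\<gamma> j t) \<in> \<int>" if "N \<in> \<U>" "\<gamma> j t \<in> N" "j < m" for N j t
    using l[OF that(1,2)] J[OF that] that(3) eq[OF that(3,3), of t "l N (\<gamma> j t)"] by simp
  define D where "D N P x = \<lfloor>l N x - l P x\<rfloor>" for N P x
  have D: "real_of_int (D N P x) = l N x - l P x" if "N \<in> \<U>" "P \<in> \<U>" "x \<in> N" "x \<in> P" for N P x
  proof -
    have x: "x \<in> topspace X" using that openin_subset by (auto simp: \<U>_def)
    then obtain j t where j: "j < m" "x = \<gamma> j t" using cover by blast
    have "(t - l P x) - (t - l N x) \<in> \<int>"
      using Ints_diff[OF lint[OF that(2) _ j(1), of t] lint[OF that(1) _ j(1), of t]] that(3,4) j(2) by simp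
    then have "l N x - l P x \<in> \<int>" by simp
    then show ?thesis unfolding D_def by (auto elim: Ints_cases)
  qed
  have Dc: "D N P x = D N P y" if "N \<in> \<U>" "P \<in> \<U>" "x \<in> N" "x \<in> P" "y \<in> N" "y \<in> P" for N P x y
  proof -
    have "\<bar>real_of_int (D N P x - D N P y)\<bar> < 1"
      using l[OF that(1,3)] l[OF that(1,5)] l[OF that(2,4)] l[OF that(2,6)]
        D[OF that(1,2,3,4)] D[OF that(1,2,5,6)] by (simp add: abs_less_iff)
    then show ?thesis using small[of "D N P x - D N P y"] by simp
  qed
  define c where "c s = (if s \<in> nerve_simplices 1 \<U> then
    k (J (s ! 0)) * D (s ! 0) (s ! 1) (SOME x. x \<in> s ! 0 \<and> x \<in> s ! 1) else 0)" for s
  have c: "c [N, P] = k (J N) * D N P x" if "N \<in> \<U>" "P \<in> \<U>" "x \<in> N" "x \<in> P" for N P x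
  proof -
    have "(SOME x. x \<in> N \<and> x \<in> P) \<in> N \<and> (SOME x. x \<in> N \<and> x \<in> P) \<in> P"
      by (rule someI[of _ x]) (use that in simp)
    then have "D N P (SOME x. x \<in> N \<and> x \<in> P) = D N P x" using Dc that by blast
    moreover have "[N, P] \<in> nerve_simplices 1 \<U>" using that by (auto simp: simplices_1 simp del: One_nat_def)
    ultimately show ?thesis by (simp add: c_def)
  qed
  have U: "\<U> \<in> open_covers X"
  proof -
    have "x \<in> \<Union>\<U>" if x: "x \<in> topspace X" for x
    proof -
      obtain j t where j: "j < m" "x = \<gamma> j t" using cover[OF x] by blast
      have "\<gamma> j ` {t - 1/4<..<t + 1/4} \<in> \<U>" unfolding \<U>_def
        by (intro CollectI conjI exI[of _ j] exI[of _ t] opn j(1) subset_refl open_greaterThanLessThan)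
      moreover have "x \<in> \<gamma> j ` {t - 1/4<..<t + 1/4}" unfolding j(2) by (rule imageI) simp
      ultimately show ?thesis by blast
    qed
    moreover have "\<Union>\<U> \<subseteq> topspace X" using openin_subset by (auto simp: \<U>_def)
    ultimately show ?thesis by (auto simp: open_covers_def \<U>_def)
  qed
  have JJ: "J N = J P" if "N \<in> \<U>" "P \<in> \<U>" "x \<in> N" "x \<in> P" for N P x
    using J[OF that(2) _ JC(1)[OF that(1)], of "l N x"] l[OF that(1,3)] that(4) by simp
  have "nerve_coboundary 1 \<U> c s = 0" for s
  proof (cases "s \<in> nerve_simplices 2 \<U>")
    case True
    then obtain N P Q x where s: "s = [N, P, Q]" "N \<in> \<U>" "P \<in> \<U>" "Q \<in> \<U>" "x \<in> N" "x \<in> P" "x \<in> Q"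
      unfolding simplices_2 by blast
    have "real_of_int (D P Q x - D N Q x + D N P x) = 0"
      using D[OF s(3,4,6,7)] D[OF s(2,4,5,7)] D[OF s(2,3,5,6)] by simp
    then have "D P Q x - D N Q x + D N P x = 0" by (simp only: of_int_eq_0_iff)
    moreover have "nerve_coboundary 1 \<U> c s = k (J N) * (D P Q x - D N Q x + D N P x)"
      unfolding s(1) coboundary_1[OF s(2-)] c[OF s(3,4,6,7)] c[OF s(2,4,5,7)] c[OF s(2,3,5,6)]
        JJ[OF s(2,3,5,6), symmetric] by (simp add: algebra_simps)
    ultimately show ?thesis by simp
  qed (simp add: nerve_coboundary_def numeral_2_eq_2)
  then have cc: "c \<in> nerve_cocycles 1 \<U>" by (auto simp: nerve_cocycles_def nerve_cochains_def c_def)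
  have "hol \<U> c j = k j" if j: "j < m" for j
  proof -
    \<comment> \<open>The floor is the number of turns from the lift in \<open>V\<close> to
      \<open>t\<close>; it grows by one over a full period.\<close>
    define b where "b t V = k j * \<lfloor>t - l V (\<gamma> j t)\<rfloor>" for t V
    have fl: "real_of_int \<lfloor>t - l V (\<gamma> j t)\<rfloor> = t - l V (\<gamma> j t)" if "V \<in> \<U>" "\<gamma> j t \<in> V" for t V
      using lint[OF that j] by (auto elim: Ints_cases)
    have "triv 1 j \<U> c b"
      unfolding triv_def
    proof (intro conjI ballI impI)
      fix t V W assume V: "V \<in> \<U>" "W \<in> \<U>" "\<gamma> j t \<in> V" "\<gamma> j t \<in> W"
      have "real_of_int (\<lfloor>t - l W (\<gamma> j t)\<rfloor> - \<lfloor>t - l V (\<gamma> j t)\<rfloor>) = real_of_int (D V W (\<gamma> j t))"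
        unfolding of_int_diff fl[OF V(1,3)] fl[OF V(2,4)] D[OF V] by simp
      then have "\<lfloor>t - l W (\<gamma> j t)\<rfloor> - \<lfloor>t - l V (\<gamma> j t)\<rfloor> = D V W (\<gamma> j t)" by (simp only: of_int_eq_iff)
      then show "b t W - b t V = c [V, W]"
        unfolding c[OF V] b_def J[OF V(1,3) j] by (simp flip: right_diff_distrib)
    next
      fix t V assume V: "V \<in> \<U>" "\<gamma> j t \<in> V"
      obtain e where e: "e > 0" "\<forall>s. \<bar>s - t\<bar> < e \<longrightarrow> \<gamma> j s \<in> V" using member_near[OF U V(1) j V(2)] by blast
      have near: "\<gamma> j s \<in> V \<and> b s V = b t V" if s: "\<bar>s - t\<bar> < min e (1/2)" for s
      proof -
        have sV: "\<gamma> j s \<in> V" using e(2) s by simp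
        have lb: "C V - 1/4 < l V (\<gamma> j s)" "l V (\<gamma> j s) < C V + 1/4"
          "C V - 1/4 < l V (\<gamma> j t)" "l V (\<gamma> j t) < C V + 1/4"
          using l[OF V(1) sV] l[OF V] by blast+
        have s2: "\<bar>s - t\<bar> < 1/2" using s by simp
        have "\<bar>real_of_int (\<lfloor>s - l V (\<gamma> j s)\<rfloor> - \<lfloor>t - l V (\<gamma> j t)\<rfloor>)\<bar> < 1"
          unfolding of_int_diff fl[OF V(1) sV] fl[OF V] using lb s2 by linarith
        then have "\<lfloor>s - l V (\<gamma> j s)\<rfloor> - \<lfloor>t - l V (\<gamma> j t)\<rfloor> = 0" by (rule small)
        then show ?thesis using sV by (simp add: b_def)
      qed
      show "\<exists>d>0. \<forall>s\<in>{0..1}. \<bar>s - t\<bar> < d \<longrightarrow> \<gamma> j s \<in> V \<and> b s V = b t V"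
      proof (intro exI conjI ballI impI)
        show "0 < min e (1/2)" using e(1) by simp
      qed (use near in blast)+
    qed
    moreover obtain W where W: "W \<in> \<U>" "\<gamma> j 0 \<in> W" using cover_member[OF U top[OF j]] by blast
    ultimately have "hol \<U> c j = b 1 W - b 0 W" by (intro hol_eq[OF U j])
    also have "\<lfloor>1 - l W (\<gamma> j 0)\<rfloor> = 1 + \<lfloor>0 - l W (\<gamma> j 0)\<rfloor>" by linarith
    then have "b 1 W - b 0 W = k j" unfolding b_def period(2)[OF j]
      by (simp only: distrib_left mult_1_right add_diff_cancel_right')
    finally show ?thesis .
  qed
  then show ?thesis using U cc by blast
qed

text \<open>Trivializations add and pull back like the cocycles themselves, and a coboundary has one
  independent of \<open>t\<close>. This yields additivity, compatibility with refinement and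
  vanishing on coboundaries of \<open>hol\<close>.\<close>

lemma cech_1: "product_group {..<m} (\<lambda>_. integer_group) \<cong> cech_cohomology 1 X"
proof (rule cech_iso[where v = hol])
  fix \<U> c assume "\<U> \<in> open_covers X" "c \<in> nerve_cocycles 1 \<U>" "\<forall>j<m. hol \<U> c j = 0"
  then show "\<exists>\<V>\<in>open_covers X. \<exists>p\<in>refinement_projections \<U> \<V>. nerve_pullback 1 \<V> p c \<in> nerve_coboundaries 1 \<V>"
    by (rule hol_zero_trivial)
next
  fix k show "\<exists>\<U>\<in>open_covers X. \<exists>c\<in>nerve_cocycles 1 \<U>. \<forall>j<m. hol \<U> c j = k j" by (rule hol_surj)
next
  fix \<U> show "nerve_coboundaries 1 \<U> \<subseteq> nerve_cocycles 1 \<U>" by (rule coboundaries_1_subset)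
next
  fix \<U> \<V> p c assume "p \<in> refinement_projections \<U> \<V>" "c \<in> nerve_coboundaries 1 \<U>"
  then show "nerve_pullback 1 \<V> p c \<in> nerve_coboundaries 1 \<V>" by (rule nerve_pullback_coboundary)
next
  fix \<U> \<V> p q c
  assume "p \<in> refinement_projections \<U> \<V>" "q \<in> refinement_projections \<U> \<V>" "c \<in> nerve_cocycles 1 \<U>"
  then show "(\<lambda>s. nerve_pullback 1 \<V> p c s - nerve_pullback 1 \<V> q c s) \<in> nerve_coboundaries 1 \<V>"
    by (rule nerve_pullback_projections_1)
next
  fix \<U> \<V> p c
  assume U: "\<U> \<in> open_covers X" and V: "\<V> \<in> open_covers X" and p: "p \<in> refinement_projections \<U> \<V>"
    and c: "c \<in> nerve_cocycles 1 \<U>"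
  have pV: "p W \<in> \<U>" "W \<subseteq> p W" if "W \<in> \<V>" for W using p that by (auto simp: refinement_projections_def)
  have "hol \<V> (nerve_pullback 1 \<V> p c) j = hol \<U> c j" if j: "j < m" for j
  proof -
    obtain b where b: "triv 1 j \<U> c b" using triv_exists[OF U c j] by blast
    \<comment> \<open>A trivialization over the coarse cover is evaluated at \<open>p W\<close>, so
      both holonomies are one and the same increment.\<close>
    have "triv 1 j \<V> (nerve_pullback 1 \<V> p c) (\<lambda>t W. b t (p W))"
      unfolding triv_def
    proof (intro conjI ballI impI)
      fix t W W' assume t: "t \<in> {0..1}" and W: "W \<in> \<V>" "W' \<in> \<V>" "\<gamma> j t \<in> W" "\<gamma> j t \<in> W'"
      have "b t (p W') - b t (p W) = c [p W, p W']"
        using trivD(1)[OF b _ _ pV(1)[OF W(1)] pV(1)[OF W(2)], of t] t pV(2)[OF W(1)] pV(2)[OF W(2)] W(3,4) by auto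
      moreover have "[W, W'] \<in> nerve_simplices 1 \<V>" using W by (auto simp: simplices_1 simp del: One_nat_def)
      ultimately show "b t (p W') - b t (p W) = nerve_pullback 1 \<V> p c [W, W']" by (simp add: nerve_pullback_def)
    next
      fix t W assume t: "t \<in> {0..1}" and W: "W \<in> \<V>" "\<gamma> j t \<in> W"
      obtain e where e: "e > 0" "\<forall>s. \<bar>s - t\<bar> < e \<longrightarrow> \<gamma> j s \<in> W" using member_near[OF V W(1) j W(2)] by blast
      obtain d where d: "d > 0" "\<forall>s\<in>{0..1}. \<bar>s - t\<bar> < d \<longrightarrow> \<gamma> j s \<in> p W \<and> b s (p W) = b t (p W)"
        using trivD(2)[OF b _ _ pV(1)[OF W(1)], of t] t pV(2)[OF W(1)] W(2) by auto
      show "\<exists>d>0. \<forall>s\<in>{0..1}. \<bar>s - t\<bar> < d \<longrightarrow> \<gamma> j s \<in> W \<and> b s (p W) = b t (p W)"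
        using d e by (intro exI[of _ "min d e"]) simp
    qed
    moreover obtain W where W: "W \<in> \<V>" "\<gamma> j 0 \<in> W" using cover_member[OF V top[OF j]] by blast
    ultimately have "hol \<V> (nerve_pullback 1 \<V> p c) j = b 1 (p W) - b 0 (p W)" by (intro hol_eq[OF V j])
    also have "\<dots> = hol \<U> c j" using hol_eq[OF U j b pV(1)[OF W(1)]] pV(2)[OF W(1)] W(2) by auto
    finally show ?thesis .
  qed
  then show "nerve_pullback 1 \<V> p c \<in> nerve_cocycles 1 \<V> \<and> (\<forall>j<m. hol \<V> (nerve_pullback 1 \<V> p c) j = hol \<U> c j)"
    using nerve_pullback_cocycle[OF p c] by blast
next
  fix \<U> c d j
  assume U: "\<U> \<in> open_covers X" and c: "c \<in> nerve_cocycles 1 \<U>" and d: "d \<in> nerve_cocycles 1 \<U>" and j: "j < m"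
  obtain b where b: "triv 1 j \<U> c b" using triv_exists[OF U c j] by blast
  obtain b' where b': "triv 1 j \<U> d b'" using triv_exists[OF U d j] by blast
  have "triv 1 j \<U> (\<lambda>s. c s + d s) (\<lambda>t V. b t V + b' t V)"
    unfolding triv_def
  proof (intro conjI ballI impI)
    fix t V W assume t: "t \<in> {0..1}" and V: "V \<in> \<U>" "W \<in> \<U>" "\<gamma> j t \<in> V" "\<gamma> j t \<in> W"
    then show "b t W + b' t W - (b t V + b' t V) = c [V, W] + d [V, W]"
      using trivD(1)[OF b _ _ V] trivD(1)[OF b' _ _ V] by auto
  next
    fix t V assume t: "t \<in> {0..1}" and V: "V \<in> \<U>" "\<gamma> j t \<in> V"
    obtain e where e: "e > 0" "\<forall>s\<in>{0..1}. \<bar>s - t\<bar> < e \<longrightarrow> \<gamma> j s \<in> V \<and> b s V = b t V"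
      using trivD(2)[OF b _ _ V] t by auto
    obtain e' where e': "e' > 0" "\<forall>s\<in>{0..1}. \<bar>s - t\<bar> < e' \<longrightarrow> \<gamma> j s \<in> V \<and> b' s V = b' t V"
      using trivD(2)[OF b' _ _ V] t by auto
    show "\<exists>d>0. \<forall>s\<in>{0..1}. \<bar>s - t\<bar> < d \<longrightarrow> \<gamma> j s \<in> V \<and> b s V + b' s V = b t V + b' t V"
      using e e' by (intro exI[of _ "min e e'"]) simp
  qed
  moreover obtain W where W: "W \<in> \<U>" "\<gamma> j 0 \<in> W" using cover_member[OF U top[OF j]] by blast
  ultimately have "hol \<U> (\<lambda>s. c s + d s) j = (b 1 W + b' 1 W) - (b 0 W + b' 0 W)" by (intro hol_eq[OF U j])
  then show "hol \<U> (\<lambda>s. c s + d s) j = hol \<U> c j + hol \<U> d j"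
    using hol_eq[OF U j b W] hol_eq[OF U j b' W] by simp
next
  fix \<U> c j assume U: "\<U> \<in> open_covers X" and c: "c \<in> nerve_coboundaries 1 \<U>" and j: "j < m"
  obtain a where a: "c = nerve_coboundary 0 \<U> a" using c by auto
  have "triv 1 j \<U> c (\<lambda>t V. a [V])"
    unfolding triv_def
  proof (intro conjI ballI impI)
    fix t V W assume "V \<in> \<U>" "W \<in> \<U>" "\<gamma> j t \<in> V" "\<gamma> j t \<in> W"
    then show "a [W] - a [V] = c [V, W]" unfolding a by (rule coboundary_0[symmetric])
  next
    fix t V assume V: "V \<in> \<U>" "\<gamma> j t \<in> V"
    then show "\<exists>d>0. \<forall>s\<in>{0..1}. \<bar>s - t\<bar> < d \<longrightarrow> \<gamma> j s \<in> V \<and> a [V] = a [V]"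
      using member_near[OF U V(1) j V(2)] by blast
  qed
  moreover obtain W where W: "W \<in> \<U>" "\<gamma> j 0 \<in> W" using cover_member[OF U top[OF j]] by blast
  ultimately have "hol \<U> c j = a [W] - a [W]" by (intro hol_eq[OF U j])
  then show "hol \<U> c j = 0" by simp
qed

end

section \<open>Conclusion\<close>

lemma cis_2pi_eq_iff: "cis (2 * pi * s) = cis (2 * pi * t) \<longleftrightarrow> s - t \<in> \<int>"
proof
  assume "cis (2 * pi * s) = cis (2 * pi * t)"
  then have "cis (2 * pi * (s - t)) = 1"
    by (simp add: right_diff_distrib flip: cis_divide)
  then have "cos (2 * pi * (s - t)) = 1" by (simp add: complex_eq_iff)
  then obtain n :: int where "2 * pi * (s - t) = of_int n * 2 * pi" using cos_one_2pi_int by blast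
  then have "2 * pi * (s - t) = 2 * pi * of_int n" by (simp only: mult.commute mult.left_commute)
  then have "s - t = of_int n" by (subst (asm) mult_left_cancel) simp_all
  then show "s - t \<in> \<int>" by simp
next
  assume "s - t \<in> \<int>"
  then obtain n :: int where "s = t + of_int n" by (metis Ints_cases add.commute diff_add_cancel)
  moreover have "cis (2 * pi * of_int n) = 1" by (rule cis_multiple_2pi) simp
  ultimately show "cis (2 * pi * s) = cis (2 * pi * t)"
    by (simp add: distrib_left flip: cis_mult)
qed

text \<open>\<open>Arg\<close> is continuous at 1 and serves as a local inverse: a nearby point of
  the circle is \<open>z\<close> times a unit number of small argument, which shifts the parameter
  only a little.\<close>

lemma open_map_cis_2pi:
  assumes "open S" shows "openin (top_of_set (sphere (0::complex) 1)) ((\<lambda>t. cis (2 * pi * t)) ` S)"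
  unfolding openin_euclidean_subtopology_iff
proof (intro conjI ballI)
  fix z assume "z \<in> (\<lambda>t. cis (2 * pi * t)) ` S"
  then obtain t where t: "t \<in> S" "z = cis (2 * pi * t)" by blast
  obtain e where e: "e > 0" "\<forall>s. \<bar>s - t\<bar> < e \<longrightarrow> s \<in> S"
    using assms t(1) unfolding open_dist dist_real_def by blast
  have "isCont Arg 1" by (rule continuous_at_Arg) (simp add: complex_nonpos_Reals_iff)
  then obtain d where d: "d > 0" "\<forall>w. dist w 1 < d \<longrightarrow> dist (Arg w) (Arg 1) < 2 * pi * e"
    unfolding continuous_at_eps_delta using e(1) pi_gt_zero by (metis mult_pos_pos zero_less_numeral)
  show "\<exists>d>0. \<forall>y\<in>sphere 0 1. dist y z < d \<longrightarrow> y \<in> (\<lambda>t. cis (2 * pi * t)) ` S"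
  proof (intro exI[of _ d] conjI ballI impI d(1))
    fix y :: complex assume y: "y \<in> sphere 0 1" "dist y z < d"
    define w where "w = y / z"
    have nz: "norm z = 1" "z \<noteq> 0" using t(2) by auto
    have "w - 1 = (y - z) / z" using nz by (simp add: w_def diff_divide_distrib)
    then have "dist w 1 < d" using y(2) nz by (simp add: dist_norm norm_divide)
    then have A: "\<bar>Arg w\<bar> < 2 * pi * e" using d(2) by (simp add: dist_real_def)
    have "norm w = 1" "w \<noteq> 0" using y(1) nz by (auto simp: w_def norm_divide)
    then have "w = cis (Arg w)" using cis_Arg[of w] by (simp add: sgn_div_norm)
    moreover have "y = z * w" using nz by (simp add: w_def)
    ultimately have "y = cis (2 * pi * t) * cis (Arg w)" using t(2) by simp
    then have "y = cis (2 * pi * t + Arg w)" unfolding cis_mult .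
    also have "2 * pi * t + Arg w = 2 * pi * (t + Arg w / (2 * pi))" by (simp add: field_simps)
    finally have "y = cis (2 * pi * (t + Arg w / (2 * pi)))" .
    moreover have "\<bar>Arg w / (2 * pi)\<bar> < e" using A by (simp add: abs_divide field_simps)
    then have "t + Arg w / (2 * pi) \<in> S" using e(2) by simp
    ultimately show "y \<in> (\<lambda>t. cis (2 * pi * t)) ` S" by blast
  qed
qed auto

text \<open>The homeomorphism is composed with the covering of each circle by the line. Injectivity
  modulo integers and openness come from the covering, disjointness of the circles from the
  sum.\<close>

lemma homeomorphic_map_circle_family:
  assumes f: "homeomorphic_map (sum_topology (\<lambda>_. top_of_set (sphere (0::complex) 1)) {..<m}) X f"
  shows "circle_family X m (\<lambda>j t. f (j, cis (2 * pi * t)))"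
proof -
  let ?C = "sum_topology (\<lambda>_. top_of_set (sphere (0::complex) 1)) {..<m}"
  have inj: "inj_on f (topspace ?C)" and im: "f ` topspace ?C = topspace X"
    by (rule homeomorphic_imp_injective_map[OF f], rule homeomorphic_imp_surjective_map[OF f])
  have C: "topspace ?C = {..<m} \<times> sphere 0 1" by (auto simp: topspace_sum_topology)
  have mem: "(j, cis r) \<in> topspace ?C" if "j < m" for j r using that unfolding C by simp
  show ?thesis
  proof
    fix j :: nat and t :: real assume "j < m"
    then show "f (j, cis (2 * pi * t)) \<in> topspace X" using mem im by blast
  next
    fix x assume "x \<in> topspace X"
    then have "x \<in> f ` ({..<m} \<times> sphere 0 1)" unfolding im[symmetric] C .
    then obtain j z where j: "j < m" "norm z = 1" "x = f (j, z)" by auto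
    moreover have "z \<noteq> 0" using j(2) by auto
    ultimately have "z = cis (Arg z)" using cis_Arg[of z] by (simp add: sgn_div_norm)
    then have "z = cis (2 * pi * (Arg z / (2 * pi)))" by simp
    then show "\<exists>j<m. \<exists>t. x = f (j, cis (2 * pi * t))" using j by metis
  next
    fix i j :: nat and s t :: real assume "i < m" "j < m"
    then have "f (i, cis (2 * pi * s)) = f (j, cis (2 * pi * t)) \<longleftrightarrow> (i, cis (2 * pi * s)) = (j, cis (2 * pi * t))"
      by (intro inj_on_eq_iff[OF inj] mem)
    then show "f (i, cis (2 * pi * s)) = f (j, cis (2 * pi * t)) \<longleftrightarrow> i = j \<and> s - t \<in> \<int>"
      by (simp add: cis_2pi_eq_iff)
  next
    fix U and j :: nat assume U: "openin X U" and j: "j < m"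
    have "continuous_map ?C X f" using f by (rule homeomorphic_imp_continuous_map)
    moreover have "continuous_map euclidean (top_of_set (sphere (0::complex) 1)) (\<lambda>t. cis (2 * pi * t))"
      by (auto simp: continuous_map_in_subtopology continuous_map_iff_continuous2 intro!: continuous_intros)
    then have "continuous_map euclidean ?C (Pair j \<circ> (\<lambda>t. cis (2 * pi * t)))"
      using j by (intro continuous_map_compose[OF _ continuous_map_component_injection]) auto
    ultimately have "continuous_map euclidean X (f \<circ> (Pair j \<circ> (\<lambda>t. cis (2 * pi * t))))"
      by (rule continuous_map_compose[rotated])
    then show "open {t. f (j, cis (2 * pi * t)) \<in> U}"
      using openin_continuous_map_preimage[OF _ U] by (force simp: o_def)
  next
    fix j :: nat and S :: "real set" assume j: "j < m" and S: "open S"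
    have "openin ?C (Pair j ` (\<lambda>t. cis (2 * pi * t)) ` S)"
      using open_map_component_injection[of j "{..<m}" "\<lambda>_. top_of_set (sphere (0::complex) 1)"]
        j open_map_cis_2pi[OF S] by (simp add: open_map_def)
    then have "openin X (f ` Pair j ` (\<lambda>t. cis (2 * pi * t)) ` S)"
      using homeomorphic_imp_open_map[OF f] by (simp add: open_map_def)
    then show "openin X ((\<lambda>t. f (j, cis (2 * pi * t))) ` S)" by (simp add: image_image)
  qed
qed

lemma cech_iso_conclusion:
  assumes "product_group {..<m::nat} (\<lambda>_. integer_group) \<cong> A" "product_group {..<m} (\<lambda>_. integer_group) \<cong> B"
  shows "A \<cong> B" "B \<cong> product_group {..<m} (\<lambda>_. integer_group)"
proof -
  have "group (product_group {..<m} (\<lambda>_. integer_group))" by (simp add: group_integer_group)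
  note s = group.iso_sym[OF this]
  show "A \<cong> B" using s[OF assms(1)] assms(2) by (rule iso_trans)
  show "B \<cong> product_group {..<m} (\<lambda>_. integer_group)" using assms(2) by (rule s)
qed

theorem mainTheorem5:
  shows "card (invariant_tilings H2 // rotation_related) = 6
    \<and> invariant_tiling_space H2 homeomorphic_space
        sum_topology (\<lambda>_. top_of_set (sphere (0::complex) 1)) {..<6::nat}
    \<and> cech_cohomology 0 (invariant_tiling_space H2) \<cong> cech_cohomology 1 (invariant_tiling_space H2)
    \<and> cech_cohomology 1 (invariant_tiling_space H2) \<cong> product_group {..<6::nat} (\<lambda>_. integer_group)"
proof -
  interpret circle_family "invariant_tiling_space H2" 6 "\<lambda>j t. circle_map (j, cis (2 * pi * t))"
    by (rule homeomorphic_map_circle_family[OF circle_map_homeomorphic])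
  have "invariant_tiling_space H2 homeomorphic_space circles"
    using homeomorphic_map_imp_homeomorphic_space[OF circle_map_homeomorphic]
    by (rule homeomorphic_space_sym[THEN iffD1])
  then show ?thesis
    by (intro conjI card_orbits cech_iso_conclusion(1)[OF cech_0 cech_1] cech_iso_conclusion(2)[OF cech_0 cech_1])
qed

end
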